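(* Assume $\Delta=0$ (so the equations are $\delta u=\alpha u^{(p)}$). 1) There is a Zariski closed subset $\Omega\subset GL_n(K^a)$ with $1\notin\Omega$ such that for every $u\in GL_n(R)\setminus\Omega$ the following holds: setting $\alpha=\delta u\cdot(u^{(p)})^{-1}$, for every valuation $\delta$-subring $\mathcal O$ of $R$ containing the entries of $\alpha$, the group $G_{u/\mathcal O}$ contains a normal subgroup of finite index which is diagonalizable (i.e. conjugate in $GL_n(K^a)$ to a group of diagonal matrices). 2) There is a subset $\Omega$ of the first category in the metric space $X=\{u\in GL_n(R): u\equiv 1\bmod p\}$ (with the $p$-adic metric) such that for every $u\in X\setminus\Omega$ the following holds: setting $\alpha=\delta u\cdot(u^{(p)})^{-1}$, there exists a valuation $\delta$-subring $\mathcal O$ of $R$ containing $R^\delta$ with $\alpha\in\mathfrak{gl}_n(\mathcal O)$ and $G_{u/\mathcal O}=N^\delta$.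
   Context: Let $p$ be an odd prime, $R$ the unique complete discrete valuation ring with maximal ideal $pR$ and residue field an algebraic closure of $\mathbb F_p$, $K$ its fraction field, $K^a$ an algebraic closure of $K$. $\phi:R\to R$ is the unique lift of Frobenius, $\delta a=(\phi(a)-a^p)/p$; on matrices $\phi,\delta$ act entrywise and $u^{(p)}=(u_{ij}^p)$. $R^\delta=\{\lambda\in R:\delta\lambda=0\}$ (zero and the roots of unity). A $\delta$-subring of $R$ is a subring closed under $\delta$; a valuation subring of $R$ is the intersection of $R$ with a subfield of $K$. A subset of a metric space is of the first category if it is a countable union of sets whose closures have empty interior. For a $\delta$-subring $\mathcal O$, $\alpha\in\mathfrak{gl}_n(\mathcal O)$ and $u\in GL_n(R)$ with $\delta u=\alpha u^{(p)}$: $\mathcal O\{u\}$ is the subring of $R$ generated by $\mathcal O$ and the entries of $u,\delta u,\delta^2u,\dots$; $\tilde G_{u/\mathcal O}$ is the group of $\mathcal O$-algebra automorphisms $\sigma$ of $\mathcal O\{u\}$ commuting with $\delta$ and satisfying $u^{-1}\sigma(u)\in GL_n(\mathcal O)$; $G_{u/\mathcal O}$ is the image of the injective homomorphism $\tilde G_{u/\mathcal O}\to GL_n(\mathcal O)$, $\sigma\mapsto u^{-1}\sigma(u)$. $T\subset GL_n(R)$ is the group of diagonal matrices, $W$ the group of permutation matrices, $N=WT$; $N^\delta$ is the subgroup of $N$ of matrices all of whose entries lie in $R^\delta$ (equivalently $N^\delta=WT^\delta$, $T^\delta$ the diagonal matrices with root-of-unity diagonal entries). *)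

theory Defs
  imports "HOL-Analysis.Analysis" "HOL-Computational_Algebra.Polynomial" "HOL-Algebra.Coset"
begin

section \<open>The ring R = W(F_p^a), characterised by hypotheses\<close>

text \<open>R is modelled as a type 'r; the standing hypotheses (complete DVR with maximal
ideal pR, residue field an algebraic closure of F_p, phi a lift of Frobenius,
iota : R -> K^a an embedding into an algebraic closure of Frac R) are collected
in the predicate delta_setting.\<close>

definition padic_complete :: "nat \<Rightarrow> ('r::comm_ring_1) itself \<Rightarrow> bool" where
  "padic_complete p _ \<longleftrightarrow>
     (\<forall>x :: nat \<Rightarrow> 'r.
        (\<forall>k. \<exists>N. \<forall>m\<ge>N. (of_nat p :: 'r) ^ k dvd (x m - x N)) \<longrightarrow>
        (\<exists>l. \<forall>k. \<exists>N. \<forall>m\<ge>N. (of_nat p :: 'r) ^ k dvd (x m - l)))"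

definition dvr_with_uniformizer :: "nat \<Rightarrow> ('r::idom) itself \<Rightarrow> bool" where
  "dvr_with_uniformizer p _ \<longleftrightarrow>
     (of_nat p :: 'r) \<noteq> 0 \<and> \<not> ((of_nat p :: 'r) dvd 1) \<and>
     (\<forall>x :: 'r. x \<noteq> 0 \<longrightarrow> (\<exists>k v. v dvd 1 \<and> x = (of_nat p) ^ k * v))"

definition residue_field_alg_closure_Fp :: "nat \<Rightarrow> ('r::idom) itself \<Rightarrow> bool" where
  "residue_field_alg_closure_Fp p _ \<longleftrightarrow>
     (\<forall>f :: 'r poly. degree f \<ge> 1 \<longrightarrow> lead_coeff f = 1 \<longrightarrow>
        (\<exists>x. (of_nat p :: 'r) dvd poly f x)) \<and>
     (\<forall>x :: 'r. \<exists>m\<ge>1. (of_nat p :: 'r) dvd (x ^ (p ^ m) - x))"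

definition frobenius_lift :: "nat \<Rightarrow> ('r::idom \<Rightarrow> 'r) \<Rightarrow> bool" where
  "frobenius_lift p \<phi> \<longleftrightarrow>
     \<phi> 1 = 1 \<and> (\<forall>x y. \<phi> (x + y) = \<phi> x + \<phi> y \<and> \<phi> (x * y) = \<phi> x * \<phi> y) \<and>
     (\<forall>x. (of_nat p :: 'r) dvd (\<phi> x - x ^ p))"

definition alg_closure_embedding :: "('r::idom \<Rightarrow> 'a::field) \<Rightarrow> bool" where
  "alg_closure_embedding \<iota> \<longleftrightarrow>
     inj \<iota> \<and> \<iota> 1 = 1 \<and> (\<forall>x y. \<iota> (x + y) = \<iota> x + \<iota> y \<and> \<iota> (x * y) = \<iota> x * \<iota> y) \<and>
     (\<forall>f :: 'a poly. degree f \<ge> 1 \<longrightarrow> (\<exists>z. poly f z = 0)) \<and>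
     (\<forall>z :: 'a. \<exists>f :: 'r poly. f \<noteq> 0 \<and> poly (map_poly \<iota> f) z = 0)"

definition delta_setting :: "nat \<Rightarrow> ('r::idom \<Rightarrow> 'r) \<Rightarrow> ('r \<Rightarrow> 'a::field) \<Rightarrow> bool" where
  "delta_setting p \<phi> \<iota> \<longleftrightarrow>
     prime p \<and> odd p \<and> dvr_with_uniformizer p TYPE('r) \<and> padic_complete p TYPE('r) \<and>
     residue_field_alg_closure_Fp p TYPE('r) \<and> frobenius_lift p \<phi> \<and> alg_closure_embedding \<iota>"

section \<open>delta and its matrix versions\<close>

definition delta :: "nat \<Rightarrow> ('r::idom \<Rightarrow> 'r) \<Rightarrow> 'r \<Rightarrow> 'r" where
  "delta p \<phi> a = (THE b. of_nat p * b = \<phi> a - a ^ p)"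

definition Rdelta :: "nat \<Rightarrow> ('r::idom \<Rightarrow> 'r) \<Rightarrow> 'r set" where
  "Rdelta p \<phi> = {x. delta p \<phi> x = 0}"

definition mmap :: "('a \<Rightarrow> 'b) \<Rightarrow> 'a^'n^'m \<Rightarrow> 'b^'n^'m" where
  "mmap f u = (\<chi> i j. f (u $ i $ j))"

definition mdelta :: "nat \<Rightarrow> ('r::idom \<Rightarrow> 'r) \<Rightarrow> 'r^'n^'m \<Rightarrow> 'r^'n^'m" where
  "mdelta p \<phi> u = mmap (delta p \<phi>) u"

text \<open>u^(p)\<close>
definition mfrob :: "nat \<Rightarrow> ('r::idom)^'n^'m \<Rightarrow> 'r^'n^'m" where
  "mfrob p u = mmap (\<lambda>x. x ^ p) u"

text \<open>alpha = delta u * (u^(p))^{-1}\<close>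
definition alpha_of :: "nat \<Rightarrow> ('r::idom \<Rightarrow> 'r) \<Rightarrow> 'r^'n^'n \<Rightarrow> 'r^'n^'n" where
  "alpha_of p \<phi> u = mdelta p \<phi> u ** matrix_inv (mfrob p u)"

definition entries :: "'a^'n^'m \<Rightarrow> 'a set" where
  "entries u = {u $ i $ j | i j. True}"

section \<open>Subrings\<close>

definition is_subring :: "('r::comm_ring_1) set \<Rightarrow> bool" where
  "is_subring S \<longleftrightarrow> 0 \<in> S \<and> 1 \<in> S \<and>
     (\<forall>x\<in>S. \<forall>y\<in>S. x + y \<in> S \<and> x * y \<in> S) \<and> (\<forall>x\<in>S. - x \<in> S)"

definition delta_subring :: "nat \<Rightarrow> ('r::idom \<Rightarrow> 'r) \<Rightarrow> 'r set \<Rightarrow> bool" where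
  "delta_subring p \<phi> S \<longleftrightarrow> is_subring S \<and> (\<forall>x\<in>S. delta p \<phi> x \<in> S)"

definition is_subfield :: "('a::field) set \<Rightarrow> bool" where
  "is_subfield F \<longleftrightarrow> is_subring F \<and> (\<forall>x\<in>F. x \<noteq> 0 \<longrightarrow> inverse x \<in> F)"

text \<open>R \<inter> F for a subfield F of K (K = Frac R, embedded in K^a via iota).
Taking F an arbitrary subfield of K^a gives the same class, as R \<inter> F = R \<inter> (F \<inter> K).\<close>
definition valuation_subring :: "('r::idom \<Rightarrow> 'a::field) \<Rightarrow> 'r set \<Rightarrow> bool" where
  "valuation_subring \<iota> S \<longleftrightarrow> (\<exists>F. is_subfield F \<and> S = {x. \<iota> x \<in> F})"

definition ring_gen :: "('r::comm_ring_1) set \<Rightarrow> 'r set" where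
  "ring_gen A = \<Inter> {T. is_subring T \<and> A \<subseteq> T}"

text \<open>O{u}\<close>
definition delta_ext :: "nat \<Rightarrow> ('r::idom \<Rightarrow> 'r) \<Rightarrow> 'r set \<Rightarrow> 'r^'n^'n \<Rightarrow> 'r set" where
  "delta_ext p \<phi> Ob u = ring_gen (Ob \<union> (\<Union>k. entries ((mdelta p \<phi> ^^ k) u)))"

text \<open>GL_n(O)\<close>
definition GL_over :: "('r::comm_ring_1) set \<Rightarrow> ('r^'n^'n) set" where
  "GL_over Ob = {M. entries M \<subseteq> Ob \<and>
      (\<exists>M'. entries M' \<subseteq> Ob \<and> M ** M' = mat 1 \<and> M' ** M = mat 1)}"

text \<open>tilde G_{u/O}: Ob-algebra automorphisms of Ob{u} commuting with delta,
with u^{-1} sigma(u) in GL_n(O)\<close>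
definition tildeG :: "nat \<Rightarrow> ('r::idom \<Rightarrow> 'r) \<Rightarrow> 'r set \<Rightarrow> 'r^'n^'n \<Rightarrow> ('r \<Rightarrow> 'r) set" where
  "tildeG p \<phi> Ob u = {\<sigma>. let A = delta_ext p \<phi> Ob u in
      bij_betw \<sigma> A A \<and>
      (\<forall>x\<in>A. \<forall>y\<in>A. \<sigma> (x + y) = \<sigma> x + \<sigma> y \<and> \<sigma> (x * y) = \<sigma> x * \<sigma> y) \<and>
      (\<forall>x\<in>Ob. \<sigma> x = x) \<and>
      (\<forall>x\<in>A. \<sigma> (delta p \<phi> x) = delta p \<phi> (\<sigma> x)) \<and>
      matrix_inv u ** mmap \<sigma> u \<in> GL_over Ob}"

text \<open>G_{u/O}\<close>
definition Ggal :: "nat \<Rightarrow> ('r::idom \<Rightarrow> 'r) \<Rightarrow> 'r set \<Rightarrow> 'r^'n^'n \<Rightarrow> ('r^'n^'n) set" where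
  "Ggal p \<phi> Ob u = {matrix_inv u ** mmap \<sigma> u | \<sigma>. \<sigma> \<in> tildeG p \<phi> Ob u}"

section \<open>Groups of matrices\<close>

definition mat_group :: "('r^'n^'n) set \<Rightarrow> ('r::comm_ring_1^'n^'n) monoid" where
  "mat_group G = \<lparr>carrier = G, mult = (**), one = mat 1\<rparr>"

definition is_diag :: "('a::zero)^'n^'n \<Rightarrow> bool" where
  "is_diag M \<longleftrightarrow> (\<forall>i j. i \<noteq> j \<longrightarrow> M $ i $ j = 0)"

text \<open>H (a set of matrices over R) is conjugate in GL_n(K^a) to a group of diagonal matrices\<close>
definition diagonalizable_over :: "('r \<Rightarrow> 'a::field) \<Rightarrow> ('r^'n^'n) set \<Rightarrow> bool" where
  "diagonalizable_over \<iota> H \<longleftrightarrow>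
     (\<exists>P :: 'a^'n^'n. invertible P \<and> (\<forall>h\<in>H. is_diag (matrix_inv P ** mmap \<iota> h ** P)))"

definition perm_mat :: "('n \<Rightarrow> 'n) \<Rightarrow> ('r::comm_ring_1)^'n^'n" where
  "perm_mat \<pi> = (\<chi> i j. if i = \<pi> j then 1 else 0)"

definition diag_mat :: "('n \<Rightarrow> 'r) \<Rightarrow> ('r::comm_ring_1)^'n^'n" where
  "diag_mat d = (\<chi> i j. if i = j then d i else 0)"

text \<open>N = W T (W permutation matrices, T invertible diagonal matrices)\<close>
definition Ngrp :: "('r::comm_ring_1^'n^'n) set" where
  "Ngrp = {perm_mat \<pi> ** diag_mat d | \<pi> d. \<pi> permutes UNIV \<and> (\<forall>i. d i dvd 1)}"

definition Ndelta :: "nat \<Rightarrow> ('r::idom \<Rightarrow> 'r) \<Rightarrow> ('r^'n^'n) set" where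
  "Ndelta p \<phi> = {M \<in> Ngrp. entries M \<subseteq> Rdelta p \<phi>}"

section \<open>Zariski closed subsets of GL_n(K^a)\<close>

inductive_set polyfun :: "(('a::comm_ring_1^'n^'n) \<Rightarrow> 'a) set" where
  const: "(\<lambda>M. c) \<in> polyfun"
| coord: "(\<lambda>M. M $ i $ j) \<in> polyfun"
| add: "f \<in> polyfun \<Longrightarrow> g \<in> polyfun \<Longrightarrow> (\<lambda>M. f M + g M) \<in> polyfun"
| mult: "f \<in> polyfun \<Longrightarrow> g \<in> polyfun \<Longrightarrow> (\<lambda>M. f M * g M) \<in> polyfun"

definition zariski_closed_GL :: "('a::field^'n^'n) set \<Rightarrow> bool" where
  "zariski_closed_GL \<Omega> \<longleftrightarrow>
     (\<exists>S \<subseteq> polyfun. \<Omega> = {M. invertible M \<and> (\<forall>f\<in>S. f M = 0)})"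

section \<open>The p-adic metric space X and first category\<close>

definition Xspace :: "nat \<Rightarrow> ('r::idom^'n^'n) set" where
  "Xspace p = {u. invertible u \<and> (\<forall>x\<in>entries (u - mat 1). (of_nat p :: 'r) dvd x)}"

definition padic_dist :: "nat \<Rightarrow> ('r::idom^'n^'n) \<Rightarrow> 'r^'n^'n \<Rightarrow> real" where
  "padic_dist p u v = (if u = v then 0 else
     (1 / real p) ^ (GREATEST k. \<forall>x\<in>entries (u - v). (of_nat p :: 'r) ^ k dvd x))"

definition first_category :: "'x topology \<Rightarrow> 'x set \<Rightarrow> bool" where
  "first_category T \<Omega> \<longleftrightarrow>
     (\<exists>A :: nat \<Rightarrow> 'x set. \<Omega> = (\<Union>i. A i) \<and>
        (\<forall>i. A i \<subseteq> topspace T \<and> T interior_of (T closure_of (A i)) = {}))"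

end

theory Submission
  imports Defs "HOL-Computational_Algebra.Fundamental_Theorem_Algebra"
begin

text \<open>
  Part 1 holds with \<open>\<Omega> = {}\<close>. An element \<open>c\<close> of the Galois group satisfies
  \<open>u\<^sup>(\<^sup>p\<^sup>) \<phi>(c) = (uc)\<^sup>(\<^sup>p\<^sup>)\<close>, and this equation determines \<open>c\<close> by its reduction modulo \<open>p\<close>: a congruence modulo
  \<open>p\<^sup>k\<close> between two solutions improves to one modulo \<open>p\<^sup>k\<^sup>+\<^sup>1\<close>. So the group embeds into \<open>GL\<^sub>n\<close> of an algebraic
  closure of the prime field and is locally finite. By Jordan's theorem, applied to the finite subgroups after
  embedding the finitely generated ring of their entries into the complex numbers, it is abelian by
  finite, and commuting matrices of finite order over an algebraically closed field of
  characteristic 0 are simultaneously diagonalizable.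

  For part 2, a matrix \<open>u\<close> outside a set of the first category has all \<open>\<phi>\<^sup>k(u\<^sub>i\<^sub>j)\<close> algebraically independent over the
  countable set \<open>R\<^sup>\<delta>\<close>. Let \<open>O\<close> be the intersection of \<open>R\<close> with the field generated by \<open>R\<^sup>\<delta>\<close> and all
  \<open>\<phi>\<^sup>k(\<alpha>)\<close>. As \<open>\<phi>(u) = (1 + p\<alpha>) u\<^sup>(\<^sup>p\<^sup>)\<close>, the entries of \<open>u\<close> are algebraically independent over \<open>O\<close>, so the equation
  above becomes a polynomial identity in \<open>u\<close>, which forces \<open>c\<close> to be monomial with entries in \<open>R\<^sup>\<delta>\<close>;
  conversely such \<open>c\<close> act on \<open>O{u}\<close> by substitution.
\<close>

section \<open>Roots of unity and simultaneous diagonalization\<close>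

text \<open>Jordan's theorem only bounds the index of an abelian subgroup inside each finite
  subgroup, and the subgroups obtained need not fit together. The passage to the whole group
  therefore uses a conjugation invariant condition that can be tested on finite sets: having a
  centralizer of small index. The complex numbers enter because unitarity rests on a positive
  hermitian form, and finitely many matrix entries are embedded at a time. In part 2 the obstacle is
  that O depends on u through \<alpha>, so independence of u over O is not a condition over a fixed
  ring. The recursion \<phi>(v) = (1 + p\<alpha>) v^(p) turns u and the \<phi>-iterates of \<alpha>
  into the \<phi>-iterates of u, and Cramer's rule inverts it. A relation of u over O thus becomes a
  relation between the \<phi>^k(u_ij) over the fixed set \<open>Rdelta\<close>. There are countably
  many such relations, and each has a closed zero set without interior, because a nonzero polynomial
  cannot vanish at the jets of all matrices in a ball.\<close>

lemma matrix_inv_inverse: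
  fixes A :: "'a::semiring_1^'n^'n"
  assumes "invertible A"
  shows "A ** matrix_inv A = mat 1" "matrix_inv A ** A = mat 1"
proof -
  have "\<exists>B. A ** B = mat 1 \<and> B ** A = mat 1" using assms by (simp add: invertible_def)
  then have "A ** matrix_inv A = mat 1 \<and> matrix_inv A ** A = mat 1"
    unfolding matrix_inv_def by (rule someI_ex)
  then show "A ** matrix_inv A = mat 1" "matrix_inv A ** A = mat 1" by auto
qed

lemma prod_linear_factors_dvd:
  fixes f :: "'a::field poly"
  assumes "finite S" "\<And>z. z \<in> S \<Longrightarrow> poly f z = 0"
  shows "(\<Prod>z\<in>S. [:-z, 1:]) dvd f"
  using assms
proof (induction S arbitrary: f rule: finite_induct)
  case empty
  then show ?case by simp
next
  case (insert x S)
  from insert.prems[of x] obtain g where g: "f = [:-x, 1:] * g"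
    by (auto simp: poly_eq_0_iff_dvd)
  have "(\<Prod>z\<in>S. [:-z, 1:]) dvd g"
    by (rule insert.IH) (use insert.prems insert.hyps in \<open>auto simp: g\<close>)
  then show ?case
    unfolding g prod.insert[OF insert.hyps] by (rule mult_dvd_mono[OF dvd_refl])
qed

text \<open>The derivative N z^(N-1) vanishes only at 0, which is not a root of z^N - 1. If the
  product of the linear factors left a nonconstant cofactor, a root of the cofactor would be a
  double root.\<close>

lemma card_roots_of_unity:
  fixes N :: nat
  assumes ac: "\<forall>f :: 'a::field poly. degree f \<ge> 1 \<longrightarrow> (\<exists>z. poly f z = 0)"
    and "N > 0" and nz: "(of_nat N :: 'a) \<noteq> 0"
  shows "finite {z::'a. z ^ N = 1}" "card {z::'a. z ^ N = 1} = N"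
proof -
  define f where "f = monom (1::'a) N - 1"
  have pf: "poly f z = z ^ N - 1" for z by (simp add: f_def poly_monom)
  have df: "degree f = N"
    unfolding f_def using \<open>N > 0\<close> by (intro antisym degree_le le_degree) (auto simp: coeff_eq_0)
  have f0: "f \<noteq> 0" using df \<open>N > 0\<close> by auto
  have eq: "{z::'a. z ^ N = 1} = {z. poly f z = 0}" by (auto simp: pf)
  show fin: "finite {z::'a. z ^ N = 1}" unfolding eq using f0 by (rule poly_roots_finite)
  let ?R = "{z::'a. z ^ N = 1}"
  have "(\<Prod>z\<in>?R. [:-z, 1:]) dvd f"
    using fin by (rule prod_linear_factors_dvd) (simp add: pf)
  then obtain g where g: "f = (\<Prod>z\<in>?R. [:-z, 1:]) * g" by auto
  have g0: "g \<noteq> 0" using f0 g by auto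
  have "degree (\<Prod>z\<in>?R. [:-z, 1:]) = card ?R" by (simp add: degree_prod_sum_eq)
  then have deg: "N = card ?R + degree g"
    using df g g0 by (metis degree_mult_eq f0 mult_eq_0_iff)
  have "degree g = 0"
  proof (rule ccontr)
    assume "degree g \<noteq> 0"
    then obtain w where w: "poly g w = 0" using ac by (metis less_one not_less)
    then have "poly f w = 0" by (simp add: g)
    then have wR: "w \<in> ?R" by (simp add: pf)
    then have wN: "w ^ N = 1" by simp
    from w obtain g' where g': "g = [:-w, 1:] * g'" by (auto simp: poly_eq_0_iff_dvd)
    have "f = [:-w,1:] * ([:-w,1:] * ((\<Prod>z\<in>?R-{w}. [:-z, 1:]) * g'))"
      unfolding g g' prod.remove[OF fin wR, of "\<lambda>z. [:-z, 1:]"] by (simp only: mult_ac)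
    then have "poly (pderiv f) w = 0" by (simp add: pderiv_mult pderiv_pCons del: mult_pCons_left)
    moreover have "poly (pderiv f) w = of_nat N * w ^ (N - 1)"
      unfolding f_def by (simp add: pderiv_diff pderiv_monom poly_monom)
    ultimately have "w ^ (N-1) = 0" using nz by simp
    then have "w = 0" by simp
    with wN \<open>N > 0\<close> show False by (simp add: power_0_left)
  qed
  with deg show "card ?R = N" by simp
qed

text \<open>The polynomial z^j - 1 has at most j < N roots, so some root of unity w has w^j
  different from 1. Multiplication by w permutes the roots and multiplies the sum by w^j.\<close>

lemma sum_powers_roots_of_unity:
  fixes N j :: nat
  assumes ac: "\<forall>f :: 'a::field poly. degree f \<ge> 1 \<longrightarrow> (\<exists>z. poly f z = 0)"
    and nz: "(of_nat N :: 'a) \<noteq> 0" and j: "0 < j" "j < N"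
  shows "(\<Sum>z\<in>{z::'a. z ^ N = 1}. z ^ j) = 0"
proof -
  let ?R = "{z::'a. z ^ N = 1}"
  have N: "N > 0" using j by simp
  note R = card_roots_of_unity[OF ac N nz]
  have "\<exists>w\<in>?R. w ^ j \<noteq> 1"
  proof (rule ccontr)
    assume "\<not> (\<exists>w\<in>?R. w ^ j \<noteq> 1)"
    then have sub: "?R \<subseteq> {z. z ^ j = 1}" by auto
    define f where "f = monom (1::'a) j - 1"
    have df: "degree f = j"
      unfolding f_def using j by (intro antisym degree_le le_degree) (auto simp: coeff_eq_0)
    have "{z. z ^ j = 1} = {z. poly f z = 0}" by (auto simp: f_def poly_monom)
    moreover have "f \<noteq> 0" using df j by auto
    ultimately have "finite {z::'a. z ^ j = 1}" "card {z::'a. z ^ j = 1} \<le> j"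
      using poly_roots_finite[of f] card_poly_roots_bound[of f] df by auto
    with card_mono[OF _ sub] R j show False by auto
  qed
  then obtain w :: 'a where w: "w ^ N = 1" "w ^ j \<noteq> 1" by blast
  then have w0: "w \<noteq> 0" using N by (auto simp: power_0_left)
  have "bij_betw (\<lambda>z. w * z) ?R ?R"
    by (rule bij_betw_byWitness[where f' = "\<lambda>z. z / w"]) (use w w0 in \<open>auto simp: power_mult_distrib power_divide\<close>)
  then have "(\<Sum>z\<in>?R. z ^ j) = (\<Sum>z\<in>?R. (w * z) ^ j)"
    by (rule sum.reindex_bij_betw[symmetric, of _ _ _ "\<lambda>z. z ^ j"])
  also have "\<dots> = w ^ j * (\<Sum>z\<in>?R. z ^ j)" by (simp add: power_mult_distrib sum_distrib_left)
  finally have "(1 - w ^ j) * (\<Sum>z\<in>?R. z ^ j) = 0" by (simp add: algebra_simps)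
  with w show ?thesis by simp
qed

definition mpow :: "('a::comm_semiring_1)^'n^'n \<Rightarrow> nat \<Rightarrow> 'a^'n^'n" where
  "mpow A k = (((**) A) ^^ k) (mat 1)"

lemma mpow_0 [simp]: "mpow A 0 = mat 1"
  and mpow_Suc [simp]: "mpow A (Suc k) = A ** mpow A k"
  by (simp_all add: mpow_def)

lemma mpow_commute: "A ** B = B ** A \<Longrightarrow> mpow A k ** B = B ** mpow A k"
  by (induction k) (simp_all add: matrix_mul_assoc, metis matrix_mul_assoc)

definition eigvec :: "('a::field^'n^'n) set \<Rightarrow> 'a^'n \<Rightarrow> bool" where
  "eigvec L v \<longleftrightarrow> (\<forall>h\<in>L. \<exists>c. h *v v = c *s v)"

text \<open>The eigencomponents of \<open>v\<close> are the averages of \<open>z\<^sup>-\<^sup>j h\<^sup>j v\<close> over a period of \<open>h\<close>.\<close>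
lemma span_common_eigenvectors:
  fixes L :: "('a::field^'n^'n) set"
  assumes ac: "\<forall>f :: 'a poly. degree f \<ge> 1 \<longrightarrow> (\<exists>z. poly f z = 0)"
    and ch: "\<And>N. N > 0 \<Longrightarrow> (of_nat N :: 'a) \<noteq> 0"
    and "finite L"
    and "\<And>h. h \<in> L \<Longrightarrow> \<exists>N>0. mpow h N = mat 1"
    and "\<And>g h. g \<in> L \<Longrightarrow> h \<in> L \<Longrightarrow> g ** h = h ** g"
  shows "v \<in> vec.span {w. eigvec L w}"
  using assms(3-)
proof (induction L arbitrary: v rule: finite_induct)
  case empty
  then show ?case by (simp add: eigvec_def)
next
  case (insert h L)
  from insert.prems(1)[of h] obtain N where N: "N > 0" "mpow h N = mat 1" by auto
  let ?R = "{z::'a. z ^ N = 1}"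
  note R = card_roots_of_unity[OF ac N(1) ch[OF N(1)]]
  \<comment> \<open>For z^N = 1 the weight \<open>z ^ (N - j)\<close> is z^(-j), written without
    inverses.\<close>
  define e where "e z w = (\<Sum>j<N. z ^ (N - j) *s (mpow h j *v w))" for z and w :: "'a^'n"
  have ew: "eigvec (insert h L) (e z w)" if z: "z \<in> ?R" and w: "eigvec L w" for z w
  proof -
    have "h *v e z w = (\<Sum>j<N. z ^ (N - j) *s (mpow h (Suc j) *v w))"
      by (simp add: e_def vec.sum vec.scale matrix_vector_mul_assoc)
    also have "\<dots> = (\<Sum>j\<in>{1..N}. z ^ (N - (j - 1)) *s (mpow h j *v w))"
      by (rule sum.reindex_bij_witness[where i = "\<lambda>j. j - 1" and j = Suc]) auto
    also have "\<dots> = (\<Sum>j\<in>{1..N}. z *s (z ^ (N - j) *s (mpow h j *v w)))"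
      by (rule sum.cong) (auto simp: Suc_diff_le simp flip: power_Suc)
    also have "\<dots> = z *s (\<Sum>j\<in>{1..N}. z ^ (N - j) *s (mpow h j *v w))"
      by (simp add: vec.scale_sum_right)
    \<comment> \<open>The two index ranges differ in N and 0, and both terms are w because h^N = 1
      and z^N = 1.\<close>
    also have "(\<Sum>j\<in>{1..N}. z ^ (N - j) *s (mpow h j *v w)) = e z w"
    proof -
      have "{1..N} = insert N {1..<N}" "{..<N} = insert 0 {1..<N}" using N(1) by auto
      then show ?thesis using z N(2) by (simp add: e_def)
    qed
    finally have h: "h *v e z w = z *s e z w" .
    have "\<exists>c. g *v e z w = c *s e z w" if g: "g \<in> L" for g
    proof -
      obtain c where c: "g *v w = c *s w" using w g by (auto simp: eigvec_def)
      have "g *v (mpow h j *v w) = c *s (mpow h j *v w)" for j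
      proof -
        have "h ** g = g ** h" using insert.prems(2) g by auto
        from mpow_commute[OF this, of j] have "g ** mpow h j = mpow h j ** g" ..
        then show ?thesis by (metis c matrix_vector_mul_assoc vec.scale)
      qed
      then have "g *v e z w = c *s e z w"
        by (simp add: e_def vec.sum vec.scale vec.scale_sum_right mult.commute)
      then show ?thesis ..
    qed
    with h show ?thesis by (auto simp: eigvec_def)
  qed
  \<comment> \<open>Summed over all z, the terms with j > 0 cancel. Since N is invertible, w is
    recovered from its eigencomponents.\<close>
  have dec: "(\<Sum>z\<in>?R. e z w) = of_nat N *s w" for w
  proof -
    have "(\<Sum>z\<in>?R. e z w) = (\<Sum>j<N. (\<Sum>z\<in>?R. z ^ (N - j)) *s (mpow h j *v w))"
      unfolding e_def by (subst sum.swap) (simp add: vec.scale_sum_left)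
    also have "\<dots> = (\<Sum>j<N. (if j = 0 then of_nat N *s w else 0))"
    proof (rule sum.cong)
      fix j assume "j \<in> {..<N}"
      show "(\<Sum>z\<in>?R. z ^ (N - j)) *s (mpow h j *v w) = (if j = 0 then of_nat N *s w else 0)"
      proof (cases "j = 0")
        case True
        have "(\<Sum>z\<in>?R. z ^ N) = of_nat N" using R by simp
        with True show ?thesis by simp
      next
        case False
        with sum_powers_roots_of_unity[OF ac ch[OF N(1)], of "N - j"] \<open>j \<in> _\<close>
        show ?thesis by simp
      qed
    qed simp
    also have "\<dots> = of_nat N *s w" using N(1) by (simp add: sum.delta)
    finally show ?thesis .
  qed
  have sub: "w \<in> vec.span {w. eigvec (insert h L) w}" if "eigvec L w" for w
  proof -
    have "w = inverse (of_nat N) *s (\<Sum>z\<in>?R. e z w)"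
      using ch[OF N(1)] by (simp add: dec)
    also have "\<dots> \<in> vec.span {w. eigvec (insert h L) w}"
      by (intro vec.span_scale vec.span_sum vec.span_base) (use ew that in auto)
    finally show ?thesis .
  qed
  have "v \<in> vec.span {w. eigvec L w}"
    by (rule insert.IH) (use insert.prems in auto)
  also have "vec.span {w. eigvec L w} \<subseteq> vec.span {w. eigvec (insert h L) w}"
    using sub by (intro vec.span_minimal) auto
  finally show ?case .
qed

text \<open>Matrices are flattened to vectors and a maximal independent subset is taken. This
  reduces infinite families to finite ones twice: for simultaneous diagonalization and for the chain
  condition on centralizers.\<close>

lemma finite_spanning_matrices:
  fixes B :: "('a::field^'n^'m) set"
  obtains B0 where "finite B0" "B0 \<subseteq> B"
    "\<And>b. b \<in> B \<Longrightarrow> \<exists>c. \<forall>i j. b $ i $ j = (\<Sum>d\<in>B0. c d * d $ i $ j)"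
proof -
  define fl where "fl M = (\<chi> ij. M $ fst ij $ snd ij)" for M :: "'a^'n^'m"
  have inj: "inj fl" by (auto simp: inj_def fl_def vec_eq_iff)
  obtain D where D: "D \<subseteq> fl ` B" "vec.independent D" "fl ` B \<subseteq> vec.span D"
    using vec.maximal_independent_subset by blast
  have fD: "finite D" using D(2) by (rule vec.finiteI_independent)
  define B0 where "B0 = {b \<in> B. fl b \<in> D}"
  have img: "fl ` B0 = D" using D(1) by (auto simp: B0_def)
  have fB: "finite B0" using fD img inj by (metis finite_imageD inj_on_subset subset_UNIV)
  show ?thesis
  proof
    show "finite B0" "B0 \<subseteq> B" by (fact fB) (auto simp: B0_def)
    fix b assume "b \<in> B"
    then have "fl b \<in> vec.span D" using D(3) by auto
    then obtain u where u: "fl b = (\<Sum>v\<in>D. u v *s v)"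
      using vec.span_finite[OF fD] by auto
    also have "\<dots> = (\<Sum>d\<in>B0. u (fl d) *s fl d)"
      unfolding img[symmetric] using inj by (subst sum.reindex) (auto intro: inj_on_subset)
    finally have "fl b = (\<Sum>d\<in>B0. u (fl d) *s fl d)" .
    then have "fl b $ (i, j) = (\<Sum>d\<in>B0. u (fl d) *s fl d) $ (i, j)" for i j by simp
    then have "b $ i $ j = (\<Sum>d\<in>B0. u (fl d) * d $ i $ j)" for i j
      by (simp add: fl_def)
    then show "\<exists>c. \<forall>i j. b $ i $ j = (\<Sum>d\<in>B0. c d * d $ i $ j)"
      by (intro exI[of _ "\<lambda>d. u (fl d)"]) simp
  qed
qed

text \<open>A common eigenvector of a finite spanning subset \<open>L\<close> is one of all of
  \<open>H\<close>, since the elements of \<open>H\<close> are linear combinations of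
  \<open>L\<close>. A basis chosen among these eigenvectors gives the columns of P.\<close>

lemma simultaneous_diagonalization:
  fixes H :: "('a::field^'n^'n) set"
  assumes ac: "\<forall>f :: 'a poly. degree f \<ge> 1 \<longrightarrow> (\<exists>z. poly f z = 0)"
    and ch: "\<And>N. N > 0 \<Longrightarrow> (of_nat N :: 'a) \<noteq> 0"
    and fo: "\<And>h. h \<in> H \<Longrightarrow> \<exists>N>0. mpow h N = mat 1"
    and co: "\<And>g h. g \<in> H \<Longrightarrow> h \<in> H \<Longrightarrow> g ** h = h ** g"
  shows "\<exists>P :: 'a^'n^'n. invertible P \<and> (\<forall>h\<in>H. is_diag (matrix_inv P ** h ** P))"
proof -
  obtain L where L: "finite L" "L \<subseteq> H"
    "\<And>b. b \<in> H \<Longrightarrow> \<exists>c. \<forall>i j. b $ i $ j = (\<Sum>d\<in>L. c d * d $ i $ j)"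
    by (rule finite_spanning_matrices[of H]) blast
  have span: "vec.span {w. eigvec L w} = UNIV"
    using span_common_eigenvectors[OF ac ch L(1)] fo co L(2) by blast
  have eig: "eigvec H w" if w: "eigvec L w" for w
    unfolding eigvec_def
  proof
    fix h assume "h \<in> H"
    from L(3)[OF this] obtain c where c: "\<And>i j. h $ i $ j = (\<Sum>d\<in>L. c d * d $ i $ j)" by blast
    from w have "\<forall>d\<in>L. \<exists>e. d *v w = e *s w" by (simp add: eigvec_def)
    then obtain e where e: "\<And>d. d \<in> L \<Longrightarrow> d *v w = e d *s w" by metis
    have "(h *v w) $ i = (\<Sum>d\<in>L. c d * (d *v w) $ i)" for i
      unfolding matrix_vector_mult_def
      by (simp add: c sum_distrib_left sum_distrib_right mult_ac) (rule sum.swap)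
    then have "h *v w = (\<Sum>d\<in>L. c d * e d) *s w"
      by (simp add: vec_eq_iff e sum_distrib_right mult.assoc)
    then show "\<exists>c. h *v w = c *s w" ..
  qed
  obtain B where B: "B \<subseteq> {w. eigvec L w}" "vec.independent B" "{w. eigvec L w} \<subseteq> vec.span B"
    using vec.maximal_independent_subset by blast
  have sB: "vec.span B = UNIV"
    using span B(3) by (metis subset_UNIV subset_antisym vec.span_minimal vec.subspace_span)
  have fB: "finite B" using B(2) by (rule vec.finiteI_independent)
  have "card B = CARD('n)"
    using vec.dim_eq_card_independent[OF B(2)] vec.dim_span[of B] sB by (simp add: vec.dim_UNIV card_cart_basis)
  then obtain f :: "'n \<Rightarrow> 'a^'n" where f: "bij_betw f UNIV B"
    using fB finite_same_card_bij[of "UNIV :: 'n set" B] by auto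
  define P where "P = (\<chi> i j. f j $ i)"
  have cols: "columns P = B"
    using f by (auto simp: columns_def column_def P_def bij_betw_def)
  then have "\<exists>P'. P ** P' = mat 1" using sB matrix_right_invertible_span_columns[of P] by simp
  then have inv: "invertible P" by (metis invertible_right_inverse)
  note PP = matrix_inv_inverse[OF inv]
  have "is_diag (matrix_inv P ** h ** P)" if h: "h \<in> H" for h
  proof -
    have "\<exists>c. h *v f j = c *s f j" for j
    proof -
      have "eigvec L (f j)" using B(1) f by (auto simp: bij_betw_def)
      from eig[OF this] h show ?thesis by (auto simp: eigvec_def)
    qed
    then obtain c where c: "\<And>j. h *v f j = c j *s f j" by metis
    have "(h ** P) $ i $ j = (h *v f j) $ i" for i j
      by (simp add: matrix_matrix_mult_def matrix_vector_mult_def P_def)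
    then have "h ** P = P ** (\<chi> i j. if i = j then c j else 0)"
      unfolding c by (simp add: vec_eq_iff matrix_matrix_mult_def P_def if_distrib[of "\<lambda>x. _ * x"]
          mult.commute cong: if_cong)
    then have "matrix_inv P ** (h ** P) = matrix_inv P ** P ** (\<chi> i j. if i = j then c j else 0)"
      by (simp only: matrix_mul_assoc)
    then have "matrix_inv P ** h ** P = (\<chi> i j. if i = j then c j else 0)"
      by (simp only: matrix_mul_assoc PP matrix_mul_lid)
    then show ?thesis by (simp add: is_diag_def)
  qed
  with inv show ?thesis by (intro exI[of _ P] conjI ballI)
qed

section \<open>Jordan's theorem for finite complex matrix groups\<close>

locale hermitian_form =
  fixes Q :: "complex^'n::finite \<Rightarrow> complex^'n \<Rightarrow> complex"
  assumes add_left: "Q (x + y) z = Q x z + Q y z"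
    and scale_left: "Q (c *s x) z = c * Q x z"
    and cnj_swap: "cnj (Q x y) = Q y x"
    and pos: "x \<noteq> 0 \<Longrightarrow> Re (Q x x) > 0"
begin

text \<open>The squared length. All estimates are made for it, with the parallelogram law and its
  factor 2 in the role of the triangle inequality.\<close>

definition q :: "complex^'n \<Rightarrow> real" where "q x = Re (Q x x)"

lemma add_right: "Q z (x + y) = Q z x + Q z y"
  by (metis add_left cnj_swap complex_cnj_add)

lemma scale_right: "Q z (c *s x) = cnj c * Q z x"
  by (metis scale_left cnj_swap complex_cnj_mult)

lemma zero_left [simp]: "Q 0 z = 0"
  using add_left[of 0 0 z] by simp

lemma zero_right [simp]: "Q z 0 = 0"
  using add_right[of z 0 0] by simp

lemma minus_left: "Q (- x) z = - Q x z"
  using add_left[of x "- x" z] by (simp add: eq_neg_iff_add_eq_0 add.commute)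

lemma minus_right: "Q z (- x) = - Q z x"
  using add_right[of z x "- x"] by (simp add: eq_neg_iff_add_eq_0 add.commute)

lemma diff_left: "Q (x - y) z = Q x z - Q y z"
  using add_left[of x "- y" z] by (simp add: minus_left)

lemma diff_right: "Q z (x - y) = Q z x - Q z y"
  using add_right[of z x "- y"] by (simp add: minus_right)

lemma sum_left: "Q (sum f I) z = (\<Sum>i\<in>I. Q (f i) z)"
  by (induction I rule: infinite_finite_induct) (auto simp: add_left)

lemma Q_self: "Q x x = of_real (q x)"
  using cnj_swap[of x x] by (metis q_def Reals_cnj_iff complex_is_Real_iff of_real_Re)

lemma q_nonneg: "q x \<ge> 0"
  using pos[of x] by (cases "x = 0") (auto simp: q_def)

lemma q_zero [simp]: "q 0 = 0"
  by (simp add: q_def)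

lemma q_eq_0_iff: "q x = 0 \<longleftrightarrow> x = 0"
  using pos[of x] by (cases "x = 0") (auto simp: q_def)

lemma q_scale: "q (c *s x) = (cmod c)\<^sup>2 * q x"
proof -
  have "Q (c *s x) (c *s x) = (c * cnj c) * Q x x"
    by (simp add: scale_left scale_right)
  also have "\<dots> = of_real ((cmod c)\<^sup>2 * q x)"
    by (simp add: Q_self flip: complex_norm_square)
  finally show ?thesis by (simp add: q_def)
qed

lemma q_parallelogram: "q (x + y) + q (x - y) = 2 * q x + 2 * q y"
  by (simp add: q_def add_left add_right diff_left diff_right)

lemma q_add_le: "q (x + y) \<le> 2 * q x + 2 * q y"
  using q_parallelogram[of x y] q_nonneg[of "x - y"] by linarith

lemma q_diff_le: "q (x - y) \<le> 2 * q x + 2 * q y"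
  using q_parallelogram[of x y] q_nonneg[of "x + y"] by linarith

lemma q_sum_le: "finite I \<Longrightarrow> q (sum f I) \<le> 2 ^ card I * (\<Sum>i\<in>I. q (f i))"
proof (induction I rule: finite_induct)
  case empty
  then show ?case by simp
next
  case (insert i I)
  have "q (sum f (insert i I)) \<le> 2 * q (f i) + 2 * q (sum f I)"
    using insert by (simp add: q_add_le)
  also have "\<dots> \<le> 2 * q (f i) + 2 * (2 ^ card I * (\<Sum>i\<in>I. q (f i)))"
    using insert.IH by simp
  also have "2 * q (f i) \<le> 2 ^ Suc (card I) * q (f i)"
    using q_nonneg[of "f i"] by (intro mult_right_mono) auto
  finally show ?case using insert by (simp add: algebra_simps)
qed

lemma q_orthogonal: "Q x y = 0 \<Longrightarrow> q (x - y) = q x + q y"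
  using cnj_swap[of x y] by (simp add: q_def diff_left diff_right)

definition orthonormal :: "(complex^'n) set \<Rightarrow> bool" where
  "orthonormal B \<longleftrightarrow> (\<forall>x\<in>B. \<forall>y\<in>B. Q x y = (if x = y then 1 else 0))"

lemma orthonormal_coeff:
  assumes "orthonormal B" "finite B" "b \<in> B"
  shows "Q (\<Sum>x\<in>B. c x *s x) b = c b"
proof -
  have "Q (\<Sum>x\<in>B. c x *s x) b = (\<Sum>x\<in>B. if x = b then c x else 0)"
    unfolding sum_left scale_left using assms by (intro sum.cong) (auto simp: orthonormal_def)
  then show ?thesis using assms by simp
qed

lemma orthonormal_card:
  assumes "orthonormal B" shows "finite B" "card B \<le> CARD('n)"
proof -
  have "vec.independent B"
    unfolding vec.dependent_explicit
  proof
    assume "\<exists>S c. finite S \<and> S \<subseteq> B \<and> (\<Sum>v\<in>S. c v *s v) = 0 \<and> (\<exists>v\<in>S. c v \<noteq> 0)"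
    then obtain S c v where S: "finite S" "S \<subseteq> B" and s: "(\<Sum>v\<in>S. c v *s v) = 0"
      and v: "v \<in> S" "c v \<noteq> 0" by blast
    have "orthonormal S" using assms S unfolding orthonormal_def by blast
    from orthonormal_coeff[OF this S(1) v(1), of c] s v show False by simp
  qed
  then show "finite B" "card B \<le> CARD('n)"
    using vec.independent_card_le_dim[of B UNIV]
    by (auto simp: vec.finiteI_independent vec.dim_UNIV card_cart_basis)
qed

text \<open>An orthonormal set of maximal size is a basis: a nonzero remainder x - sum Q(x,b) b,
  once normalized, would enlarge it.\<close>

lemma orthonormal_basis_exists:
  "\<exists>B. orthonormal B \<and> finite B \<and> card B \<le> CARD('n) \<and> (\<forall>x. x = (\<Sum>b\<in>B. Q x b *s b))"
proof -
  let ?K = "{k. \<exists>B. orthonormal B \<and> card B = k}"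
  have sub: "?K \<subseteq> {..CARD('n)}" using orthonormal_card by auto
  have "0 \<in> ?K" by (auto intro!: exI[of _ "{}"] simp: orthonormal_def)
  then have "Max ?K \<in> ?K" using sub by (intro Max_in) (auto intro: finite_subset)
  then obtain B where B: "orthonormal B" "card B = Max ?K" by auto
  note fB = orthonormal_card[OF B(1)]
  have "x = (\<Sum>b\<in>B. Q x b *s b)" for x
  proof (rule ccontr)
    assume neq: "x \<noteq> (\<Sum>b\<in>B. Q x b *s b)"
    define y where "y = x - (\<Sum>b\<in>B. Q x b *s b)"
    have y0: "y \<noteq> 0" using neq by (simp add: y_def)
    then have qy: "q y > 0" using q_nonneg[of y] q_eq_0_iff[of y] by linarith
    have ort: "Q y b = 0" if "b \<in> B" for b
      using orthonormal_coeff[OF B(1) fB(1) that] by (simp add: y_def diff_left)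
    define z where "z = complex_of_real (1 / sqrt (q y)) *s y"
    have "q z = 1" using qy by (simp add: z_def q_scale norm_divide power_divide)
    then have zz: "Q z z = 1" by (simp add: Q_self)
    have zb: "Q z b = 0" "Q b z = 0" if "b \<in> B" for b
    proof -
      show *: "Q z b = 0" using ort[OF that] by (simp add: z_def scale_left)
      show "Q b z = 0" using cnj_swap[of z b] * by simp
    qed
    have "z \<notin> B" using zz zb by auto
    moreover have "orthonormal (insert z B)"
      using B(1) zz zb by (auto simp: orthonormal_def)
    ultimately have "Suc (Max ?K) \<in> ?K"
      using fB(1) B(2) by (metis (mono_tags, lifting) card_insert_disjoint mem_Collect_eq)
    then have "Suc (Max ?K) \<le> Max ?K" using sub by (intro Max_ge) (auto intro: finite_subset)
    then show False by simp
  qed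
  with B(1) fB show ?thesis by (intro exI[of _ B] conjI allI)
qed

definition unitary :: "complex^'n^'n \<Rightarrow> bool" where
  "unitary A \<longleftrightarrow> (\<forall>x y. Q (A *v x) (A *v y) = Q x y)"

text \<open>The parameter bounds the square of the operator norm of A - 1.\<close>

definition small :: "real \<Rightarrow> complex^'n^'n \<Rightarrow> bool" where
  "small a A \<longleftrightarrow> (\<forall>x. q (A *v x - x) \<le> a * q x)"

lemma unitary_q: "unitary A \<Longrightarrow> q (A *v x) = q x"
  by (simp add: unitary_def q_def)

text \<open>If \<open>A\<close> and \<open>A' = B A B\<^sup>-\<^sup>1\<close> had a common eigenvector \<open>v\<close> with different eigenvalues,
  then \<open>v\<close> and \<open>B\<^sup>-\<^sup>1 v\<close> would be orthogonal, so \<open>B\<close> would move \<open>v\<close> by \<open>sqrt 2\<close> times its length.\<close>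
lemma commute_if_commute_conjugate:
  assumes u: "unitary A" "unitary B" and inv: "B ** B' = mat 1" "B' ** B = mat 1"
    and fo: "\<exists>N>0. mpow A N = mat 1" "\<exists>N>0. mpow (B ** A ** B') N = mat 1"
    and co: "A ** (B ** A ** B') = (B ** A ** B') ** A"
    and sm: "small a B" "a < 2"
  shows "A ** B = B ** A"
proof -
  define A' where "A' = B ** A ** B'"
  have uB': "unitary B'"
    unfolding unitary_def
  proof (intro allI)
    fix x y
    have "Q (B *v (B' *v x)) (B *v (B' *v y)) = Q (B' *v x) (B' *v y)"
      using u(2) by (simp add: unitary_def)
    then show "Q (B' *v x) (B' *v y) = Q x y"
      by (simp add: matrix_vector_mul_assoc inv)
  qed
  have "v \<in> vec.span {w. eigvec {A, A'} w}" for v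
  proof (rule span_common_eigenvectors)
    show "\<forall>f :: complex poly. degree f \<ge> 1 \<longrightarrow> (\<exists>z. poly f z = 0)"
      by (metis alg_closed_imp_poly_has_root less_one not_less zero_less_iff_neq_zero)
  qed (use fo co in \<open>auto simp: A'_def\<close>)
  then have sp: "vec.span {w. eigvec {A, A'} w} = UNIV" by auto
  have "A *v v = A' *v v" if ev: "eigvec {A, A'} v" for v
  proof (rule ccontr)
    assume neq: "A *v v \<noteq> A' *v v"
    from ev obtain l m where l: "A *v v = l *s v" and m: "A' *v v = m *s v"
      by (auto simp: eigvec_def)
    have lm: "l \<noteq> m" and v0: "v \<noteq> 0" using neq l m by auto
    define w where "w = B' *v v"
    have "A *v w = (B' ** A') *v v"
      by (simp add: w_def A'_def matrix_vector_mul_assoc matrix_mul_assoc inv)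
    also have "\<dots> = B' *v (A' *v v)" by (simp add: matrix_vector_mul_assoc)
    also have "\<dots> = m *s w" by (simp add: m w_def vec.scale)
    finally have Aw: "A *v w = m *s w" .
    have qw: "q w = q v" using unitary_q[OF uB'] by (simp add: w_def)
    have "q v > 0" using v0 q_nonneg[of v] q_eq_0_iff[of v] by linarith
    have "q w = (cmod m)\<^sup>2 * q w"
      using unitary_q[OF u(1), of w] by (simp add: Aw q_scale)
    then have "(cmod m)\<^sup>2 = 1" using qw \<open>q v > 0\<close> by simp
    then have mm: "m * cnj m = 1" by (simp add: complex_norm_square[symmetric] flip: of_real_power)
    \<comment> \<open>Applying \<open>A\<close> to both arguments produces the factor
      \<open>l * cnj m\<close>. Since |m| = 1 and \<open>l\<close> differs from \<open>m\<close>,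
      the factor is not 1, so \<open>v\<close> and \<open>w\<close> are orthogonal.\<close>
    have "Q v w = l * cnj m * Q v w"
      using u(1) by (metis l Aw scale_left scale_right unitary_def mult.assoc)
    moreover have "l * cnj m \<noteq> 1"
    proof
      assume "l * cnj m = 1"
      then have "l * (m * cnj m) = m" by (metis mult.commute mult.left_commute mult.right_neutral)
      with mm lm show False by simp
    qed
    ultimately have "Q v w = 0" by auto
    then have "q (v - w) = 2 * q v" using q_orthogonal[of v w] qw by simp
    moreover have "q (v - w) = q (B *v w - w)"
      by (simp add: w_def matrix_vector_mul_assoc inv)
    ultimately have "2 * q v \<le> a * q w" using sm(1)[unfolded small_def, rule_format, of w] by linarith
    with qw \<open>q v > 0\<close> sm(2) show False by (simp add: mult_le_cancel_right)
  qed
  then have "{w. eigvec {A, A'} w} \<subseteq> {v. A *v v = A' *v v}" by blast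
  moreover have "vec.subspace {v. A *v v = A' *v v}"
    by (simp add: vec.subspace_def matrix_vector_right_distrib vec.scale)
  ultimately have "vec.span {w. eigvec {A, A'} w} \<subseteq> {v. A *v v = A' *v v}"
    by (rule vec.span_minimal)
  then have "A = A'" using sp by (auto simp: matrix_eq)
  then have "A ** B = B ** A ** (B' ** B)" by (simp add: A'_def matrix_mul_assoc)
  then show ?thesis using inv by simp
qed

text \<open>With x = BAy the displacement of x is ABy - BAy = (A-1)(B-1)y - (B-1)(A-1)y. Each term
  has squared length at most ab q(y), and \<open>q_diff_le\<close> contributes 2 + 2 = 4.\<close>

lemma small_commutator:
  assumes u: "unitary A" "unitary B"
    and inv: "A ** A' = mat 1" "A' ** A = mat 1" "B ** B' = mat 1" "B' ** B = mat 1"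
    and sm: "small a A" "small b B" "a \<ge> 0" "b \<ge> 0"
  shows "small (4 * a * b) (A ** B ** A' ** B')"
  unfolding small_def
proof
  fix x
  define y where "y = A' *v (B' *v x)"
  have x: "x = B *v (A *v y)"
    by (simp add: y_def matrix_vector_mul_assoc matrix_mul_assoc inv)
  have "q x = q y" unfolding x using u by (simp add: unitary_q)
  have "(A ** B ** A' ** B') *v x = A *v (B *v y)"
    by (simp add: y_def matrix_vector_mul_assoc matrix_mul_assoc)
  moreover define s where "s = B *v y - y"
  moreover define t where "t = A *v y - y"
  ultimately have "(A ** B ** A' ** B') *v x - x = (A *v s - s) - (B *v t - t)"
    by (simp add: x vec.diff)
  also have "q \<dots> \<le> 2 * q (A *v s - s) + 2 * q (B *v t - t)" by (rule q_diff_le)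
  also have "q (A *v s - s) \<le> a * q s" using sm by (auto simp: small_def)
  also have "q s \<le> b * q y" using sm by (auto simp: small_def s_def)
  also have "q (B *v t - t) \<le> b * q t" using sm by (auto simp: small_def)
  also have "q t \<le> a * q y" using sm by (auto simp: small_def t_def)
  finally show "q ((A ** B ** A' ** B') *v x - x) \<le> 4 * a * b * q x"
    using \<open>q x = q y\<close> sm by (simp add: mult_left_mono)
qed

lemma small_mono: "small a A \<Longrightarrow> a \<le> b \<Longrightarrow> small b A"
  unfolding small_def by (meson mult_right_mono order_trans q_nonneg)

lemma small_0_imp: "(\<And>e. e > 0 \<Longrightarrow> small e A) \<Longrightarrow> A = mat 1"
proof -
  assume *: "\<And>e. e > 0 \<Longrightarrow> small e A"
  have "A *v x = x" for x
  proof (rule ccontr)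
    assume "A *v x \<noteq> x"
    then have 1: "q (A *v x - x) > 0" using q_nonneg[of "A *v x - x"] q_eq_0_iff[of "A *v x - x"] by auto
    then have x: "q x > 0" using q_nonneg[of x] q_eq_0_iff[of x] by fastforce
    have "small (q (A *v x - x) / (2 * q x)) A" using 1 x by (intro *) simp
    then have "q (A *v x - x) \<le> q (A *v x - x) / (2 * q x) * q x" unfolding small_def by blast
    then have "q (A *v x - x) \<le> 1 / 2 * q (A *v x - x)" using x by simp
    then show False using 1 by linarith
  qed
  then show "A = mat 1" by (simp add: matrix_eq)
qed

end

lemma finite_group_finite_order:
  fixes F :: "('a::comm_ring_1^'n^'n) set"
  assumes "finite F" "mat 1 \<in> F" "\<And>g h. g \<in> F \<Longrightarrow> h \<in> F \<Longrightarrow> g ** h \<in> F"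
    and "g \<in> F" and inv: "g' ** g = mat 1"
  shows "\<exists>N>0. mpow g N = mat 1"
proof -
  have "mpow g k \<in> F" for k using assms by (induction k) auto
  then have "\<not> inj (mpow g)"
    using assms(1) by (meson finite_subset image_subsetI infinite_UNIV_nat range_inj_infinite)
  then obtain i j where ij: "i < j" "mpow g i = mpow g j"
    by (metis injI linorder_neqE_nat)
  have cancel: "mpow g (i - k) = mpow g (j - k)" if "k \<le> i" for k
    using that
  proof (induction k)
    case 0
    then show ?case using ij by simp
  next
    case (Suc k)
    then have "mpow g (Suc (i - Suc k)) = mpow g (Suc (j - Suc k))"
      using ij by (simp add: Suc_diff_Suc del: mpow_Suc)
    then have "g' ** (g ** mpow g (i - Suc k)) = g' ** (g ** mpow g (j - Suc k))" by simp
    then show ?case by (simp add: matrix_mul_assoc inv)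
  qed
  from cancel[of i] ij(1) show ?thesis by (intro exI[of _ "j - i"]) auto
qed

context hermitian_form begin

text \<open>The iterated commutators \<open>A\<^sub>k\<^sub>+\<^sub>1 = [A\<^sub>k, B]\<close> tend to 1, hence reach 1 in a finite group;
  going back along the sequence, each \<open>A\<^sub>k\<close> commutes with \<open>B\<close>.\<close>
lemma small_commute:
  assumes fin: "finite F" and one: "mat 1 \<in> F"
    and mult: "\<And>g h. g \<in> F \<Longrightarrow> h \<in> F \<Longrightarrow> g ** h \<in> F"
    and inv: "\<And>g. g \<in> F \<Longrightarrow> \<exists>h\<in>F. g ** h = mat 1 \<and> h ** g = mat 1"
    and u: "\<And>g. g \<in> F \<Longrightarrow> unitary g"
    and AB: "A \<in> F" "B \<in> F" "small (1/8) A" "small (1/8) B"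
  shows "A ** B = B ** A"
proof -
  define iv where "iv g = (SOME h. h \<in> F \<and> g ** h = mat 1 \<and> h ** g = mat 1)" for g
  have iv: "iv g \<in> F" "g ** iv g = mat 1" "iv g ** g = mat 1" if "g \<in> F" for g
  proof -
    have "iv g \<in> F \<and> g ** iv g = mat 1 \<and> iv g ** g = mat 1"
    proof -
      from inv[OF that] have "\<exists>h. h \<in> F \<and> g ** h = mat 1 \<and> h ** g = mat 1" by blast
      then show ?thesis unfolding iv_def by (rule someI_ex)
    qed
    then show "iv g \<in> F" "g ** iv g = mat 1" "iv g ** g = mat 1" by auto
  qed
  have fo: "\<exists>N>0. mpow g N = mat 1" if "g \<in> F" for g
    using fin one mult that iv(3)[OF that] by (rule finite_group_finite_order)
  define c where "c X = X ** B ** iv X ** iv B" for X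
  have cF: "c X \<in> F" if "X \<in> F" for X using that AB iv mult by (simp add: c_def)
  have AkF: "(c ^^ k) A \<in> F" for k by (induction k) (auto intro: cF AB)
  have sk: "small (1/8 * (1/2) ^ k) ((c ^^ k) A)" for k
  proof (induction k)
    case 0
    then show ?case using AB by simp
  next
    case (Suc k)
    \<comment> \<open>The threshold 1/8 is chosen so that 4 * (1/8) = 1/2: every commutator with
      \<open>B\<close> halves the bound.\<close>
    have "small (4 * (1/8 * (1/2) ^ k) * (1/8)) (c ((c ^^ k) A))"
      unfolding c_def[of "(c ^^ k) A"]
      by (rule small_commutator) (use u iv AkF[of k] AB Suc in auto)
    then show ?case by simp
  qed
  have ex: "\<exists>k. (c ^^ k) A = mat 1"
  proof -
    \<comment> \<open>In a finite set some value recurs infinitely often; it obeys all the shrinking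
      bounds and must be 1.\<close>
    have "finite (range (\<lambda>k. (c ^^ k) A))" using AkF fin by (meson finite_subset image_subsetI)
    then obtain X where "infinite {k. (c ^^ k) A = X}"
      using pigeonhole_infinite[of UNIV "\<lambda>k. (c ^^ k) A"] by auto
    then have X: "\<exists>k\<ge>m. (c ^^ k) A = X" for m
      by (metis (mono_tags, lifting) infinite_nat_iff_unbounded_le mem_Collect_eq)
    have "small e X" if "e > 0" for e
    proof -
      obtain m where m: "(1/2::real) ^ m < e" using \<open>e > 0\<close> real_arch_pow_inv[of e "1/2"] by auto
      obtain k where k: "k \<ge> m" "(c ^^ k) A = X" using X by blast
      have "1/8 * (1/2::real) ^ k \<le> 1 * (1/2) ^ m"
        using k by (intro mult_mono power_decreasing) auto
      then show ?thesis using sk[of k] k m small_mono by (metis less_eq_real_def mult_1 order_trans)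
    qed
    then have "X = mat 1" by (rule small_0_imp)
    with X show ?thesis by blast
  qed
  \<comment> \<open>As c(X) B = X B X^(-1), the assumption says that \<open>B\<close> commutes with
    its conjugate by \<open>X\<close>. So \<open>commute_if_commute_conjugate\<close> applies with
    \<open>B\<close> conjugated by the small matrix \<open>X\<close>.\<close>
  have descend: "X ** B = B ** X" if X: "X \<in> F" "small (1/8) X" and "c X ** B = B ** c X" for X
  proof -
    have "c X ** B = X ** B ** iv X"
      by (simp add: c_def iv AB flip: matrix_mul_assoc)
    then have "B ** (X ** B ** iv X) = (X ** B ** iv X) ** B"
      using that(3) by (metis matrix_mul_assoc)
    then have "B ** X = X ** B"
      using X AB iv u mult
      by (intro commute_if_commute_conjugate[where B = X and B' = "iv X" and a = "1/8"])
        (auto intro!: fo)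
    then show ?thesis by simp
  qed
  have "(c ^^ (k - i)) A ** B = B ** (c ^^ (k - i)) A" if "(c ^^ k) A = mat 1" "i \<le> k" for i k
    using that(2)
  proof (induction i)
    case 0
    then show ?case using that by simp
  next
    case (Suc i)
    have "small (1/8) ((c ^^ (k - Suc i)) A)"
      by (rule small_mono[OF sk]) (simp add: power_le_one)
    moreover have "(c ^^ (k - i)) A = c ((c ^^ (k - Suc i)) A)"
      using Suc.prems by (metis Suc_diff_Suc Suc_le_lessD comp_apply funpow.simps(2))
    ultimately show ?case using Suc.IH Suc.prems AkF[of "k - Suc i"] descend[of "(c ^^ (k - Suc i)) A"]
      by (metis Suc_leD)
  qed
  with ex show ?thesis by (metis diff_self_eq_0 funpow_0 order_refl)
qed

text \<open>In an orthonormal basis the coefficients of a unitary matrix lie in the unit disc, which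
  is cut into cells of mesh 1/K. Two matrices in the same cells have coefficients at squared
  distance at most 2/K^2; with n rows and the factor 2^n of \<open>q_sum_le\<close> this gives the
  condition on K.\<close>

lemma unitary_pigeonhole:
  fixes K :: nat
  assumes "2 ^ CARD('n) * (2 * real CARD('n)) \<le> e * (real K)\<^sup>2" "K > 0" "e \<ge> 0"
    and "finite E" "\<And>g. g \<in> E \<Longrightarrow> unitary g"
    and card: "card E > ((2 * K + 1)\<^sup>2) ^ (CARD('n)\<^sup>2)"
  shows "\<exists>a\<in>E. \<exists>b\<in>E. a \<noteq> b \<and> (\<forall>x. q (b *v x - a *v x) \<le> e * q x)"
proof -
  obtain B where B: "orthonormal B" "finite B" "card B \<le> CARD('n)" "\<And>x. x = (\<Sum>b\<in>B. Q x b *s b)"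
    using orthonormal_basis_exists by (elim exE conjE) (rule that, auto)
  have parseval: "q x = (\<Sum>b\<in>B. (cmod (Q x b))\<^sup>2)" for x
  proof -
    have "Q x x = (\<Sum>b\<in>B. Q x b * Q b x)"
      by (subst (1) B(4)) (simp add: sum_left scale_left)
    also have "\<dots> = (\<Sum>b\<in>B. Q x b * cnj (Q x b))" by (simp add: cnj_swap)
    also have "\<dots> = of_real (\<Sum>b\<in>B. (cmod (Q x b))\<^sup>2)" by (simp flip: complex_norm_square)
    finally show ?thesis by (simp add: q_def)
  qed
  \<comment> \<open>Each floor takes one of the 2K + 1 values from -K to K, so there are at most
    ((2K+1)^2)^(n^2) cells.\<close>
  define cell where "cell g = (\<lambda>bc\<in>B \<times> B. (\<lfloor>K * Re (Q (g *v fst bc) (snd bc))\<rfloor>, \<lfloor>K * Im (Q (g *v fst bc) (snd bc))\<rfloor>))"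
    for g
  let ?R = "PiE (B \<times> B) (\<lambda>_. {- int K..int K} \<times> {- int K..int K})"
  have "cell g \<in> ?R" if "g \<in> E" for g
  proof -
    have "\<lfloor>K * Re (Q (g *v b) c)\<rfloor> \<in> {- int K..int K} \<and> \<lfloor>K * Im (Q (g *v b) c)\<rfloor> \<in> {- int K..int K}"
      if bc: "b \<in> B" "c \<in> B" for b c
    proof -
      have "q b = 1" using B(1) bc by (simp add: orthonormal_def q_def)
      then have "q (g *v b) = 1" using unitary_q assms(5)[OF \<open>g \<in> E\<close>] by simp
      moreover have "(cmod (Q (g *v b) c))\<^sup>2 \<le> q (g *v b)"
        unfolding parseval using B(2) bc by (intro member_le_sum) auto
      ultimately have "cmod (Q (g *v b) c) \<le> 1" by (simp add: power_le_one_iff abs_square_le_1)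
      then have *: "\<bar>Re (Q (g *v b) c)\<bar> \<le> 1" "\<bar>Im (Q (g *v b) c)\<bar> \<le> 1"
        using abs_Re_le_cmod abs_Im_le_cmod order_trans by blast+
      have **: "\<lfloor>K * t\<rfloor> \<in> {- int K..int K}" if "\<bar>t\<bar> \<le> 1" for t :: real
      proof -
        have "real K * t \<le> real K * 1" "real K * (- 1) \<le> real K * t"
            using that mult_left_mono[of t 1 "real K"] mult_left_mono[of "-1" t "real K"] by linarith+
        then show ?thesis by (simp add: le_floor_iff floor_le_iff)
      qed
      show ?thesis using **[OF *(1)] **[OF *(2)] by blast
    qed
    then show ?thesis by (auto simp: cell_def)
  qed
  then have sub: "cell ` E \<subseteq> ?R" by auto
  have "card ?R = ((2 * K + 1)\<^sup>2) ^ ((card B)\<^sup>2)"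
    using B(2) by (simp add: card_PiE card_cartesian_product power2_eq_square nat_add_distrib nat_mult_distrib flip: of_nat_Suc)
  also have "\<dots> \<le> ((2 * K + 1)\<^sup>2) ^ (CARD('n)\<^sup>2)"
    using B(3) by (intro power_increasing power_mono) auto
  finally have "card (cell ` E) < card E"
    using card card_mono[OF _ sub] B(2) by (simp add: finite_PiE)
  then have "\<not> inj_on cell E" by (rule pigeonhole)
  then obtain a b where ab: "a \<in> E" "b \<in> E" "a \<noteq> b" "cell a = cell b" by (auto simp: inj_on_def)
  have close: "(cmod (Q (b *v c - a *v c) d))\<^sup>2 \<le> 2 / (real K)\<^sup>2" if cd: "c \<in> B" "d \<in> B" for c d
  proof -
    have fl: "\<bar>s - t\<bar> \<le> 1 / K" if "\<lfloor>K * s\<rfloor> = \<lfloor>K * t\<rfloor>" for s t :: real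
    proof -
      have "\<bar>K * s - K * t\<bar> \<le> 1" using that by linarith
      then have "K * \<bar>s - t\<bar> \<le> 1" by (simp add: abs_mult flip: right_diff_distrib)
      then show ?thesis using \<open>K > 0\<close> by (simp add: field_simps)
    qed
    have "cell a (c, d) = cell b (c, d)" using ab by simp
    then have "\<bar>Re (Q (b *v c - a *v c) d)\<bar> \<le> 1 / K" "\<bar>Im (Q (b *v c - a *v c) d)\<bar> \<le> 1 / K"
      using cd by (auto simp: cell_def diff_left intro!: fl)
    then have "(Re (Q (b *v c - a *v c) d))\<^sup>2 \<le> (1 / K)\<^sup>2" "(Im (Q (b *v c - a *v c) d))\<^sup>2 \<le> (1 / K)\<^sup>2"
      by (metis abs_ge_zero power2_abs power_mono)+
    then show ?thesis unfolding cmod_power2 by (simp add: power_divide)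
  qed
  have "q (b *v x - a *v x) \<le> e * q x" for x
  proof -
    let ?n = "CARD('n)"
    have lin: "b *v x - a *v x = (\<Sum>c\<in>B. Q x c *s (b *v c - a *v c))"
      by (subst (1 2) B(4)[of x]) (simp add: vec.sum vec.scale sum_subtractf vec.scale_right_diff_distrib)
    have "q (b *v x - a *v x) \<le> 2 ^ card B * (\<Sum>c\<in>B. q (Q x c *s (b *v c - a *v c)))"
      unfolding lin using B(2) by (rule q_sum_le)
    also have "(\<Sum>c\<in>B. q (Q x c *s (b *v c - a *v c))) \<le> (\<Sum>c\<in>B. (cmod (Q x c))\<^sup>2 * (card B * (2 / (real K)\<^sup>2)))"
    proof (rule sum_mono)
      fix c assume c: "c \<in> B"
      have "q (b *v c - a *v c) \<le> (\<Sum>d\<in>B. 2 / (real K)\<^sup>2)"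
        unfolding parseval by (intro sum_mono close c)
      then show "q (Q x c *s (b *v c - a *v c)) \<le> (cmod (Q x c))\<^sup>2 * (card B * (2 / (real K)\<^sup>2))"
        unfolding q_scale by (intro mult_left_mono) auto
    qed
    also have "\<dots> = q x * (card B * (2 / (real K)\<^sup>2))"
      by (simp only: parseval sum_distrib_right)
    also have "2 ^ card B * (q x * (card B * (2 / (real K)\<^sup>2))) = (2 ^ card B * (2 * real (card B))) / (real K)\<^sup>2 * q x"
      by simp
    also have "\<dots> \<le> (2 ^ ?n * (2 * real ?n)) / (real K)\<^sup>2 * q x"
      using B(3) q_nonneg by (intro mult_right_mono divide_right_mono mult_mono power_increasing) auto
    also have "\<dots> \<le> e * q x"
      using assms(1,2) q_nonneg by (intro mult_right_mono) (auto simp: field_simps)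
    finally show ?thesis by simp
  qed
  with ab show ?thesis by blast
qed

end

definition herm :: "complex^'n \<Rightarrow> complex^'n \<Rightarrow> complex" where
  "herm x y = (\<Sum>i\<in>UNIV. x $ i * cnj (y $ i))"

text \<open>S consists of the elements near 1 for the averaged form, and J is the number of cells of
  the pigeonhole argument, which depends on the dimension only. The index is bounded by counting
  elements rather than cosets, because \<open>virtually_abelian\<close> compares finite
  subsets.\<close>

theorem jordan_finite_complex:
  "\<exists>J. \<forall>F :: (complex^'n::finite^'n) set.
     finite F \<longrightarrow> mat 1 \<in> F \<longrightarrow> (\<forall>g\<in>F. \<forall>h\<in>F. g ** h \<in> F) \<longrightarrow>
     (\<forall>g\<in>F. \<exists>h\<in>F. g ** h = mat 1 \<and> h ** g = mat 1) \<longrightarrow>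
     (\<exists>S\<subseteq>F. (\<forall>a\<in>S. \<forall>b\<in>S. a ** b = b ** a) \<and>
        (\<forall>E\<subseteq>F. card E > J \<longrightarrow> (\<exists>a\<in>E. \<exists>b\<in>E. a \<noteq> b \<and> (\<exists>s\<in>S. b = a ** s))))"
proof -
  \<comment> \<open>The pigeonhole condition for the threshold 1/8 is 2^n * 2n * 8 \<le> K^2; the
    bound 1 allows K \<le> K^2.\<close>
  obtain K where K: "real K > max 1 (2 ^ CARD('n) * (2 * real CARD('n)) * 8)"
    using reals_Archimedean2 by blast
  have K0: "K > 0" using K by (cases K) auto
  have "2 ^ CARD('n) * (2 * real CARD('n)) * 8 \<le> real K * 1" using K by simp
  also have "\<dots> \<le> real K * real K" using K by (intro mult_left_mono) auto
  finally have K1: "2 ^ CARD('n) * (2 * real CARD('n)) \<le> 1/8 * (real K)\<^sup>2"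
    by (simp add: power2_eq_square)
  show ?thesis
  proof (rule exI, intro allI impI)
    fix F :: "(complex^'n^'n) set"
    assume fin: "finite F" and one: "mat 1 \<in> F" and mult: "\<forall>g\<in>F. \<forall>h\<in>F. g ** h \<in> F"
      and inv: "\<forall>g\<in>F. \<exists>h\<in>F. g ** h = mat 1 \<and> h ** g = mat 1"
    \<comment> \<open>Summing the standard form over the group makes it invariant, since right
      translation by g permutes \<open>F\<close>.\<close>
    define Q where "Q x y = (\<Sum>g\<in>F. herm (g *v x) (g *v y))" for x y
    have herm_self: "Re (herm x x) = (\<Sum>i\<in>UNIV. (cmod (x $ i))\<^sup>2)" for x :: "complex^'n"
      unfolding herm_def Re_sum by (intro sum.cong refl) (simp flip: complex_norm_square of_real_power)
    have herm_nonneg: "Re (herm x x) \<ge> 0" for x :: "complex^'n"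
      unfolding herm_self by (intro sum_nonneg) auto
    interpret hermitian_form Q
    proof
      show "Q (x + y) z = Q x z + Q y z" for x y z
        by (simp add: Q_def herm_def matrix_vector_right_distrib algebra_simps sum.distrib)
      show "Q (c *s x) z = c * Q x z" for c x z
        by (simp add: Q_def herm_def vec.scale sum_distrib_left mult.assoc)
      show "cnj (Q x y) = Q y x" for x y
        by (simp add: Q_def herm_def mult.commute)
      show "Re (Q x x) > 0" if x0: "x \<noteq> 0" for x
      proof -
        obtain i where "x $ i \<noteq> 0" using x0 unfolding vec_eq_iff zero_index by blast
        then have "0 < (cmod (x $ i))\<^sup>2" by simp
        also have "\<dots> \<le> Re (herm (mat 1 *v x) (mat 1 *v x))"
          unfolding herm_self matrix_vector_mul_lid by (intro member_le_sum) auto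
        also have "\<dots> \<le> Re (Q x x)"
          unfolding Q_def Re_sum using fin one herm_nonneg by (intro member_le_sum) auto
        finally show ?thesis .
      qed
    qed
    have uni: "unitary g" if g: "g \<in> F" for g
      unfolding unitary_def
    proof (intro allI)
      fix x y
      obtain h where h: "h \<in> F" "g ** h = mat 1" "h ** g = mat 1" using inv g by blast
      have "bij_betw (\<lambda>a. a ** g) F F"
        by (rule bij_betw_byWitness[where f' = "\<lambda>a. a ** h"])
          (use g h mult in \<open>auto simp flip: matrix_mul_assoc\<close>)
      from sum.reindex_bij_betw[OF this, of "\<lambda>a. herm (a *v x) (a *v y)"]
      show "Q (g *v x) (g *v y) = Q x y"
        by (simp add: Q_def matrix_vector_mul_assoc)
    qed
    define S where "S = {g \<in> F. small (1/8) g}"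
    have com: "a ** b = b ** a" if "a \<in> S" "b \<in> S" for a b
      by (rule small_commute[OF fin one]) (use that mult inv uni in \<open>auto simp: S_def\<close>)
    have pig: "\<exists>a\<in>E. \<exists>b\<in>E. a \<noteq> b \<and> (\<exists>s\<in>S. b = a ** s)"
      if E: "E \<subseteq> F" "card E > ((2 * K + 1)\<^sup>2) ^ (CARD('n)\<^sup>2)" for E
    proof -
      have "\<exists>a\<in>E. \<exists>b\<in>E. a \<noteq> b \<and> (\<forall>x. q (b *v x - a *v x) \<le> 1/8 * q x)"
        by (rule unitary_pigeonhole[OF K1 K0])
          (use E uni fin in \<open>auto intro: finite_subset\<close>)
      then obtain a b where ab: "a \<in> E" "b \<in> E" "a \<noteq> b" "\<And>x. q (b *v x - a *v x) \<le> 1/8 * q x" by blast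
      obtain a' where a': "a' \<in> F" "a ** a' = mat 1" "a' ** a = mat 1" using inv ab E by blast
      have "small (1/8) (a' ** b)"
        unfolding small_def
      proof
        fix x
        have "(a' ** b) *v x - x = a' *v (b *v x - a *v x)"
          by (simp add: vec.diff matrix_vector_mul_assoc a')
        then have "q ((a' ** b) *v x - x) = q (b *v x - a *v x)"
          using unitary_q[OF uni[OF a'(1)]] by simp
        then show "q ((a' ** b) *v x - x) \<le> 1/8 * q x" using ab(4)[of x] by simp
      qed
      then have "a' ** b \<in> S" using a' ab E mult by (auto simp: S_def)
      moreover have "b = a ** (a' ** b)" by (simp add: matrix_mul_assoc a')
      ultimately show ?thesis using ab by blast
    qed
    show "\<exists>S\<subseteq>F. (\<forall>a\<in>S. \<forall>b\<in>S. a ** b = b ** a) \<and>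
        (\<forall>E\<subseteq>F. card E > ((2 * K + 1)\<^sup>2) ^ (CARD('n)\<^sup>2) \<longrightarrow> (\<exists>a\<in>E. \<exists>b\<in>E. a \<noteq> b \<and> (\<exists>s\<in>S. b = a ** s)))"
      by (intro exI[of _ S] conjI ballI allI impI com pig) (auto simp: S_def)
  qed
qed

section \<open>Rings, homomorphisms and matrices\<close>

lemma is_subring_diff: "is_subring A \<Longrightarrow> x \<in> A \<Longrightarrow> y \<in> A \<Longrightarrow> x - y \<in> A"
  by (metis is_subring_def diff_conv_add_uminus)

lemma is_subring_sum: "is_subring A \<Longrightarrow> (\<And>i. i \<in> I \<Longrightarrow> f i \<in> A) \<Longrightarrow> sum f I \<in> A"
  by (induction I rule: infinite_finite_induct) (auto simp: is_subring_def)

lemma is_subring_prod: "is_subring A \<Longrightarrow> (\<And>i. i \<in> I \<Longrightarrow> f i \<in> A) \<Longrightarrow> prod f I \<in> A"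
  by (induction I rule: infinite_finite_induct) (auto simp: is_subring_def)

lemma is_subring_power: "is_subring A \<Longrightarrow> x \<in> A \<Longrightarrow> x ^ k \<in> A"
  by (induction k) (auto simp: is_subring_def)

lemma is_subring_of_nat: "is_subring A \<Longrightarrow> of_nat k \<in> A"
  by (induction k) (auto simp: is_subring_def)

text \<open>One notion serves the total maps \<phi> and \<iota> (with \<open>UNIV\<close>) as well
  as the maps that are meaningful only on a subring: embeddings into the complex numbers and
  automorphisms of O{u}.\<close>

definition ring_hom_on :: "'r::comm_ring_1 set \<Rightarrow> ('r \<Rightarrow> 's::comm_ring_1) \<Rightarrow> bool" where
  "ring_hom_on A f \<longleftrightarrow> is_subring A \<and> f 1 = 1 \<and>
     (\<forall>x\<in>A. \<forall>y\<in>A. f (x + y) = f x + f y \<and> f (x * y) = f x * f y)"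

lemma is_subring_UNIV: "is_subring UNIV"
  by (simp add: is_subring_def)

context
  fixes A :: "'r::comm_ring_1 set" and f :: "'r \<Rightarrow> 's::comm_ring_1"
  assumes hom: "ring_hom_on A f"
begin

lemma hom_on_0: "f 0 = 0"
proof -
  have "f (0 + 0) = f 0 + f 0" using hom unfolding ring_hom_on_def is_subring_def by blast
  then show ?thesis by simp
qed

lemma hom_on_add: "x \<in> A \<Longrightarrow> y \<in> A \<Longrightarrow> f (x + y) = f x + f y"
  and hom_on_mult: "x \<in> A \<Longrightarrow> y \<in> A \<Longrightarrow> f (x * y) = f x * f y"
  and hom_on_1: "f 1 = 1"
  and hom_on_subring: "is_subring A"
  using hom by (auto simp: ring_hom_on_def)

lemma hom_on_minus: "x \<in> A \<Longrightarrow> f (- x) = - f x"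
  using hom_on_add[of x "- x"] hom_on_subring hom_on_0
  by (simp add: is_subring_def eq_neg_iff_add_eq_0 add.commute)

lemma hom_on_diff: "x \<in> A \<Longrightarrow> y \<in> A \<Longrightarrow> f (x - y) = f x - f y"
  using hom_on_add[of x "- y"] hom_on_minus[of y] hom_on_subring by (simp add: is_subring_def)

lemma hom_on_sum: "(\<And>i. i \<in> I \<Longrightarrow> g i \<in> A) \<Longrightarrow> f (sum g I) = (\<Sum>i\<in>I. f (g i))"
proof (induction I rule: infinite_finite_induct)
  case (insert x F)
  then show ?case using is_subring_sum[OF hom_on_subring, of F g] by (simp add: hom_on_add)
qed (auto simp: hom_on_0)

lemma hom_on_prod: "(\<And>i. i \<in> I \<Longrightarrow> g i \<in> A) \<Longrightarrow> f (prod g I) = (\<Prod>i\<in>I. f (g i))"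
proof (induction I rule: infinite_finite_induct)
  case (insert x F)
  then show ?case using is_subring_prod[OF hom_on_subring, of F g] by (simp add: hom_on_mult)
qed (auto simp: hom_on_1)

lemma hom_on_power: "x \<in> A \<Longrightarrow> f (x ^ k) = f x ^ k"
  by (induction k) (simp_all add: hom_on_1 hom_on_mult is_subring_power[OF hom_on_subring])

lemma hom_on_of_nat: "f (of_nat k) = of_nat k"
proof (induction k)
  case (Suc k)
  have "f (of_nat k + 1) = f (of_nat k) + f 1"
    using is_subring_of_nat[OF hom_on_subring, of k] hom_on_subring
    by (intro hom_on_add) (auto simp: is_subring_def)
  then show ?case by (simp add: Suc hom_on_1 add.commute)
qed (simp add: hom_on_0)

lemma mmap_mat_1: "mmap f (mat 1 :: 'r^'n^'n) = mat 1"
  by (simp add: mmap_def mat_def vec_eq_iff hom_on_0 hom_on_1)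

lemma mmap_mult:
  assumes "entries M \<subseteq> A" "entries N \<subseteq> A"
  shows "mmap f (M ** N) = mmap f M ** mmap f N"
proof -
  have e: "M $ i $ j \<in> A" "N $ k $ l \<in> A" for i j k l using assms by (auto simp: entries_def)
  then have "M $ i $ j * N $ k $ l \<in> A" for i j k l
    using hom_on_subring by (simp add: is_subring_def)
  then show ?thesis
    by (simp add: mmap_def matrix_matrix_mult_def vec_eq_iff hom_on_sum hom_on_mult e)
qed

lemma det_mmap:
  assumes "A = UNIV"
  shows "det (mmap f M) = f (det M)"
proof -
  have mem: "x \<in> A" for x using assms by simp
  have sgn: "f (of_int (sign q)) = of_int (sign q)" for q :: "'n \<Rightarrow> 'n"
    by (auto simp: sign_def hom_on_1 hom_on_minus mem)
  show ?thesis
    by (simp add: det_def mmap_def hom_on_sum hom_on_mult hom_on_prod sgn mem)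
qed

end

lemma entries_mat_1: "is_subring A \<Longrightarrow> entries (mat 1 :: 'r::comm_ring_1^'n^'n) \<subseteq> A"
  by (auto simp: entries_def mat_def is_subring_def)

lemma entries_mult:
  assumes "is_subring A" "entries M \<subseteq> A" "entries N \<subseteq> A"
  shows "entries (M ** N) \<subseteq> A"
proof -
  have e: "M $ i $ j \<in> A" "N $ k $ l \<in> A" for i j k l using assms by (auto simp: entries_def)
  have "(M ** N) $ i $ j \<in> A" for i j
    unfolding matrix_matrix_mult_def using assms(1) e
    by (auto intro!: is_subring_sum simp: is_subring_def)
  then show ?thesis by (auto simp: entries_def)
qed

lemma finite_entries: "finite (entries (M :: 'a^'n::finite^'m::finite))"
proof -
  have "entries M = (\<lambda>(i, j). M $ i $ j) ` UNIV" by (auto simp: entries_def)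
  then show ?thesis by simp
qed

text \<open>Cramer's rule is available over fields; an injective homomorphism into a field transfers it
  to a domain.\<close>
context
  fixes f :: "'r::idom \<Rightarrow> 'a::field"
  assumes hom: "ring_hom_on UNIV f" and inj: "inj f"
begin

lemma cramer_domain:
  "det (\<chi> i j. if j = k then (A *v x) $ i else A $ i $ j) = x $ k * det (A :: 'r^'n^'n)"
proof -
  have "f ((A *v x) $ i) = (mmap f A *v (\<chi> j. f (x $ j))) $ i" for i
    by (simp add: matrix_vector_mult_def mmap_def hom_on_sum[OF hom] hom_on_mult[OF hom])
  then have "mmap f (\<chi> i j. if j = k then (A *v x) $ i else A $ i $ j)
     = (\<chi> i j. if j = k then (mmap f A *v (\<chi> j. f (x $ j))) $ i else mmap f A $ i $ j)"
    by (simp add: mmap_def vec_eq_iff)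
  then have "f (det (\<chi> i j. if j = k then (A *v x) $ i else A $ i $ j)) = f (x $ k * det A)"
    by (simp add: det_mmap[OF hom, symmetric] cramer_lemma hom_on_mult[OF hom])
  then show ?thesis using inj by (auto dest: injD)
qed

lemma invertible_if_det_unit:
  assumes "det A dvd 1"
  shows "invertible (A :: 'r^'n^'n)"
proof -
  obtain d where d: "det A * d = 1" using assms by (auto simp: dvd_def)
  \<comment> \<open>The adjugate divided by the determinant: column l is Cramer's solution of A x =
    e_l.\<close>
  define B where "B = (\<chi> k l. d * det (\<chi> i j. if j = k then (if i = l then 1 else 0) else A $ i $ j))"
  let ?A = "mmap f A"
  have dA: "det ?A = f (det A)" by (rule det_mmap[OF hom refl])
  have df: "det ?A * f d = 1"
    using d by (metis dA hom hom_on_1 hom_on_mult UNIV_I)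
  then have "det ?A \<noteq> 0" by auto
  then have inv: "invertible ?A" by (simp add: invertible_det_nz)
  note I = matrix_inv_inverse[OF inv]
  have "mmap f B = matrix_inv ?A"
  proof -
    have "f (B $ k $ l) = matrix_inv ?A $ k $ l" for k l
    proof -
      have col: "?A *v (matrix_inv ?A *v axis l 1) = axis l 1"
        by (simp add: matrix_vector_mul_assoc I)
      have e: "mmap f (\<chi> i j. if j = k then (if i = l then 1 else 0) else A $ i $ j)
         = (\<chi> i j. if j = k then axis l 1 $ i else ?A $ i $ j)"
        by (simp add: mmap_def vec_eq_iff axis_def hom_on_0[OF hom] hom_on_1[OF hom])
      have "f (B $ k $ l) = f d * det (mmap f (\<chi> i j. if j = k then (if i = l then 1 else 0) else A $ i $ j))"
        by (simp add: B_def hom_on_mult[OF hom] det_mmap[OF hom])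
      also have "\<dots> = f d * ((matrix_inv ?A *v axis l 1) $ k * det ?A)"
        unfolding e by (subst cramer_lemma[symmetric]) (simp only: col)
      also have "\<dots> = (matrix_inv ?A *v axis l 1) $ k" using df by (simp add: mult_ac)
      finally show ?thesis by (simp add: matrix_vector_mult_def axis_def if_distrib[of "\<lambda>x. _ * x"] cong: if_cong)
    qed
    then show ?thesis by (simp add: mmap_def vec_eq_iff)
  qed
  then have "mmap f (A ** B) = mmap f (mat 1)" "mmap f (B ** A) = mmap f (mat 1)"
    using I by (simp_all add: mmap_mult[OF hom] mmap_mat_1[OF hom])
  then have "A ** B = mat 1" "B ** A = mat 1"
    by (simp_all add: mmap_def vec_eq_iff inj_eq[OF inj])
  then show ?thesis by (auto simp: invertible_def)
qed

end

lemma invertible_det_unit: "invertible (A :: 'r::comm_ring_1^'n^'n) \<Longrightarrow> det A dvd 1"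
  by (metis det_I det_mul dvd_triv_left invertible_def)

section \<open>Embedding finitely generated domains into the complex numbers\<close>

definition polys_over :: "'a::comm_ring_1 set \<Rightarrow> 'a poly set" where
  "polys_over A = {f. \<forall>i. coeff f i \<in> A}"

lemma countable_polys_over:
  assumes "countable A" shows "countable (polys_over A)"
proof (rule countable_subset)
  show "polys_over A \<subseteq> Poly ` lists A"
  proof
    fix f assume "f \<in> polys_over A"
    then have "set (coeffs f) \<subseteq> A" by (auto simp: polys_over_def coeffs_def)
    then show "f \<in> Poly ` lists A" by (metis Poly_coeffs imageI in_listsI subset_iff)
  qed
qed (use assms in auto)

context
  fixes A :: "'r::idom set" and h :: "'r \<Rightarrow> complex"
  assumes hom: "ring_hom_on A h" and inj: "inj_on h A"
begin

lemmas sub = hom_on_subring[OF hom] and h1 = hom_on_1[OF hom] and hadd = hom_on_add[OF hom]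
  and hmult = hom_on_mult[OF hom] and emb_0 = hom_on_0[OF hom] and emb_minus = hom_on_minus[OF hom]
  and emb_sum = hom_on_sum[OF hom]

lemma emb_eq_0_iff: "x \<in> A \<Longrightarrow> h x = 0 \<longleftrightarrow> x = 0"
  using inj emb_0 sub by (metis inj_onD is_subring_def)

definition hp :: "'r poly \<Rightarrow> complex poly" where "hp f = map_poly h f"

lemma coeff_hp: "coeff (hp f) i = h (coeff f i)"
  by (simp add: hp_def coeff_map_poly emb_0)

lemma polys_over_add: "f \<in> polys_over A \<Longrightarrow> g \<in> polys_over A \<Longrightarrow> f + g \<in> polys_over A"
  using sub by (auto simp: polys_over_def is_subring_def)

lemma polys_over_mult: "f \<in> polys_over A \<Longrightarrow> g \<in> polys_over A \<Longrightarrow> f * g \<in> polys_over A"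
  unfolding polys_over_def mem_Collect_eq coeff_mult
  by (intro allI is_subring_sum[OF sub]) (use sub in \<open>auto simp: is_subring_def\<close>)

lemma polys_over_minus: "f \<in> polys_over A \<Longrightarrow> - f \<in> polys_over A"
  using sub by (auto simp: polys_over_def is_subring_def)

lemma polys_over_diff: "f \<in> polys_over A \<Longrightarrow> g \<in> polys_over A \<Longrightarrow> f - g \<in> polys_over A"
  using polys_over_add[of f "- g"] polys_over_minus[of g] by simp

lemma polys_over_monom: "c \<in> A \<Longrightarrow> monom c k \<in> polys_over A"
  using sub by (auto simp: polys_over_def is_subring_def)

lemma polys_over_smult: "c \<in> A \<Longrightarrow> f \<in> polys_over A \<Longrightarrow> smult c f \<in> polys_over A"
  using sub by (auto simp: polys_over_def is_subring_def)

lemma hp_add: "f \<in> polys_over A \<Longrightarrow> g \<in> polys_over A \<Longrightarrow> hp (f + g) = hp f + hp g"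
  by (intro poly_eqI) (auto simp: coeff_hp hadd polys_over_def)

lemma hp_mult: "f \<in> polys_over A \<Longrightarrow> g \<in> polys_over A \<Longrightarrow> hp (f * g) = hp f * hp g"
proof (intro poly_eqI)
  fix n assume fg: "f \<in> polys_over A" "g \<in> polys_over A"
  then have "coeff f i * coeff g j \<in> A" for i j using sub by (auto simp: polys_over_def is_subring_def)
  then show "coeff (hp (f * g)) n = coeff (hp f * hp g) n"
    using fg by (simp add: coeff_hp coeff_mult emb_sum hmult polys_over_def)
qed

lemma hp_minus: "f \<in> polys_over A \<Longrightarrow> hp (- f) = - hp f"
  by (intro poly_eqI) (auto simp: coeff_hp emb_minus polys_over_def)

lemma hp_diff: "f \<in> polys_over A \<Longrightarrow> g \<in> polys_over A \<Longrightarrow> hp (f - g) = hp f - hp g"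
  using hp_add[of f "- g"] polys_over_minus hp_minus by simp

lemma hp_smult: "c \<in> A \<Longrightarrow> f \<in> polys_over A \<Longrightarrow> hp (smult c f) = smult (h c) (hp f)"
  by (intro poly_eqI) (auto simp: coeff_hp hmult polys_over_def)

lemma degree_hp: "f \<in> polys_over A \<Longrightarrow> degree (hp f) = degree f"
proof -
  assume f: "f \<in> polys_over A"
  then have fi: "coeff f i \<in> A" for i by (simp add: polys_over_def)
  have "degree (hp f) \<le> degree f" by (rule degree_le) (simp add: coeff_hp emb_0 coeff_eq_0)
  moreover have "degree f \<le> degree (hp f)"
  proof (intro degree_le allI impI)
    show "coeff f i = 0" if "degree (hp f) < i" for i
      using coeff_eq_0[OF that] emb_eq_0_iff[OF fi] by (simp add: coeff_hp)
  qed
  ultimately show ?thesis by simp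
qed

lemma hp_eq_0_iff: "f \<in> polys_over A \<Longrightarrow> hp f = 0 \<longleftrightarrow> f = 0"
  by (auto simp: poly_eq_iff coeff_hp emb_eq_0_iff polys_over_def)

text \<open>\<open>A\<close> is only a ring, so g is first multiplied by a power of the leading
  coefficient of f. This keeps quotient and remainder over \<open>A\<close>, where \<open>hp\<close>
  is multiplicative.\<close>

lemma pseudo_division:
  assumes f: "f \<in> polys_over A" "f \<noteq> 0" and g: "g \<in> polys_over A"
  shows "\<exists>k. \<exists>s\<in>polys_over A. \<exists>r\<in>polys_over A.
    smult (lead_coeff f ^ k) g = s * f + r \<and> (r = 0 \<or> degree r < degree f)"
  using g
proof (induction "degree g" arbitrary: g rule: less_induct)
  case less
  have lcA: "lead_coeff f \<in> A" "lead_coeff g \<in> A" using f less.prems by (auto simp: polys_over_def)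
  have zA: "0 \<in> polys_over A" using sub by (auto simp: polys_over_def is_subring_def)
  show ?case
  proof (cases "g = 0 \<or> degree g < degree f")
    case True
    then show ?thesis using less.prems zA by (intro exI[of _ 0] bexI[of _ 0] bexI[of _ g]) auto
  next
    case False
    define m where "m = monom (lead_coeff g) (degree g - degree f)"
    define g' where "g' = smult (lead_coeff f) g - m * f"
    have mA: "m \<in> polys_over A" using lcA by (simp add: m_def polys_over_monom)
    have g'A: "g' \<in> polys_over A"
      unfolding g'_def using lcA mA f less.prems by (intro polys_over_diff polys_over_smult polys_over_mult)
    have m0: "m \<noteq> 0" using False by (simp add: m_def monom_eq_0_iff)
    have degm: "degree (m * f) = degree g" 
    proof -
      have "degree m = degree g - degree f" using False by (simp add: m_def degree_monom_eq)
      then show ?thesis using False f m0 by (subst degree_mult_eq) auto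
    qed
    have "g' = 0 \<or> degree g' < degree g"
    proof (cases "degree g = 0")
      case True
      then have "degree f = 0" using False by simp
      then obtain c d where "f = [:c:]" "g = [:d:]" using True by (metis degree_eq_zeroE)
      then have "g' = 0" by (simp add: g'_def m_def monom_0 mult.commute)
      then show ?thesis ..
    next
      case dg: False
      have "degree g' \<le> degree g" unfolding g'_def
        using degm by (intro degree_diff_le) (auto intro: order_trans[OF degree_smult_le])
      moreover have "coeff g' (degree g) = 0"
      proof -
        have "coeff (m * f) (degree g) = lead_coeff (m * f)" by (simp only: degm)
        also have "\<dots> = lead_coeff g * lead_coeff f"
          by (simp only: lead_coeff_mult m_def lead_coeff_monom)
        finally have "coeff (m * f) (degree g) = lead_coeff g * lead_coeff f" .
        then show ?thesis by (simp add: g'_def mult.commute)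
      qed
      ultimately show ?thesis by (rule eq_zero_or_degree_less)
    qed
    then show ?thesis
    proof
      assume "g' = 0"
      then have "smult (lead_coeff f ^ 1) g = m * f + 0" by (simp add: g'_def)
      with mA zA show ?thesis by blast
    next
      assume "degree g' < degree g"
      from less.hyps[OF this g'A] obtain k s r where ksr: "s \<in> polys_over A" "r \<in> polys_over A"
        "smult (lead_coeff f ^ k) g' = s * f + r" "r = 0 \<or> degree r < degree f" by blast
      have "smult (lead_coeff f ^ Suc k) g = smult (lead_coeff f ^ k) g' + smult (lead_coeff f ^ k) m * f"
        by (simp only: g'_def smult_diff_right smult_smult mult_smult_left power_Suc2 diff_add_cancel)
      also have "\<dots> = (s + smult (lead_coeff f ^ k) m) * f + r"
        unfolding ksr(3) by (simp only: distrib_right add_ac)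
      finally have "smult (lead_coeff f ^ Suc k) g = (s + smult (lead_coeff f ^ k) m) * f + r" .
      moreover have "s + smult (lead_coeff f ^ k) m \<in> polys_over A"
        using ksr mA lcA is_subring_power[OF sub] by (intro polys_over_add polys_over_smult) auto
      ultimately show ?thesis using ksr(2,4) by blast
    qed
  qed
qed

text \<open>The image of \<open>x\<close>: transcendental over the countable ring \<open>h ` A\<close> if \<open>x\<close> is transcendental over
  \<open>A\<close>, and otherwise a root of the image of a polynomial of least degree annihilating \<open>x\<close>.\<close>
lemma extension_root:
  assumes "countable A"
  shows "\<exists>z. \<forall>f\<in>polys_over A. poly f x = 0 \<longleftrightarrow> poly (hp f) z = 0"
proof (cases "\<exists>f\<in>polys_over A. f \<noteq> 0 \<and> poly f x = 0")
  case False
  note countable_polys_over[OF assms]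
  then have "countable (\<Union>f\<in>polys_over A - {0}. {z. poly (hp f) z = 0})"
    by (intro countable_UN) (auto intro!: countable_finite poly_roots_finite simp: hp_eq_0_iff)
  then have "(\<Union>f\<in>polys_over A - {0}. {z. poly (hp f) z = 0}) \<noteq> UNIV"
    using uncountable_UNIV_complex by metis
  then obtain z where z: "\<And>f. f \<in> polys_over A \<Longrightarrow> f \<noteq> 0 \<Longrightarrow> poly (hp f) z \<noteq> 0" by blast
  have "hp 0 = 0" by (simp add: hp_def)
  with z False show ?thesis by (intro exI[of _ z]) (metis poly_0)
next
  case True
  define P where "P d \<longleftrightarrow> (\<exists>f\<in>polys_over A. f \<noteq> 0 \<and> poly f x = 0 \<and> degree f = d)" for d
  have "\<exists>d. P d" using True by (auto simp: P_def)
  then have "P (LEAST d. P d)" by (rule LeastI_ex)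
  then obtain f where f: "f \<in> polys_over A" "f \<noteq> 0" "poly f x = 0" "degree f = (LEAST d. P d)"
    by (auto simp: P_def)
  have fmin: "degree f \<le> degree g" if "g \<in> polys_over A" "g \<noteq> 0" "poly g x = 0" for g
    unfolding f(4) using that by (intro Least_le) (auto simp: P_def)
  have "degree f > 0"
  proof (rule ccontr)
    assume "\<not> degree f > 0"
    then obtain c where "f = [:c:]" by (auto elim: degree_eq_zeroE)
    with f(2,3) show False by simp
  qed
  then obtain z where z: "poly (hp f) z = 0"
    using alg_closed_imp_poly_has_root[of "hp f"] degree_hp[OF f(1)] by auto
  \<comment> \<open>The converse direction compares f with a polynomial g of least degree whose
    image kills z: g divides, up to a constant, everything whose image kills z.\<close>
  define P' where "P' d \<longleftrightarrow> (\<exists>g\<in>polys_over A. g \<noteq> 0 \<and> poly (hp g) z = 0 \<and> degree g = d)" for d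
  have "\<exists>d. P' d" using f z by (auto simp: P'_def)
  then have "P' (LEAST d. P' d)" by (rule LeastI_ex)
  then obtain g where g: "g \<in> polys_over A" "g \<noteq> 0" "poly (hp g) z = 0" "degree g = (LEAST d. P' d)"
    by (auto simp: P'_def)
  have gmin: "degree g \<le> degree k" if "k \<in> polys_over A" "k \<noteq> 0" "poly (hp k) z = 0" for k
    unfolding g(4) using that by (intro Least_le) (auto simp: P'_def)
  have pow: "lead_coeff k ^ i \<in> A" "h (lead_coeff k ^ i) \<noteq> 0" if "k \<in> polys_over A" "k \<noteq> 0" for k i
  proof -
    show *: "lead_coeff k ^ i \<in> A" using that sub by (intro is_subring_power) (auto simp: polys_over_def)
    show "h (lead_coeff k ^ i) \<noteq> 0" using that emb_eq_0_iff[OF *] by simp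
  qed
  have to: "poly (hp k) z = 0" if k: "k \<in> polys_over A" "poly k x = 0" for k
  proof -
    obtain i s r where r: "s \<in> polys_over A" "r \<in> polys_over A"
      "smult (lead_coeff f ^ i) k = s * f + r" "r = 0 \<or> degree r < degree f"
      using pseudo_division[OF f(1,2) k(1)] by blast
    have "poly (smult (lead_coeff f ^ i) k) x = poly (s * f + r) x" by (simp only: r(3))
    then have "poly r x = 0" using k f by simp
    with r fmin have "r = 0" by force
    then have "hp (smult (lead_coeff f ^ i) k) = hp s * hp f"
      using r f by (simp add: hp_mult)
    then have "smult (h (lead_coeff f ^ i)) (hp k) = hp s * hp f"
      using pow[OF f(1,2)] k by (simp add: hp_smult)
    then have "h (lead_coeff f ^ i) * poly (hp k) z = 0" using z by (metis mult_zero_right poly_mult poly_smult)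
    then show ?thesis using pow[OF f(1,2)] by simp
  qed
  have div: "\<exists>i. \<exists>s\<in>polys_over A. smult (lead_coeff g ^ i) k = s * g"
    if k: "k \<in> polys_over A" "poly (hp k) z = 0" for k
  proof -
    obtain i s r where r: "s \<in> polys_over A" "r \<in> polys_over A"
      "smult (lead_coeff g ^ i) k = s * g + r" "r = 0 \<or> degree r < degree g"
      using pseudo_division[OF g(1,2) k(1)] by blast
    have "smult (h (lead_coeff g ^ i)) (hp k) = hp s * hp g + hp r"
      using pow[OF g(1,2)] k r g by (metis hp_add hp_mult hp_smult polys_over_mult)
    from arg_cong[OF this, of "\<lambda>p. poly p z"] have "poly (hp r) z = 0" using k g by simp
    with r gmin have "r = 0" by force
    with r show ?thesis by auto
  qed
  \<comment> \<open>This is the irreducibility of f: otherwise the cofactor of g in a multiple of f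
    would annihilate x, hence have degree at least that of f, leaving g constant.\<close>
  have gx: "poly g x = 0"
  proof (rule ccontr)
    assume gx: "poly g x \<noteq> 0"
    obtain i s where s: "s \<in> polys_over A" "smult (lead_coeff g ^ i) f = s * g"
      using div[OF f(1) z] by blast
    from arg_cong[OF s(2), of "\<lambda>p. poly p x"] gx f have sx: "poly s x = 0" by simp
    have s0: "s \<noteq> 0" using s(2) f(2) g(2) by auto
    have "degree f = degree s + degree g"
      using arg_cong[OF s(2), of degree] s0 g(2) by (simp add: degree_mult_eq)
    with fmin[OF s(1) s0 sx] have "degree g = 0" by simp
    then obtain c where c: "g = [:c:]" by (auto elim: degree_eq_zeroE)
    then have "h c = 0" using g(3) by (simp add: hp_def map_poly_pCons emb_0)
    moreover have "coeff g 0 \<in> A" using g(1) by (simp add: polys_over_def)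
    then have "c \<in> A" using c by simp
    ultimately show False using c g(2) emb_eq_0_iff by simp
  qed
  have "poly k x = 0" if k: "k \<in> polys_over A" "poly (hp k) z = 0" for k
  proof -
    obtain i s where s: "smult (lead_coeff g ^ i) k = s * g" using div[OF k] by blast
    from arg_cong[OF s, of "\<lambda>p. poly p x"] gx g(2) show ?thesis by simp
  qed
  with to show ?thesis by (intro exI[of _ z] ballI iffI)
qed

text \<open>The new ring is A[x], and f(x) is sent to the value of the image of f at z. The
  equivalence of \<open>extension_root\<close> gives both independence of the chosen representative
  and injectivity.\<close>

lemma embedding_extend:
  assumes "countable A"
  shows "\<exists>A' (h' :: 'r \<Rightarrow> complex). ring_hom_on A' h' \<and> inj_on h' A' \<and> countable A' \<and> A \<subseteq> A' \<and> x \<in> A'"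
proof -
  obtain z where z: "\<And>f. f \<in> polys_over A \<Longrightarrow> poly f x = 0 \<longleftrightarrow> poly (hp f) z = 0"
    using extension_root[OF assms, of x] by blast
  define A' where "A' = (\<lambda>f. poly f x) ` polys_over A"
  define rep where "rep y = (SOME f. f \<in> polys_over A \<and> poly f x = y)" for y
  define h' where "h' y = poly (hp (rep y)) z" for y
  have rep: "rep y \<in> polys_over A \<and> poly (rep y) x = y" if "y \<in> A'" for y
    unfolding rep_def by (rule someI_ex) (use that in \<open>auto simp: A'_def\<close>)
  have eq: "poly f x = poly g x \<longleftrightarrow> poly (hp f) z = poly (hp g) z"
    if "f \<in> polys_over A" "g \<in> polys_over A" for f g
    using z[OF polys_over_diff[OF that]] that by (simp add: hp_diff)
  have mem: "poly f x \<in> A'" if "f \<in> polys_over A" for f using that by (auto simp: A'_def)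
  have h': "h' (poly f x) = poly (hp f) z" if "f \<in> polys_over A" for f
    unfolding h'_def using eq rep[OF mem[OF that]] that by blast
  have constA: "[:c:] \<in> polys_over A" if "c \<in> A" for c
    using polys_over_monom[OF that, of 0] by (simp add: monom_0)
  have XA: "[:0, 1:] \<in> polys_over A"
    using sub by (auto simp: polys_over_def is_subring_def coeff_pCons split: nat.split)
  have A01: "0 \<in> A" "1 \<in> A" using sub by (auto simp: is_subring_def)
  show ?thesis
    unfolding ring_hom_on_def
  proof (intro exI conjI ballI)
    show "is_subring A'"
      unfolding is_subring_def
    proof (intro conjI ballI)
      show "0 \<in> A'" "1 \<in> A'" using mem[OF constA[OF A01(1)]] mem[OF constA[OF A01(2)]] by auto
      show "- a \<in> A'" if "a \<in> A'" for a
        using mem[OF polys_over_minus, of "rep a"] rep[OF that] by simp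
      show "a + b \<in> A'" "a * b \<in> A'" if "a \<in> A'" "b \<in> A'" for a b
        using mem[OF polys_over_add, of "rep a" "rep b"] mem[OF polys_over_mult, of "rep a" "rep b"]
          rep[OF that(1)] rep[OF that(2)] by simp_all
    qed
    show "countable A'" unfolding A'_def using countable_polys_over[OF assms] by simp
    show "A \<subseteq> A'" using mem[OF constA] by auto
    show "x \<in> A'" using mem[OF XA] by simp
    show "inj_on h' A'"
    proof (rule inj_onI)
      fix a b assume ab: "a \<in> A'" "b \<in> A'" and "h' a = h' b"
      then have "poly (hp (rep a)) z = poly (hp (rep b)) z" by (simp add: h'_def)
      then have "poly (rep a) x = poly (rep b) x" using eq rep ab by blast
      then show "a = b" using rep[OF ab(1)] rep[OF ab(2)] by simp
    qed
    show "h' 1 = 1" using h'[OF constA[OF A01(2)]] by (simp add: hp_def map_poly_pCons emb_0 h1)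
    show "h' (a + b) = h' a + h' b" "h' (a * b) = h' a * h' b" if "a \<in> A'" "b \<in> A'" for a b
      using h'[OF polys_over_add, of "rep a" "rep b"] h'[OF polys_over_mult, of "rep a" "rep b"]
        rep[OF that(1)] rep[OF that(2)] by (simp_all add: hp_add hp_mult h'_def[of a] h'_def[of b])
  qed
qed

end

text \<open>Induction adjoins one element at a time, starting from the integers. Countability is
  carried along so that a transcendental value remains available at each step.\<close>

lemma finitely_generated_embedding:
  assumes char0: "\<And>k. k > 0 \<Longrightarrow> of_nat k \<noteq> (0::'r::idom)" and "finite E"
  shows "\<exists>A (h :: 'r \<Rightarrow> complex). ring_hom_on A h \<and> inj_on h A \<and> countable A \<and> E \<subseteq> A"
  using assms(2)
proof (induction E rule: finite_induct)
  case empty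
  have inj: "inj (of_int :: int \<Rightarrow> 'r)"
  proof (rule injI)
    fix i j :: int assume "of_int i = (of_int j :: 'r)"
    then have *: "of_int (i - j) = (0::'r)" "of_int (j - i) = (0::'r)" by simp_all
    have "of_nat (nat \<bar>i - j\<bar>) = (0::'r)"
      using * by (cases "i \<ge> j") (simp_all add: of_nat_nat)
    then show "i = j" using char0[of "nat \<bar>i - j\<bar>"] by fastforce
  qed
  define h :: "'r \<Rightarrow> complex" where "h x = of_int (inv_into UNIV of_int x)" for x
  have h: "h (of_int i) = of_int i" for i by (simp add: h_def inv_f_f inj)
  show ?case
    unfolding ring_hom_on_def
  proof (intro exI[of _ "range of_int"] exI[of _ h] conjI)
    show "is_subring (range of_int :: 'r set)"
      unfolding is_subring_def
      by (auto simp flip: of_int_add of_int_mult of_int_minus intro: range_eqI[of _ _ 0] range_eqI[of _ _ 1])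
    show "inj_on h (range of_int)" by (auto simp: inj_on_def h)
    show "h 1 = 1" using h[of 1] by simp
    show "\<forall>a\<in>range of_int. \<forall>b\<in>range of_int. h (a + b) = h a + h b \<and> h (a * b) = h a * h b"
      by (auto simp: h simp flip: of_int_add of_int_mult)
  qed auto
next
  case (insert x E)
  then obtain A and h :: "'r \<Rightarrow> complex" where
    A: "ring_hom_on A h" "inj_on h A" "countable A" "E \<subseteq> A" by (elim exE conjE)
  from embedding_extend[OF A(1-3), of x]
  obtain A' and h' :: "'r \<Rightarrow> complex" where
    A': "ring_hom_on A' h'" "inj_on h' A'" "countable A'" "A \<subseteq> A'" "x \<in> A'" by (elim exE conjE)
  have "insert x E \<subseteq> A'" using A(4) A'(4,5) by auto
  with A' show ?case by (intro exI[of _ A'] exI[of _ h'] conjI)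
qed

section \<open>Virtually abelian groups\<close>

text \<open>Let \<open>B\<close> consist of the elements whose centralizer has index at most \<open>J\<close>. By local finiteness the
  hypothesis on finite subsets makes \<open>B\<close> large, the chain condition gives its centralizer \<open>C\<close>
  finite index, and \<open>B\<close> lies in the centralizer of \<open>C\<close>; hence the center of \<open>C\<close> has finite index.\<close>
lemma (in group) virtually_abelian:
  assumes locfin: "\<And>E. finite E \<Longrightarrow> E \<subseteq> carrier G \<Longrightarrow> \<exists>F S. E \<subseteq> F \<and> F \<subseteq> carrier G \<and> S \<subseteq> F \<and>
      (\<forall>s\<in>S. \<forall>t\<in>S. s \<otimes> t = t \<otimes> s) \<and>
      (\<forall>E'\<subseteq>F. card E' > J \<longrightarrow> (\<exists>a\<in>E'. \<exists>b\<in>E'. a \<noteq> b \<and> (\<exists>s\<in>S. b = a \<otimes> s)))"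
    and chain: "\<And>B. B \<subseteq> carrier G \<Longrightarrow> \<exists>B0\<subseteq>B. finite B0 \<and>
      (\<forall>c\<in>carrier G. (\<forall>b\<in>B0. c \<otimes> b = b \<otimes> c) \<longrightarrow> (\<forall>b\<in>B. c \<otimes> b = b \<otimes> c))"
  shows "\<exists>H. H \<lhd> G \<and> finite (rcosets H) \<and> (\<forall>x\<in>H. \<forall>y\<in>H. x \<otimes> y = y \<otimes> x)"
proof -
  define Z where "Z X = {g \<in> carrier G. \<forall>x\<in>X. g \<otimes> x = x \<otimes> g}" for X
  have cancel: "inv g \<otimes> (g \<otimes> x) = x" "g \<otimes> (inv g \<otimes> x) = x" if "g \<in> carrier G" "x \<in> carrier G" for g x
    using that by (simp_all flip: m_assoc)
  have inv_comm: "inv a \<otimes> x = x \<otimes> inv a"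
    if "a \<in> carrier G" "x \<in> carrier G" "a \<otimes> x = x \<otimes> a" for a x
  proof -
    have "inv a \<otimes> (x \<otimes> a) \<otimes> inv a = inv a \<otimes> (a \<otimes> x) \<otimes> inv a" using that by simp
    then show ?thesis using that(1,2) by (simp add: m_assoc cancel)
  qed
  \<comment> \<open>For a subgroup \<open>K\<close> this says that the elements of E lie in distinct
    left cosets, and \<open>small K\<close> that the index is at most J. Both are stated for sets
    because \<open>B\<close> is not known to be a subgroup.\<close>
  define indep where "indep K E \<longleftrightarrow> (\<forall>a\<in>E. \<forall>b\<in>E. a \<noteq> b \<longrightarrow> \<not> (\<exists>s\<in>K. b = a \<otimes> s))" for K E
  define small where "small K \<longleftrightarrow> (\<forall>E\<subseteq>carrier G. finite E \<longrightarrow> card E > J \<longrightarrow> \<not> indep K E)" for K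
  define B where "B = {g \<in> carrier G. small (Z {g})}"
  have Z_subgroup: "subgroup (Z X) G" if X: "X \<subseteq> carrier G" for X
  proof (rule subgroupI)
    show "Z X \<subseteq> carrier G" by (auto simp: Z_def)
    have "\<one> \<in> Z X" using X by (auto simp: Z_def)
    then show "Z X \<noteq> {}" by auto
    fix a assume a: "a \<in> Z X"
    show "inv a \<in> Z X"
      using a X unfolding Z_def by (auto simp: subset_iff intro!: inv_comm)
    fix b assume "b \<in> Z X"
    then show "a \<otimes> b \<in> Z X" using a X by (auto simp: Z_def subset_iff) (metis m_assoc)
  qed
  \<comment> \<open>An independent set of maximal size meets every left coset; \<tau> chooses the
    representative in it.\<close>
  have small_transversal: "\<exists>\<tau> :: 'a \<Rightarrow> 'a. finite (\<tau> ` carrier G) \<and>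
      (\<forall>g\<in>carrier G. \<forall>g'\<in>carrier G. \<tau> g = \<tau> g' \<longrightarrow> inv g \<otimes> g' \<in> K)"
    if K: "subgroup K G" "small K" for K
  proof -
    define P where "P E \<longleftrightarrow> E \<subseteq> carrier G \<and> finite E \<and> indep K E" for E
    have bound: "card E \<le> J" if "P E" for E
      using that K(2) unfolding P_def small_def by (metis not_le)
    let ?C = "{card E | E. P E}"
    have "P {}" by (simp add: P_def indep_def)
    then have ne: "?C \<noteq> {}" by blast
    have fC: "finite ?C" using bound by (intro finite_subset[of ?C "{..J}"]) auto
    from Max_in[OF fC ne] obtain E where E: "P E" "card E = Max ?C" by auto
    have ex: "\<exists>e\<in>E. inv e \<otimes> g \<in> K" if g: "g \<in> carrier G" for g
    proof (rule ccontr)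
      assume no: "\<not> (\<exists>e\<in>E. inv e \<otimes> g \<in> K)"
      have Ec: "E \<subseteq> carrier G" "finite E" using E by (auto simp: P_def)
      have Kc: "K \<subseteq> carrier G" using K(1) by (rule subgroup.subset)
      have no1: "g \<noteq> e \<otimes> s" if "e \<in> E" "s \<in> K" for e s
      proof
        assume "g = e \<otimes> s"
        then have "inv e \<otimes> g = s" using that Ec Kc by (metis inv_solve_left subset_iff g)
        with no that show False by auto
      qed
      have no2: "e \<noteq> g \<otimes> s" if "e \<in> E" "s \<in> K" for e s
      proof
        assume "e = g \<otimes> s"
        then have "g = e \<otimes> inv s" using that Ec Kc g by (metis inv_solve_right subset_iff)
        with no1[OF that(1), of "inv s"] K(1) that show False by (simp add: subgroup.m_inv_closed)
      qed
      have "g \<notin> E"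
        using no1[of g \<one>] subgroup.one_closed[OF K(1)] g by auto
      have "P (insert g E)"
        unfolding P_def indep_def
      proof (intro conjI ballI impI)
        show "insert g E \<subseteq> carrier G" "finite (insert g E)" using Ec g by auto
        have noE: "\<not> (\<exists>s\<in>K. b = a \<otimes> s)" if "a \<in> E" "b \<in> E" "a \<noteq> b" for a b
          using E(1) that by (simp add: P_def indep_def)
        fix a b assume ab: "a \<in> insert g E" "b \<in> insert g E" "a \<noteq> b"
        show "\<not> (\<exists>s\<in>K. b = a \<otimes> s)"
        proof (cases "a = g")
          case True
          then show ?thesis using ab no2[of b] by auto
        next
          case False
          then show ?thesis using ab no1[of a] noE[of a b] by (cases "b = g") auto
        qed
      qed
      then have "card (insert g E) \<le> Max ?C" by (intro Max_ge fC) blast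
      with \<open>g \<notin> E\<close> Ec E(2) show False by simp
    qed
    then obtain \<tau> where \<tau>: "\<And>g. g \<in> carrier G \<Longrightarrow> \<tau> g \<in> E \<and> inv (\<tau> g) \<otimes> g \<in> K" by metis
    have Ec: "E \<subseteq> carrier G" "finite E" using E by (auto simp: P_def)
    show ?thesis
    proof (intro exI[of _ \<tau>] conjI ballI impI)
      show "finite (\<tau> ` carrier G)" using \<tau> Ec(2) by (meson finite_subset image_subsetI)
      fix g g' assume g: "g \<in> carrier G" "g' \<in> carrier G" "\<tau> g = \<tau> g'"
      have t: "\<tau> g \<in> carrier G" using \<tau> g Ec by auto
      have "inv g \<otimes> g' = inv (inv (\<tau> g) \<otimes> g) \<otimes> (inv (\<tau> g) \<otimes> g')"
        using g t by (simp add: inv_mult_group m_assoc cancel)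
      also have "\<dots> \<in> K"
        using \<tau>[OF g(1)] \<tau>[OF g(2)] g(3) K(1) by (simp add: subgroup.m_inv_closed subgroup.m_closed)
      finally show "inv g \<otimes> g' \<in> K" .
    qed
  qed
  have Bc: "B \<subseteq> carrier G" by (auto simp: B_def)
  \<comment> \<open>Suppose E has more than J elements, pairwise independent for \<open>B\<close>.
    Each a^(-1)b is then outside \<open>B\<close>, which is witnessed by a large set D(a,b)
    independent for its centralizer. All these sets lie in one finite F. There two elements a, b of
    E differ by some s in S, and two elements of D(a,b) by some t in S; but t commutes with s =
    a^(-1)b, a contradiction.\<close>
  have smallB: "small B"
    unfolding small_def
  proof (intro allI impI)
    fix E assume E: "E \<subseteq> carrier G" "finite E" "card E > J"
    show "\<not> indep B E"
    proof
      assume no: "indep B E"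
      have "\<exists>D. D \<subseteq> carrier G \<and> finite D \<and> card D > J \<and> indep (Z {inv a \<otimes> b}) D"
        if "a \<in> E" "b \<in> E" "a \<noteq> b" for a b
      proof -
        have ab: "a \<in> carrier G" "b \<in> carrier G" using that E by auto
        then have "b = a \<otimes> (inv a \<otimes> b)" by (simp flip: m_assoc)
        then have "inv a \<otimes> b \<notin> B" using no that unfolding indep_def by metis
        then have "\<not> small (Z {inv a \<otimes> b})" using ab by (simp add: B_def)
        then show ?thesis unfolding small_def by (simp only: not_all not_imp not_not)
      qed
      then obtain D where D: "\<And>a b. a \<in> E \<Longrightarrow> b \<in> E \<Longrightarrow> a \<noteq> b \<Longrightarrow> D a b \<subseteq> carrier G \<and> finite (D a b) \<and>
          card (D a b) > J \<and> indep (Z {inv a \<otimes> b}) (D a b)"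
        by metis
      let ?E = "E \<union> (\<Union>a\<in>E. \<Union>b\<in>E - {a}. D a b)"
      have "finite ?E" "?E \<subseteq> carrier G" using E D by auto
      from locfin[OF this] obtain F S where FS: "?E \<subseteq> F" "F \<subseteq> carrier G" "S \<subseteq> F"
        "\<forall>s\<in>S. \<forall>t\<in>S. s \<otimes> t = t \<otimes> s"
        "\<forall>E'\<subseteq>F. card E' > J \<longrightarrow> (\<exists>a\<in>E'. \<exists>b\<in>E'. a \<noteq> b \<and> (\<exists>s\<in>S. b = a \<otimes> s))"
        by (elim exE conjE)
      have "E \<subseteq> F" using FS(1) by blast
      from FS(5)[rule_format, OF this E(3)] obtain a b s where ab: "a \<in> E" "b \<in> E" "a \<noteq> b" "s \<in> S" "b = a \<otimes> s"
        by blast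
      have car: "a \<in> carrier G" "b \<in> carrier G" "s \<in> carrier G" using ab E FS by auto
      have s: "inv a \<otimes> b = s" using ab(5) car by (simp flip: m_assoc)
      have "b \<in> E - {a}" using ab by simp
      then have "D a b \<subseteq> F" using ab(1) FS(1) by (auto simp: UN_subset_iff)
      from FS(5)[rule_format, OF this] D[OF ab(1-3)] obtain c d t where
        cd: "c \<in> D a b" "d \<in> D a b" "c \<noteq> d" "t \<in> S" "d = c \<otimes> t" by auto
      have "t \<in> Z {inv a \<otimes> b}" unfolding s Z_def using FS(2,3) FS(4)[rule_format, OF cd(4) ab(4)] cd(4) by auto
      with D[OF ab(1-3)] cd(1,2,3,5) show False unfolding indep_def by metis
    qed
  qed
  define C where "C = Z B"
  have subC: "subgroup C G" unfolding C_def by (rule Z_subgroup[OF Bc])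
  have Cc: "C \<subseteq> carrier G" using subC by (rule subgroup.subset)
  have subZC: "subgroup (Z C) G" by (rule Z_subgroup[OF Cc])
  have "B \<subseteq> Z C" using Bc by (auto simp: C_def Z_def)
  then have smallZC: "small (Z C)" using smallB unfolding small_def indep_def by (meson subset_iff)
  define H where "H = C \<inter> Z C"
  have subH: "subgroup H G" unfolding H_def by (rule subgroups_Inter_pair[OF subC subZC])
  have conj: "g \<otimes> x \<otimes> inv g \<in> Z X" if X: "X \<subseteq> carrier G" and g: "g \<in> carrier G" and x: "x \<in> Z Y"
    and inv: "\<And>y. y \<in> X \<Longrightarrow> inv g \<otimes> y \<otimes> g \<in> Y" for g x X Y
  proof -
    have xc: "x \<in> carrier G" using x by (auto simp: Z_def)
    have "(g \<otimes> x \<otimes> inv g) \<otimes> y = y \<otimes> (g \<otimes> x \<otimes> inv g)" if y: "y \<in> X" for y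
    proof -
      have yc: "y \<in> carrier G" using y X by auto
      have "x \<otimes> (inv g \<otimes> y \<otimes> g) = (inv g \<otimes> y \<otimes> g) \<otimes> x" using x inv[OF y] by (auto simp: Z_def)
      then have "g \<otimes> (x \<otimes> (inv g \<otimes> y \<otimes> g)) \<otimes> inv g = g \<otimes> ((inv g \<otimes> y \<otimes> g) \<otimes> x) \<otimes> inv g" by simp
      moreover have "g \<otimes> (x \<otimes> (inv g \<otimes> y \<otimes> g)) \<otimes> inv g = (g \<otimes> x \<otimes> inv g) \<otimes> y"
        using g xc yc by (simp add: m_assoc)
      moreover have "g \<otimes> ((inv g \<otimes> y \<otimes> g) \<otimes> x) \<otimes> inv g = y \<otimes> (g \<otimes> x \<otimes> inv g)"
        using g xc yc by (simp add: m_assoc cancel)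
      ultimately show ?thesis by simp
    qed
    then show ?thesis using g xc by (simp add: Z_def)
  qed
  have conjB: "g \<otimes> b \<otimes> inv g \<in> B" if g: "g \<in> carrier G" and b: "b \<in> B" for g b
  proof -
    have bc: "b \<in> carrier G" using b Bc by auto
    have "small (Z {g \<otimes> b \<otimes> inv g})"
      unfolding small_def
    proof (intro allI impI)
      fix E assume E: "E \<subseteq> carrier G" "finite E" "card E > J"
      \<comment> \<open>Right translation by g carries left cosets of the centralizer of g b g^(-1)
        to left cosets of the centralizer of b.\<close>
      let ?f = "\<lambda>e. e \<otimes> g"
      have injf: "inj_on ?f E" using E g by (auto simp: inj_on_def subset_iff)
      have "?f ` E \<subseteq> carrier G" "finite (?f ` E)" "card (?f ` E) > J"
        using E g card_image[OF injf] by auto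
      then have "\<not> indep (Z {b}) (?f ` E)"
        using b unfolding B_def small_def by simp
      then obtain c d s where cd: "c \<in> E" "d \<in> E" "c \<otimes> g \<noteq> d \<otimes> g" "s \<in> Z {b}" "d \<otimes> g = c \<otimes> g \<otimes> s"
        unfolding indep_def by auto
      have car: "c \<in> carrier G" "d \<in> carrier G" "s \<in> carrier G" using cd E by (auto simp: Z_def)
      have "g \<otimes> s \<otimes> inv g \<in> Z {g \<otimes> b \<otimes> inv g}"
        using g cd(4) bc car
        by (intro conj[where Y = "{b}"]) (auto simp: m_assoc cancel)
      moreover have "d = c \<otimes> (g \<otimes> s \<otimes> inv g)"
      proof -
        have "d = (d \<otimes> g) \<otimes> inv g" using car g by (simp add: m_assoc)
        then show ?thesis unfolding cd(5) using car g by (simp add: m_assoc)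
      qed
      moreover have "c \<noteq> d" using cd(3) by auto
      ultimately show "\<not> indep (Z {g \<otimes> b \<otimes> inv g}) E"
        using cd(1,2) unfolding indep_def by metis
    qed
    then show ?thesis using g bc by (simp add: B_def)
  qed
  have conjB': "inv g \<otimes> b \<otimes> g \<in> B" if "g \<in> carrier G" "b \<in> B" for g b
    using conjB[of "inv g" b] that by simp
  have conjC: "g \<otimes> c \<otimes> inv g \<in> C" if "g \<in> carrier G" "c \<in> C" for g c
    unfolding C_def using that conjB' by (intro conj[OF Bc, where Y = B]) (auto simp: C_def)
  have conjC': "inv g \<otimes> c \<otimes> g \<in> C" if "g \<in> carrier G" "c \<in> C" for g c
    using conjC[of "inv g" c] that by simp
  have conjZC: "g \<otimes> c \<otimes> inv g \<in> Z C" if "g \<in> carrier G" "c \<in> Z C" for g c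
    using that conjC' by (intro conj[OF Cc, where Y = C]) auto
  have normal: "H \<lhd> G"
    unfolding normal_inv_iff using subH conjC conjZC by (auto simp: H_def)
  \<comment> \<open>The chain condition turns C into a finite intersection of centralizers of index
    at most J.\<close>
  obtain B0 where B0: "B0 \<subseteq> B" "finite B0"
    "\<And>c. c \<in> carrier G \<Longrightarrow> (\<forall>b\<in>B0. c \<otimes> b = b \<otimes> c) \<Longrightarrow> c \<in> C"
    using chain[OF Bc] unfolding C_def Z_def by blast
  have "\<exists>\<tau> :: 'a \<Rightarrow> 'a. finite (\<tau> ` carrier G) \<and>
      (\<forall>g\<in>carrier G. \<forall>g'\<in>carrier G. \<tau> g = \<tau> g' \<longrightarrow> inv g \<otimes> g' \<in> Z {b})" if "b \<in> B0" for b
    using that B0(1) Bc by (intro small_transversal Z_subgroup) (auto simp: B_def)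
  then have "\<forall>b\<in>B0. \<exists>\<tau> :: 'a \<Rightarrow> 'a. finite (\<tau> ` carrier G) \<and>
      (\<forall>g\<in>carrier G. \<forall>g'\<in>carrier G. \<tau> g = \<tau> g' \<longrightarrow> inv g \<otimes> g' \<in> Z {b})"
    by (rule ballI)
  from bchoice[OF this] obtain \<tau> :: "'a \<Rightarrow> 'a \<Rightarrow> 'a" where \<tau>0: "\<forall>b\<in>B0. finite (\<tau> b ` carrier G) \<and>
      (\<forall>g\<in>carrier G. \<forall>g'\<in>carrier G. \<tau> b g = \<tau> b g' \<longrightarrow> inv g \<otimes> g' \<in> Z {b})"
    by (elim exE)
  have \<tau>: "finite (\<tau> b ` carrier G)"
    "g \<in> carrier G \<Longrightarrow> g' \<in> carrier G \<Longrightarrow> \<tau> b g = \<tau> b g' \<Longrightarrow> inv g \<otimes> g' \<in> Z {b}"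
    if "b \<in> B0" for b g g'
    using \<tau>0[rule_format, OF that] by simp_all
  from small_transversal[OF subZC smallZC] obtain \<rho> :: "'a \<Rightarrow> 'a" where \<rho>0: "finite (\<rho> ` carrier G) \<and>
      (\<forall>g\<in>carrier G. \<forall>g'\<in>carrier G. \<rho> g = \<rho> g' \<longrightarrow> inv g \<otimes> g' \<in> Z C)"
    by (elim exE)
  have \<rho>: "finite (\<rho> ` carrier G)"
    "g \<in> carrier G \<Longrightarrow> g' \<in> carrier G \<Longrightarrow> \<rho> g = \<rho> g' \<Longrightarrow> inv g \<otimes> g' \<in> Z C" for g g'
    using \<rho>0 by simp_all
  \<comment> \<open>Equal values place g^(-1)g' in \<open>Z C\<close> and in every
    \<open>Z {b}\<close> with b in \<open>B0\<close>, hence in H.\<close>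
  define \<kappa> where "\<kappa> g = (\<rho> g, \<lambda>b\<in>B0. \<tau> b g)" for g
  have "\<kappa> ` carrier G \<subseteq> \<rho> ` carrier G \<times> PiE B0 (\<lambda>b. \<tau> b ` carrier G)" by (auto simp: \<kappa>_def)
  moreover have "finite \<dots>" using \<rho>(1) B0(2) \<tau>(1) by (intro finite_cartesian_product finite_PiE) auto
  ultimately have fin\<kappa>: "finite (\<kappa> ` carrier G)" by (rule finite_subset)
  have coset: "H #> g = H #> g'" if g: "g \<in> carrier G" "g' \<in> carrier G" "\<kappa> g = \<kappa> g'" for g g'
  proof -
    have "\<tau> b g = \<tau> b g'" if "b \<in> B0" for b
      using g(3) that unfolding \<kappa>_def by (metis restrict_apply' snd_conv)
    then have "inv g \<otimes> g' \<in> C"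
      using g B0(1) \<tau>(2) by (intro B0(3)) (auto simp: Z_def)
    moreover have "inv g \<otimes> g' \<in> Z C" using \<rho>(2) g by (simp add: \<kappa>_def)
    ultimately have h: "inv g \<otimes> g' \<in> H" by (simp add: H_def)
    \<comment> \<open>The data compare left cosets while \<open>rcosets\<close> has right cosets;
      normality translates.\<close>
    then have "g \<otimes> (inv g \<otimes> g') \<otimes> inv g \<in> H" using normal g(1) unfolding normal_inv_iff by blast
    then have "g' \<otimes> inv g \<in> H" using g by (simp flip: m_assoc)
    moreover have "g' = g' \<otimes> inv g \<otimes> g" using g by (simp add: m_assoc)
    ultimately have "g' \<in> H #> g" unfolding r_coset_def by blast
    then show ?thesis using g subH by (intro repr_independence) auto
  qed
  define \<theta> where "\<theta> y = H #> (SOME g. g \<in> carrier G \<and> \<kappa> g = y)" for y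
  have "rcosets H \<subseteq> \<theta> ` \<kappa> ` carrier G"
  proof
    fix X assume "X \<in> rcosets H"
    then obtain g where g: "g \<in> carrier G" "X = H #> g" by (auto simp: RCOSETS_def)
    have "\<exists>g'. g' \<in> carrier G \<and> \<kappa> g' = \<kappa> g" using g by auto
    then have "(SOME g'. g' \<in> carrier G \<and> \<kappa> g' = \<kappa> g) \<in> carrier G \<and> \<kappa> (SOME g'. g' \<in> carrier G \<and> \<kappa> g' = \<kappa> g) = \<kappa> g"
      by (rule someI_ex)
    then have "\<theta> (\<kappa> g) = X" unfolding \<theta>_def g(2) using coset g(1) by blast
    then show "X \<in> \<theta> ` \<kappa> ` carrier G" using g(1) by blast
  qed
  then have "finite (rcosets H)" using fin\<kappa> by (meson finite_imageI finite_subset)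
  moreover have "\<forall>x\<in>H. \<forall>y\<in>H. x \<otimes> y = y \<otimes> x"
  proof (intro ballI)
    fix x y assume xy: "x \<in> H" "y \<in> H"
    have "x \<in> Z C" using xy(1) unfolding H_def by (rule IntD2)
    have y: "y \<in> C" using xy(2) unfolding H_def by (rule IntD1)
    from \<open>x \<in> Z C\<close> have "\<forall>c\<in>C. x \<otimes> c = c \<otimes> x" unfolding Z_def mem_Collect_eq by (rule conjunct2)
    then show "x \<otimes> y = y \<otimes> x" using y by (rule bspec)
  qed
  ultimately show ?thesis using normal by (intro exI[of _ H] conjI)
qed

section \<open>Arithmetic of the ring R\<close>

lemma dvd_diff_mult:
  fixes d :: "'r::comm_ring_1"
  assumes "d dvd a - b" "d dvd a' - b'"
  shows "d dvd a * a' - b * b'"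
proof -
  have "a * a' - b * b' = a * (a' - b') + (a - b) * b'" by (simp add: algebra_simps)
  then show ?thesis using assms by (metis dvd_add dvd_mult dvd_mult2)
qed

lemma dvd_diff_swap: "(d :: 'r::comm_ring_1) dvd a - b \<longleftrightarrow> d dvd b - a"
  by (metis dvd_minus_iff minus_diff_eq)

lemma dvd_diff_trans: "(d :: 'r::comm_ring_1) dvd a - b \<Longrightarrow> d dvd b - c \<Longrightarrow> d dvd a - c"
  using dvd_add[of d "a - b" "b - c"] by simp

lemma dvd_diff_add: "(d :: 'r::comm_ring_1) dvd a - b \<Longrightarrow> d dvd a' - b' \<Longrightarrow> d dvd (a + a') - (b + b')"
  by (metis add_diff_add dvd_add)

lemma dvd_diff_power: "(d :: 'r::comm_ring_1) dvd a - b \<Longrightarrow> d dvd a ^ k - b ^ k"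
  by (induction k) (auto intro: dvd_diff_mult)

lemma dvd_diff_prod:
  "(\<And>i. i \<in> I \<Longrightarrow> (d :: 'r::comm_ring_1) dvd f i - g i) \<Longrightarrow> d dvd prod f I - prod g I"
  by (induction I rule: infinite_finite_induct) (auto intro: dvd_diff_mult)

lemma dvd_diff_sum:
  "(\<And>i. i \<in> I \<Longrightarrow> (d :: 'r::comm_ring_1) dvd f i - g i) \<Longrightarrow> d dvd sum f I - sum g I"
  by (simp flip: sum_subtractf add: dvd_sum)

lemma dvd_diff_det:
  fixes A B :: "'r::comm_ring_1^'n^'n"
  assumes "\<And>i j. d dvd A $ i $ j - B $ i $ j"
  shows "d dvd det A - det B"
  unfolding det_def
proof (rule dvd_diff_sum)
  fix q :: "'n \<Rightarrow> 'n"
  have "d dvd (\<Prod>i\<in>UNIV. A $ i $ q i) - (\<Prod>i\<in>UNIV. B $ i $ q i)"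
    by (rule dvd_diff_prod) (rule assms)
  then show "d dvd of_int (sign q) * (\<Prod>i\<in>UNIV. A $ i $ q i) - of_int (sign q) * (\<Prod>i\<in>UNIV. B $ i $ q i)"
    by (intro dvd_diff_mult) auto
qed

lemma dvd_diff_matrix_mult:
  fixes A B :: "'r::comm_ring_1^'n^'n"
  assumes "\<And>i j. d dvd A $ i $ j - B $ i $ j" "\<And>i j. d dvd A' $ i $ j - B' $ i $ j"
  shows "d dvd (A ** A') $ i $ j - (B ** B') $ i $ j"
  unfolding matrix_matrix_mult_def by (auto intro!: dvd_diff_sum dvd_diff_mult assms)

text \<open>In x^p - y^p = (x - y) sum x^i y^(p-1-i) the sum is congruent to p y^(p-1), hence to 0,
  modulo p. This gain of one factor p drives every lifting argument below.\<close>

lemma power_dvd_diff_step: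
  fixes x y d :: "'r::comm_ring_1"
  assumes "k > 0" "of_nat p ^ k dvd x - y"
  shows "of_nat p ^ Suc k dvd x ^ p - y ^ p"
proof -
  have p: "of_nat p dvd x - y"
    using assms by (metis dvd_power dvd_trans)
  have "of_nat p dvd (\<Sum>i<p. x ^ i * y ^ (p - Suc i))"
  proof -
    have "of_nat p dvd (\<Sum>i<p. x ^ i * y ^ (p - Suc i)) - (\<Sum>i<p. y ^ i * y ^ (p - Suc i))"
      using p by (intro dvd_diff_sum dvd_diff_mult dvd_diff_power) auto
    moreover have "(\<Sum>i<p. y ^ i * y ^ (p - Suc i)) = (\<Sum>i<p. y ^ (p - 1))"
      by (intro sum.cong) (auto simp flip: power_add)
    ultimately show ?thesis by (simp add: dvd_diff_left_iff)
  qed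
  then have "of_nat p ^ k * of_nat p dvd (x - y) * (\<Sum>i<p. x ^ i * y ^ (p - Suc i))"
    using assms(2) by (intro mult_dvd_mono) auto
  then show ?thesis by (simp add: power_diff_sumr2 mult.commute)
qed

text \<open>The bound on the number of roots over a field, phrased by divisibility instead of in a
  quotient: synthetic division removes one root, and primality of d lets the other, incongruent
  roots pass to the quotient.\<close>

lemma roots_mod_bound:
  fixes f :: "'r::idom poly"
  assumes prime: "\<And>x y. d dvd x * y \<Longrightarrow> d dvd x \<or> d dvd y"
    and "finite Y" "\<And>y y'. y \<in> Y \<Longrightarrow> y' \<in> Y \<Longrightarrow> d dvd y - y' \<Longrightarrow> y = y'"
    and "\<And>y. y \<in> Y \<Longrightarrow> d dvd poly f y" "card Y > degree f"
  shows "d dvd coeff f i"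
  using assms(2-)
proof (induction "degree f" arbitrary: f Y i)
  case 0
  then obtain c where c: "f = [:c:]" by (metis degree_eq_zeroE)
  from 0 obtain y where "y \<in> Y" by (metis all_not_in_conv card.empty not_less_zero)
  with 0 c have "d dvd c" by force
  then show ?case by (simp add: c coeff_pCons split: nat.split)
next
  case (Suc n)
  from Suc.prems obtain y where y: "y \<in> Y" by (metis all_not_in_conv card.empty not_less_zero)
  define g where "g = synthetic_div f y"
  have f: "f = [:- y, 1:] * g + [:poly f y:]" unfolding g_def by (rule synthetic_div_correct'[symmetric])
  have dg: "degree g = n" using Suc.hyps(2) by (simp add: g_def degree_synthetic_div)
  have "d dvd coeff g i" for i
  proof (rule Suc.hyps(1)[of g "Y - {y}"])
    show "n = degree g" by (simp add: dg)
    fix y' assume y': "y' \<in> Y - {y}"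
    have "poly f y' = (y' - y) * poly g y' + poly f y"
      by (subst f) (simp add: algebra_simps)
    moreover have "d dvd poly f y'" "d dvd poly f y" using Suc.prems y y' by auto
    ultimately have "d dvd (y' - y) * poly g y'" by (simp add: dvd_add_left_iff)
    moreover have "\<not> d dvd y' - y" using Suc.prems(2)[of y' y] y y' by auto
    ultimately show "d dvd poly g y'" using prime by blast
  qed (use Suc.prems Suc.hyps(2) dg y in auto)
  moreover have "d dvd poly f y" using Suc.prems y by auto
  ultimately have "d dvd coeff ([:- y, 1:] * g + [:poly f y:]) i"
    by (auto simp: coeff_pCons split: nat.split)
  then show ?case by (simp only: f[symmetric])
qed

locale delta_frobenius =
  fixes p :: nat and \<phi> :: "'r::idom \<Rightarrow> 'r" and \<iota> :: "'r \<Rightarrow> 'a::field"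
  assumes setting: "delta_setting p \<phi> \<iota>"
begin

abbreviation P :: 'r where "P \<equiv> of_nat p"

lemma prime_p: "prime p" and odd_p: "odd p"
  using setting by (auto simp: delta_setting_def)

lemma p_gt_0: "p > 0"
  using prime_p by (simp add: prime_gt_0_nat)

lemma P_nonzero: "P \<noteq> 0" and P_nonunit: "\<not> P dvd 1"
  using setting by (auto simp: delta_setting_def dvr_with_uniformizer_def)

lemma P_adic_decomp: "x \<noteq> 0 \<Longrightarrow> \<exists>k v. v dvd 1 \<and> x = P ^ k * v"
  using setting by (auto simp: delta_setting_def dvr_with_uniformizer_def)

lemma unit_or_dvd: "P dvd x \<or> x dvd 1"
proof (cases "x = 0")
  case False
  then obtain k v where "v dvd 1" "x = P ^ k * v" using P_adic_decomp by blast
  then show ?thesis by (cases k) auto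
qed simp

lemma not_dvd_unit: "x dvd 1 \<Longrightarrow> \<not> P dvd x"
  using P_nonunit dvd_trans by blast

lemma P_prime: "P dvd x * y \<Longrightarrow> P dvd x \<or> P dvd y"
  using unit_or_dvd[of x] unit_or_dvd[of y] not_dvd_unit[of "x * y"] mult_dvd_mono[of x 1 y 1] by auto

lemma separated:
  assumes "\<And>k. P ^ k dvd x" shows "x = 0"
proof (rule ccontr)
  assume "x \<noteq> 0"
  then obtain k v where v: "v dvd 1" "x = P ^ k * v" using P_adic_decomp by blast
  from assms[of "Suc k"] have "P ^ k * P dvd P ^ k * v" by (simp add: v mult.commute)
  then have "P dvd v" using P_nonzero by simp
  with v(1) not_dvd_unit show False by blast
qed

lemma phi_hom: "ring_hom_on UNIV \<phi>"
  using setting by (auto simp: delta_setting_def frobenius_lift_def ring_hom_on_def is_subring_UNIV)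

lemmas phi_simps = hom_on_0[OF phi_hom] hom_on_1[OF phi_hom] hom_on_of_nat[OF phi_hom]
  hom_on_add[OF phi_hom UNIV_I UNIV_I] hom_on_mult[OF phi_hom UNIV_I UNIV_I]
  hom_on_minus[OF phi_hom UNIV_I] hom_on_diff[OF phi_hom UNIV_I UNIV_I] hom_on_power[OF phi_hom UNIV_I]

lemma phi_frob: "P dvd \<phi> x - x ^ p"
  using setting by (auto simp: delta_setting_def frobenius_lift_def)

lemma iota_hom: "ring_hom_on UNIV \<iota>" and iota_inj: "inj \<iota>"
  using setting by (auto simp: delta_setting_def alg_closure_embedding_def ring_hom_on_def is_subring_UNIV)

lemmas iota_simps = hom_on_0[OF iota_hom] hom_on_1[OF iota_hom] hom_on_of_nat[OF iota_hom]
  hom_on_add[OF iota_hom UNIV_I UNIV_I] hom_on_mult[OF iota_hom UNIV_I UNIV_I]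
  hom_on_minus[OF iota_hom UNIV_I] hom_on_diff[OF iota_hom UNIV_I UNIV_I] hom_on_power[OF iota_hom UNIV_I]

lemma iota_eq_iff: "\<iota> x = \<iota> y \<longleftrightarrow> x = y"
  using iota_inj by (auto dest: injD)

lemma alg_closed_field: "\<forall>f :: 'a poly. degree f \<ge> 1 \<longrightarrow> (\<exists>z. poly f z = 0)"
  using setting by (simp add: delta_setting_def alg_closure_embedding_def)

lemma P_delta: "P * delta p \<phi> x = \<phi> x - x ^ p"
proof -
  obtain b where b: "\<phi> x - x ^ p = P * b" using phi_frob[of x] by (auto simp: dvd_def)
  have "\<exists>!b. P * b = \<phi> x - x ^ p" using b P_nonzero by auto
  then show ?thesis unfolding delta_def by (rule theI')
qed

lemma phi_eq: "\<phi> x = x ^ p + P * delta p \<phi> x"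
  by (simp add: P_delta)

lemma phi_unit: "v dvd 1 \<Longrightarrow> \<phi> v dvd 1"
  by (metis dvd_def phi_simps(2,5))

text \<open>\<phi> fixes p and maps units to units, so it preserves the p-adic valuation;
  injectivity of \<phi> will follow from this.\<close>

lemma phi_dvd_iff: "P ^ k dvd \<phi> x \<longleftrightarrow> P ^ k dvd x"
proof
  assume "P ^ k dvd x"
  then show "P ^ k dvd \<phi> x" by (auto simp: dvd_def phi_simps)
next
  assume k: "P ^ k dvd \<phi> x"
  show "P ^ k dvd x"
  proof (cases "x = 0")
    case False
    then obtain j v where v: "v dvd 1" "x = P ^ j * v" using P_adic_decomp by blast
    have "k \<le> j"
    proof (rule ccontr)
      assume "\<not> k \<le> j"
      then have "P ^ Suc j dvd P ^ k" by (intro le_imp_power_dvd) simp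
      with k have "P ^ Suc j dvd P ^ j * \<phi> v" by (auto simp: v phi_simps dvd_trans)
      then have "P ^ j * P dvd P ^ j * \<phi> v" by (simp add: mult.commute)
      then have "P dvd \<phi> v" using P_nonzero by simp
      with phi_unit[OF v(1)] not_dvd_unit show False by blast
    qed
    then show ?thesis by (simp add: v le_imp_power_dvd)
  qed simp
qed

lemma phi_dvd_diff: "P ^ k dvd x - y \<Longrightarrow> P ^ k dvd \<phi> x - \<phi> y"
  using phi_dvd_iff[of k "x - y"] by (simp add: phi_simps)

text \<open>Factors p are split off by induction; a number prime to p is invertible modulo p by
  Bezout.\<close>

lemma of_nat_nonzero: "k > 0 \<Longrightarrow> of_nat k \<noteq> (0::'r)"
proof (induction k rule: less_induct)
  case (less k)
  show ?case
  proof (cases "p dvd k")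
    case True
    then obtain m where m: "k = p * m" by auto
    have "m > 0" using less.prems m by (intro gr0I) simp
    moreover have "m < k" unfolding m using \<open>m > 0\<close> prime_gt_1_nat[OF prime_p] by simp
    ultimately have "of_nat m \<noteq> (0::'r)" by (intro less.IH)
    then show ?thesis using P_nonzero by (simp add: m)
  next
    case False
    then have "coprime k p" using prime_imp_coprime[OF prime_p] by (simp add: coprime_commute)
    moreover have "p \<noteq> 1" using prime_gt_1_nat[OF prime_p] by simp
    ultimately have "\<exists>x y. k * x = p * y + 1" by (rule coprime_bezout_strong)
    then obtain x y where "k * x = p * y + 1" by (elim exE)
    then have *: "of_nat k * of_nat x = P * of_nat y + (1::'r)"
      by (metis of_nat_1 of_nat_add of_nat_mult)
    show ?thesis
    proof
      assume "of_nat k = (0::'r)"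
      with * have "1 = P * (- of_nat y)" by (simp add: eq_neg_iff_add_eq_0 add.commute)
      then show False using P_nonunit by (metis dvd_triv_left)
    qed
  qed
qed

lemma of_nat_field_nonzero: "k > 0 \<Longrightarrow> of_nat k \<noteq> (0::'a)"
  using of_nat_nonzero[of k] iota_eq_iff[of "of_nat k" 0] by (simp add: iota_simps)

lemma dvd_funpow_phi: "P dvd (\<phi> ^^ m) x - x ^ (p ^ m)"
proof (induction m)
  case (Suc m)
  have "P ^ 1 dvd \<phi> ((\<phi> ^^ m) x) - \<phi> (x ^ (p ^ m))"
    by (rule phi_dvd_diff) (use Suc in simp)
  then have "P dvd (\<phi> ((\<phi> ^^ m) x) - \<phi> (x ^ (p ^ m))) + (\<phi> (x ^ (p ^ m)) - (x ^ (p ^ m)) ^ p)"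
    using phi_frob by (intro dvd_add) auto
  then show ?case by (simp add: power_mult[symmetric] mult.commute)
qed simp

lemma funpow_phi_hom: "ring_hom_on UNIV (\<phi> ^^ m)"
  by (induction m) (auto simp: ring_hom_on_def is_subring_UNIV phi_simps)

text \<open>The elements whose residue lies in the field with p^m elements, because \<phi>^m induces
  x^(p^m) modulo p. Writing it with \<phi>^m makes the subring property immediate.\<close>

definition frob_fixed :: "nat \<Rightarrow> 'r set" where
  "frob_fixed m = {x. P dvd (\<phi> ^^ m) x - x}"

lemma frob_fixed_subring: "is_subring (frob_fixed m)"
proof -
  note h = hom_on_add[OF funpow_phi_hom UNIV_I UNIV_I] hom_on_mult[OF funpow_phi_hom UNIV_I UNIV_I]
    hom_on_minus[OF funpow_phi_hom UNIV_I] hom_on_0[OF funpow_phi_hom] hom_on_1[OF funpow_phi_hom]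
  show ?thesis
    unfolding is_subring_def frob_fixed_def
    by (auto simp: h intro: dvd_diff_add dvd_diff_mult) (metis dvd_minus_iff minus_diff_eq minus_diff_minus)
qed

lemma frob_fixed_mult: "frob_fixed m \<subseteq> frob_fixed (m * k)"
proof
  fix x assume x: "x \<in> frob_fixed m"
  have "P dvd (\<phi> ^^ (m * k)) x - x"
  proof (induction k)
    case (Suc k)
    have "P ^ 1 dvd (\<phi> ^^ j) y - (\<phi> ^^ j) z" if "P ^ 1 dvd y - z" for j y z
      using that by (induction j) (auto dest: phi_dvd_diff[of 1, simplified])
    from this[of "(\<phi> ^^ (m * k)) x" x m]
    have "P dvd (\<phi> ^^ m) ((\<phi> ^^ (m * k)) x) - (\<phi> ^^ m) x" using Suc by simp
    moreover have "P dvd (\<phi> ^^ m) x - x" using x by (simp add: frob_fixed_def)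
    ultimately have "P dvd ((\<phi> ^^ m) ((\<phi> ^^ (m * k)) x) - (\<phi> ^^ m) x) + ((\<phi> ^^ m) x - x)"
      by (rule dvd_add)
    then show ?case by (simp add: funpow_add)
  qed simp
  then show "x \<in> frob_fixed (m * k)" by (simp add: frob_fixed_def)
qed

lemma frob_fixed_exists: "\<exists>m\<ge>1. x \<in> frob_fixed m"
proof -
  obtain m where m: "m \<ge> 1" "P dvd x ^ (p ^ m) - x"
    using setting unfolding delta_setting_def residue_field_alg_closure_Fp_def by blast
  have "P dvd ((\<phi> ^^ m) x - x ^ (p ^ m)) + (x ^ (p ^ m) - x)"
    using m(2) dvd_funpow_phi by (intro dvd_add)
  then have "x \<in> frob_fixed m" by (simp add: frob_fixed_def)
  with m(1) show ?thesis by blast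
qed

lemma frob_fixed_finite:
  assumes "finite X"
  shows "\<exists>m\<ge>1. X \<subseteq> frob_fixed m"
  using assms
proof (induction X rule: finite_induct)
  case empty
  then show ?case by (intro exI[of _ 1]) simp
next
  case (insert x X)
  then obtain m where m: "m \<ge> 1" "X \<subseteq> frob_fixed m" by blast
  obtain k where k: "k \<ge> 1" "x \<in> frob_fixed k" using frob_fixed_exists by blast
  have "x \<in> frob_fixed (m * k)" using k(2) frob_fixed_mult[of k m] by (auto simp: mult.commute)
  then have "insert x X \<subseteq> frob_fixed (m * k)" using m(2) frob_fixed_mult[of m k] by auto
  moreover have "m * k \<ge> 1" using m(1) k(1) by simp
  ultimately show ?case by blast
qed

text \<open>A representative that depends only on the class modulo p, standing in for the element of
  the residue field.\<close>

definition residue :: "'r \<Rightarrow> 'r" where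
  "residue x = (SOME y. P dvd x - y)"

lemma residue_dvd: "P dvd x - residue x"
  unfolding residue_def by (rule someI[of _ x]) simp

lemma residue_eq_iff: "residue x = residue y \<longleftrightarrow> P dvd x - y"
proof
  assume "residue x = residue y"
  then show "P dvd x - y"
    using residue_dvd[of x] residue_dvd[of y] dvd_diff_trans[of P x "residue y" y]
      dvd_diff_swap[of P y "residue y"] by simp
next
  assume "P dvd x - y"
  then have "P dvd x - z \<longleftrightarrow> P dvd y - z" for z
    using dvd_diff_trans[of P x y z] dvd_diff_trans[of P y x z] dvd_diff_swap[of P y x] by blast
  then show "residue x = residue y" by (simp add: residue_def)
qed

text \<open>The residues are roots of X^(p^m) - X modulo p. More than p^m of them would make p
  divide the leading coefficient 1.\<close>

lemma finite_residues:
  assumes "m \<ge> 1"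
  shows "finite (residue ` frob_fixed m)"
proof (rule ccontr)
  assume "infinite (residue ` frob_fixed m)"
  then obtain Y where Y: "Y \<subseteq> residue ` frob_fixed m" "finite Y" "card Y = Suc (p ^ m)"
    by (meson infinite_arbitrarily_large)
  define f where "f = monom (1::'r) (p ^ m) - monom 1 1"
  have pm: "p ^ m > 1"
    using prime_gt_1_nat[OF prime_p] assms by (intro one_less_power) auto
  have "degree f \<le> p ^ m"
    unfolding f_def using pm by (intro degree_diff_le) (auto simp: degree_monom_eq)
  have "P dvd coeff f (p ^ m)"
  proof (rule roots_mod_bound[OF P_prime Y(2)])
    show "degree f < card Y" using Y(3) \<open>degree f \<le> p ^ m\<close> by simp
    show "y = y'" if y: "y \<in> Y" "y' \<in> Y" and d: "P dvd y - y'" for y y'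
    proof -
      have "residue y = y" if y0: "y \<in> Y" for y
      proof -
        obtain x where "y = residue x" using y0 Y(1) by blast
        then show ?thesis using residue_dvd[of x] residue_eq_iff[of x y] by simp
      qed
      then show ?thesis using d residue_eq_iff[of y y'] y by simp
    qed
    show "P dvd poly f y" if y: "y \<in> Y" for y
    proof -
      obtain x where x: "y = residue x" "x \<in> frob_fixed m" using y Y(1) by blast
      have xy: "P dvd x - y" using residue_dvd x by simp
      have "P dvd (\<phi> ^^ m) x - x" using x by (simp add: frob_fixed_def)
      moreover have "P dvd x ^ (p ^ m) - (\<phi> ^^ m) x"
        using dvd_funpow_phi[of m x] by (subst dvd_diff_swap)
      moreover have "P dvd y ^ (p ^ m) - x ^ (p ^ m)"
        using dvd_diff_power[OF xy, of "p ^ m"] by (subst dvd_diff_swap)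
      ultimately have "P dvd y ^ (p ^ m) - y" using xy by (meson dvd_diff_trans)
      then show ?thesis by (simp add: f_def poly_monom)
    qed
  qed
  moreover have "coeff f (p ^ m) = 1" using pm by (simp add: f_def)
  ultimately show False using P_nonunit by simp
qed

end

section \<open>Torsion and diagonalizability of the Galois group\<close>

context delta_frobenius
begin

text \<open>The finitely many entries of E lie in one \<open>frob_fixed m\<close>. The elements of G
  with entries there are closed under products, and reduction modulo p embeds them into a finite set
  of matrices.\<close>

lemma locally_finite:
  fixes G :: "('r^'n^'n) set"
  assumes one: "mat 1 \<in> G" and mult: "\<And>g h. g \<in> G \<Longrightarrow> h \<in> G \<Longrightarrow> g ** h \<in> G"
    and inv: "\<And>g. g \<in> G \<Longrightarrow> \<exists>h\<in>G. g ** h = mat 1 \<and> h ** g = mat 1"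
    and inj: "\<And>g h. g \<in> G \<Longrightarrow> h \<in> G \<Longrightarrow> (\<And>i j. P dvd g $ i $ j - h $ i $ j) \<Longrightarrow> g = h"
    and E: "finite E" "E \<subseteq> G"
  shows "\<exists>F. finite F \<and> E \<subseteq> F \<and> F \<subseteq> G \<and> mat 1 \<in> F \<and> (\<forall>g\<in>F. \<forall>h\<in>F. g ** h \<in> F) \<and>
     (\<forall>g\<in>F. \<exists>h\<in>F. g ** h = mat 1 \<and> h ** g = mat 1)"
proof -
  have "finite (\<Union>g\<in>E. entries g)" using E(1) finite_entries by blast
  from frob_fixed_finite[OF this] obtain m where m: "m \<ge> 1" "(\<Union>g\<in>E. entries g) \<subseteq> frob_fixed m" by blast
  define F where "F = {g \<in> G. entries g \<subseteq> frob_fixed m}"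
  have FG: "F \<subseteq> G" and EF: "E \<subseteq> F" using m(2) E(2) by (auto simp: F_def)
  have F1: "mat 1 \<in> F" using one entries_mat_1[OF frob_fixed_subring] by (simp add: F_def)
  have Fm: "g ** h \<in> F" if "g \<in> F" "h \<in> F" for g h
    using that mult[of g h] entries_mult[OF frob_fixed_subring, of g m h] unfolding F_def by blast
  have "inj_on (mmap residue) F"
  proof (rule inj_onI)
    fix g h assume gh: "g \<in> F" "h \<in> F" "mmap residue g = mmap residue h"
    have "P dvd g $ i $ j - h $ i $ j" for i j
      using gh(3) by (simp add: mmap_def vec_eq_iff residue_eq_iff)
    then show "g = h" using inj gh FG by blast
  qed
  moreover have "finite (mmap residue ` F)"
  proof (rule finite_subset)
    let ?X = "residue ` frob_fixed m"
    show "mmap residue ` F \<subseteq> (\<lambda>w. \<chi> i j. w (i, j)) ` PiE (UNIV :: ('n \<times> 'n) set) (\<lambda>_. ?X)"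
    proof (rule image_subsetI)
      fix g assume "g \<in> F"
      then have "g $ i $ j \<in> frob_fixed m" for i j by (auto simp: F_def entries_def)
      then show "mmap residue g \<in> (\<lambda>w. \<chi> i j. w (i, j)) ` PiE (UNIV :: ('n \<times> 'n) set) (\<lambda>_. ?X)"
        by (intro image_eqI[of _ _ "\<lambda>ij. residue (g $ fst ij $ snd ij)"]) (auto simp: mmap_def)
    qed
    show "finite ((\<lambda>w. (\<chi> i j. w (i, j)) :: 'r^'n^'n) ` PiE (UNIV :: ('n \<times> 'n) set) (\<lambda>_. ?X))"
      using finite_residues[OF m(1)] by (intro finite_imageI[OF finite_PiE]) simp_all
  qed
  ultimately have fF: "finite F" by (rule finite_imageD[rotated])
  \<comment> \<open>The inverse in G comes without control of its entries; a power of g has its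
    entries in \<open>frob_fixed m\<close>, and finiteness of \<open>F\<close> provides one that is
    inverse to g.\<close>
  have "\<exists>h\<in>F. g ** h = mat 1 \<and> h ** g = mat 1" if g: "g \<in> F" for g
  proof -
    obtain g' where g': "g ** g' = mat 1" "g' ** g = mat 1" using inv g FG by blast
    obtain N where N: "N > 0" "mpow g N = mat 1"
      using finite_group_finite_order[OF fF F1 Fm g g'(2)] by blast
    have "mpow g k \<in> F" for k by (induction k) (auto intro: F1 Fm g)
    moreover have gN: "g ** mpow g (N - 1) = mat 1"
      using N by (metis Suc_diff_1 mpow_Suc)
    moreover have "mpow g (N - 1) ** g = mat 1"
      using mpow_commute[of g g "N - 1"] gN by simp
    ultimately show ?thesis by blast
  qed
  then show ?thesis using fF EF FG F1 Fm by (intro exI[of _ F]) auto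
qed

text \<open>The two hypotheses of \<open>virtually_abelian\<close> come from Jordan's bound, pulled
  back along an embedding of the entries of a finite subgroup, and from finite dimension. Local
  finiteness then makes H torsion, hence diagonalizable.\<close>

lemma virtually_abelian_matrix_group:
  fixes G :: "('r^'n^'n) set"
  assumes grp: "group (mat_group G)"
    and inj: "\<And>g h. g \<in> G \<Longrightarrow> h \<in> G \<Longrightarrow> (\<And>i j. P dvd g $ i $ j - h $ i $ j) \<Longrightarrow> g = h"
  shows "\<exists>H. H \<lhd> mat_group G \<and> finite (rcosets\<^bsub>mat_group G\<^esub> H) \<and> diagonalizable_over \<iota> H"
proof -
  interpret group "mat_group G" by (fact grp)
  have sel: "carrier (mat_group G) = G" "\<And>g h. g \<otimes>\<^bsub>mat_group G\<^esub> h = g ** h" "\<one>\<^bsub>mat_group G\<^esub> = mat 1"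
    by (simp_all add: mat_group_def)
  have one: "mat 1 \<in> G" using one_closed by (simp add: sel)
  have mult: "g ** h \<in> G" if "g \<in> G" "h \<in> G" for g h
    using m_closed[of g h] that by (simp add: sel)
  have inv: "\<exists>h\<in>G. g ** h = mat 1 \<and> h ** g = mat 1" if "g \<in> G" for g
    using inv_closed[of g] r_inv[of g] l_inv[of g] that unfolding sel by blast
  have lf: "\<exists>F. finite F \<and> E \<subseteq> F \<and> F \<subseteq> G \<and> mat 1 \<in> F \<and> (\<forall>g\<in>F. \<forall>h\<in>F. g ** h \<in> F) \<and>
     (\<forall>g\<in>F. \<exists>h\<in>F. g ** h = mat 1 \<and> h ** g = mat 1)" if "finite E" "E \<subseteq> G" for E
    by (rule locally_finite[of G E]) (fact one mult inv inj that)+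
  from jordan_finite_complex[where 'n = 'n] obtain J where J0: "\<forall>F :: (complex^'n^'n) set.
     finite F \<longrightarrow> mat 1 \<in> F \<longrightarrow> (\<forall>g\<in>F. \<forall>h\<in>F. g ** h \<in> F) \<longrightarrow>
     (\<forall>g\<in>F. \<exists>h\<in>F. g ** h = mat 1 \<and> h ** g = mat 1) \<longrightarrow>
     (\<exists>S\<subseteq>F. (\<forall>a\<in>S. \<forall>b\<in>S. a ** b = b ** a) \<and>
        (\<forall>E\<subseteq>F. card E > J \<longrightarrow> (\<exists>a\<in>E. \<exists>b\<in>E. a \<noteq> b \<and> (\<exists>s\<in>S. b = a ** s))))"
    by (elim exE)
  note J = J0[THEN spec, THEN mp, THEN mp, THEN mp, THEN mp]
  have "\<exists>H. H \<lhd> mat_group G \<and> finite (rcosets\<^bsub>mat_group G\<^esub> H) \<and> (\<forall>x\<in>H. \<forall>y\<in>H. x ** y = y ** x)"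
  proof (rule virtually_abelian[unfolded sel, where J = J])
    fix E assume "finite E" "E \<subseteq> G"
    from lf[OF this] obtain F where F: "finite F" "E \<subseteq> F" "F \<subseteq> G"
      "mat 1 \<in> F" "\<forall>g\<in>F. \<forall>h\<in>F. g ** h \<in> F" "\<forall>g\<in>F. \<exists>h\<in>F. g ** h = mat 1 \<and> h ** g = mat 1"
      by (elim exE conjE)
    have fin: "finite (\<Union>g\<in>F. entries g)" using F(1) finite_entries by blast
    have "\<exists>A (h :: 'r \<Rightarrow> complex). ring_hom_on A h \<and> inj_on h A \<and> countable A \<and> (\<Union>g\<in>F. entries g) \<subseteq> A"
      by (rule finitely_generated_embedding) (fact of_nat_nonzero fin)+
    then obtain A and h :: "'r \<Rightarrow> complex" where hom: "ring_hom_on A h" and injA: "inj_on h A"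
      and A: "(\<Union>g\<in>F. entries g) \<subseteq> A" by (elim exE conjE)
    have eA: "entries g \<subseteq> A" if "g \<in> F" for g using A that by auto
    have hm: "mmap h (g ** k) = mmap h g ** mmap h k" if "g \<in> F" "k \<in> F" for g k
      using mmap_mult[OF hom eA eA] that by simp
    have injh: "g = k" if "g \<in> F" "k \<in> F" "mmap h g = mmap h k" for g k
    proof -
      have "g $ i $ j \<in> A" "k $ i $ j \<in> A" "h (g $ i $ j) = h (k $ i $ j)" for i j
        using eA[OF that(1)] eA[OF that(2)] that(3) by (auto simp: entries_def mmap_def vec_eq_iff)
      then show ?thesis using injA by (simp add: vec_eq_iff inj_on_def)
    qed
    let ?F = "mmap h ` F"
    have "\<exists>S\<subseteq>?F. (\<forall>a\<in>S. \<forall>b\<in>S. a ** b = b ** a) \<and>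
        (\<forall>E\<subseteq>?F. card E > J \<longrightarrow> (\<exists>a\<in>E. \<exists>b\<in>E. a \<noteq> b \<and> (\<exists>s\<in>S. b = a ** s)))"
    proof (rule J)
      show "finite ?F" using F(1) by simp
      show "mat 1 \<in> ?F" using F(4) mmap_mat_1[OF hom] by (metis imageI)
      show "\<forall>g\<in>?F. \<forall>k\<in>?F. g ** k \<in> ?F" using F(5) hm by (auto simp flip: hm)
      show "\<forall>g\<in>?F. \<exists>k\<in>?F. g ** k = mat 1 \<and> k ** g = mat 1"
      proof
        fix g assume "g \<in> ?F"
        then obtain g0 where g0: "g = mmap h g0" "g0 \<in> F" by blast
        then obtain k0 where k0: "k0 \<in> F" "g0 ** k0 = mat 1" "k0 ** g0 = mat 1" using F(6) by blast
        then have "g ** mmap h k0 = mat 1" "mmap h k0 ** g = mat 1"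
          unfolding g0(1) using hm[OF g0(2) k0(1)] hm[OF k0(1) g0(2)]
          by (simp_all only: k0 mmap_mat_1[OF hom])
        then show "\<exists>k\<in>?F. g ** k = mat 1 \<and> k ** g = mat 1" using k0(1) by blast
      qed
    qed
    then obtain S where S: "S \<subseteq> ?F" "\<forall>a\<in>S. \<forall>b\<in>S. a ** b = b ** a"
      "\<forall>E\<subseteq>?F. card E > J \<longrightarrow> (\<exists>a\<in>E. \<exists>b\<in>E. a \<noteq> b \<and> (\<exists>s\<in>S. b = a ** s))"
      by (elim exE conjE)
    define S0 where "S0 = {g \<in> F. mmap h g \<in> S}"
    have "S0 \<subseteq> F" by (auto simp: S0_def)
    moreover have "s ** t = t ** s" if "s \<in> S0" "t \<in> S0" for s t
    proof -
      have st: "s \<in> F" "t \<in> F" "mmap h s \<in> S" "mmap h t \<in> S" using that by (auto simp: S0_def)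
      then have "mmap h (s ** t) = mmap h (t ** s)" using hm S(2) by simp
      moreover have "s ** t \<in> F" "t ** s \<in> F" using st F(5) by auto
      ultimately show ?thesis using injh by blast
    qed
    moreover have "\<exists>a\<in>E'. \<exists>b\<in>E'. a \<noteq> b \<and> (\<exists>s\<in>S0. b = a ** s)" if E': "E' \<subseteq> F" "card E' > J" for E'
    proof -
      have "inj_on (mmap h) E'" using injh E'(1) by (meson inj_onI subsetD)
      then have "card (mmap h ` E') > J" using E'(2) by (simp add: card_image)
      moreover have "mmap h ` E' \<subseteq> ?F" using E'(1) by blast
      ultimately have "\<exists>a\<in>mmap h ` E'. \<exists>b\<in>mmap h ` E'. a \<noteq> b \<and> (\<exists>s\<in>S. b = a ** s)" using S(3) by blast
      then obtain a b s where ab: "a \<in> E'" "b \<in> E'" "mmap h a \<noteq> mmap h b" "s \<in> S" "mmap h b = mmap h a ** s"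
        by blast
      obtain s0 where s0: "s0 \<in> F" "s = mmap h s0" using ab(4) S(1) by blast
      have abF: "a \<in> F" "b \<in> F" using ab E'(1) by auto
      have "mmap h b = mmap h (a ** s0)" using ab s0 hm abF by simp
      then have "b = a ** s0" using injh abF s0 F(5) by blast
      moreover have "s0 \<in> S0" using s0 ab by (simp add: S0_def)
      moreover have "a \<noteq> b" using ab(3) by auto
      ultimately show ?thesis using ab(1,2) by blast
    qed
    ultimately show "\<exists>F S. E \<subseteq> F \<and> F \<subseteq> G \<and> S \<subseteq> F \<and> (\<forall>s\<in>S. \<forall>t\<in>S. s ** t = t ** s) \<and>
      (\<forall>E'\<subseteq>F. card E' > J \<longrightarrow> (\<exists>a\<in>E'. \<exists>b\<in>E'. a \<noteq> b \<and> (\<exists>s\<in>S. b = a ** s)))"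
      using F(2,3) by (intro exI[of _ F] exI[of _ S0] conjI ballI allI impI)
  next
    fix B assume "B \<subseteq> G"
    \<comment> \<open>Commuting with c is a linear condition, so B has the same centralizer as a
      finite subset with the same span over \<open>'a\<close>.\<close>
    obtain C0 where C0: "finite C0" "C0 \<subseteq> mmap \<iota> ` B"
      "\<And>b. b \<in> mmap \<iota> ` B \<Longrightarrow> \<exists>c. \<forall>i j. b $ i $ j = (\<Sum>d\<in>C0. c d * d $ i $ j)"
      by (rule finite_spanning_matrices[of "mmap \<iota> ` B"]) (rule that)
    obtain B0 where B0: "B0 \<subseteq> B" "finite B0" "C0 = mmap \<iota> ` B0"
      using C0(1,2) by (meson finite_subset_image)
    have m: "mmap \<iota> (x ** y) = mmap \<iota> x ** mmap \<iota> y" for x y :: "'r^'n^'n"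
      by (rule mmap_mult[OF iota_hom]) auto
    have injm: "x = y" if "mmap \<iota> x = mmap \<iota> y" for x y :: "'r^'n^'n"
      using that by (simp add: mmap_def vec_eq_iff iota_eq_iff)
    have "c ** b = b ** c" if c: "\<forall>b\<in>B0. c ** b = b ** c" and b: "b \<in> B" for c b
    proof -
      obtain k where k: "\<And>i j. mmap \<iota> b $ i $ j = (\<Sum>d\<in>C0. k d * d $ i $ j)" using C0(3) b by blast
      let ?c = "mmap \<iota> c"
      have com: "(?c ** d) $ i $ j = (d ** ?c) $ i $ j" if "d \<in> C0" for d i j
        using that c unfolding B0(3) by (auto simp flip: m)
      have "(?c ** mmap \<iota> b) $ i $ j = (\<Sum>d\<in>C0. k d * (?c ** d) $ i $ j)" for i j
        unfolding matrix_matrix_mult_def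
        by (simp add: k sum_distrib_left mult.left_commute) (rule sum.swap)
      moreover have "(mmap \<iota> b ** ?c) $ i $ j = (\<Sum>d\<in>C0. k d * (d ** ?c) $ i $ j)" for i j
        unfolding matrix_matrix_mult_def
        by (simp add: k sum_distrib_left sum_distrib_right mult.assoc) (rule sum.swap)
      ultimately have "?c ** mmap \<iota> b = mmap \<iota> b ** ?c" by (simp add: vec_eq_iff com)
      then show ?thesis by (intro injm) (simp add: m)
    qed
    then show "\<exists>B0\<subseteq>B. finite B0 \<and> (\<forall>c\<in>G. (\<forall>b\<in>B0. c ** b = b ** c) \<longrightarrow> (\<forall>b\<in>B. c ** b = b ** c))"
      using B0(1,2) by (intro exI[of _ B0] conjI ballI impI)
  qed
  then obtain H where H: "H \<lhd> mat_group G" "finite (rcosets\<^bsub>mat_group G\<^esub> H)"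
    "\<forall>x\<in>H. \<forall>y\<in>H. x ** y = y ** x" by (elim exE conjE)
  have HG: "H \<subseteq> G" using normal_imp_subgroup[OF H(1)] subgroup.subset by (fastforce simp: sel)
  have m: "mmap \<iota> (x ** y) = mmap \<iota> x ** mmap \<iota> y" for x y :: "'r^'n^'n"
    by (rule mmap_mult[OF iota_hom]) auto
  have "\<exists>N>0. mpow (mmap \<iota> g) N = mat 1" if g: "g \<in> H" for g
  proof -
    have "finite {g}" "{g} \<subseteq> G" using g HG by auto
    from lf[OF this] obtain F where F: "finite F" "{g} \<subseteq> F" "F \<subseteq> G"
      "mat 1 \<in> F" "\<forall>g\<in>F. \<forall>h\<in>F. g ** h \<in> F" "\<forall>g\<in>F. \<exists>h\<in>F. g ** h = mat 1 \<and> h ** g = mat 1"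
      by (elim exE conjE)
    obtain g' where "g' ** g = mat 1" using F(2,6) by auto
    with F obtain N where N: "N > 0" "mpow g N = mat 1"
      using finite_group_finite_order[of F g g'] by auto
    have "mpow (mmap \<iota> g) k = mmap \<iota> (mpow g k)" for k
      by (induction k) (simp_all add: m mmap_mat_1[OF iota_hom])
    then show ?thesis using N mmap_mat_1[OF iota_hom] by (metis (no_types))
  qed
  moreover have "g ** k = k ** g" if "g \<in> mmap \<iota> ` H" "k \<in> mmap \<iota> ` H" for g k
    using that H(3) by (auto simp flip: m)
  ultimately have "\<exists>Q :: 'a^'n^'n. invertible Q \<and> (\<forall>h\<in>mmap \<iota> ` H. is_diag (matrix_inv Q ** h ** Q))"
    by (intro simultaneous_diagonalization alg_closed_field of_nat_field_nonzero) auto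
  then have "diagonalizable_over \<iota> H" by (simp add: diagonalizable_over_def)
  with H(1,2) show ?thesis by (intro exI[of _ H] conjI)
qed

end

section \<open>The Galois relation and the group structure of \<open>Ggal\<close>\<close>

lemma ring_gen_subring: "is_subring (ring_gen X)"
  unfolding ring_gen_def is_subring_def by auto

lemma ring_gen_superset: "X \<subseteq> ring_gen X"
  unfolding ring_gen_def by auto

lemma ring_gen_minimal: "is_subring T \<Longrightarrow> X \<subseteq> T \<Longrightarrow> ring_gen X \<subseteq> T"
  unfolding ring_gen_def by auto

lemma entries_mem: "M $ i $ j \<in> entries M"
  by (auto simp: entries_def)

lemma entries_subset_iff: "entries M \<subseteq> A \<longleftrightarrow> (\<forall>i j. M $ i $ j \<in> A)"
  by (auto simp: entries_def)

lemma matrix_mult_add_left: "((A :: 'r::comm_ring_1^'n^'m) + B) ** C = A ** C + B ** C"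
  by (simp add: matrix_matrix_mult_def vec_eq_iff algebra_simps sum.distrib)

lemma matrix_left_inverse_unique:
  fixes A :: "'r::comm_ring_1^'n^'n"
  assumes "invertible A" "B ** A = mat 1"
  shows "B = matrix_inv A"
proof -
  have "B = B ** (A ** matrix_inv A)" by (simp add: matrix_inv_inverse[OF assms(1)])
  also have "\<dots> = matrix_inv A" by (simp only: matrix_mul_assoc assms(2) matrix_mul_lid)
  finally show ?thesis .
qed

lemma GL_over_mult:
  assumes "is_subring A" "M \<in> GL_over A" "N \<in> GL_over A"
  shows "M ** N \<in> GL_over A"
proof -
  obtain M' where M: "entries M \<subseteq> A" "entries M' \<subseteq> A" "M ** M' = mat 1" "M' ** M = mat 1"
    using assms(2) unfolding GL_over_def by blast
  obtain N' where N: "entries N \<subseteq> A" "entries N' \<subseteq> A" "N ** N' = mat 1" "N' ** N = mat 1"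
    using assms(3) unfolding GL_over_def by blast
  have "(M ** N) ** (N' ** M') = M ** (N ** N') ** M'" "(N' ** M') ** (M ** N) = N' ** (M' ** M) ** N"
    by (simp_all only: matrix_mul_assoc)
  then have "(M ** N) ** (N' ** M') = mat 1" "(N' ** M') ** (M ** N) = mat 1"
    using M N by simp_all
  moreover have "entries (M ** N) \<subseteq> A" "entries (N' ** M') \<subseteq> A"
    using entries_mult[OF assms(1)] M N by blast+
  ultimately show ?thesis unfolding GL_over_def by blast
qed

context delta_frobenius
begin

text \<open>\<delta> is not additive, but \<delta>(x+y) and \<delta>(xy) are integer polynomials in
  x, y, \<delta>x, \<delta>y, and \<delta>(-x) = -\<delta>x as p is odd. Closure under \<delta> can
  thus be checked on generators.\<close>

lemma delta_stable_subring:
  assumes T: "is_subring T"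
  shows "is_subring {x \<in> T. delta p \<phi> x \<in> T}"
proof -
  have cancel: "x = y" if "P * x = P * y" for x y using that P_nonzero by simp
  have sub: "x + y \<in> T" "x * y \<in> T" "- x \<in> T" "0 \<in> T" "1 \<in> T" if "x \<in> T" "y \<in> T" for x y
    using T that by (auto simp: is_subring_def)
  have T01: "0 \<in> T" "1 \<in> T" using T by (auto simp: is_subring_def)
  have d01: "delta p \<phi> 0 = 0" "delta p \<phi> 1 = 0"
    by (rule cancel, simp add: P_delta phi_simps p_gt_0)+
  have dminus: "delta p \<phi> (- x) = - delta p \<phi> x" for x
    by (rule cancel) (simp add: P_delta phi_simps odd_p)
  have dmult: "delta p \<phi> (x * y) = x ^ p * delta p \<phi> y + delta p \<phi> x * y ^ p + P * delta p \<phi> x * delta p \<phi> y" for x y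
  proof (rule cancel)
    have "P * delta p \<phi> (x * y) = \<phi> x * \<phi> y - (x * y) ^ p" by (simp only: P_delta phi_simps)
    then show "P * delta p \<phi> (x * y) = P * (x ^ p * delta p \<phi> y + delta p \<phi> x * y ^ p + P * delta p \<phi> x * delta p \<phi> y)"
      unfolding phi_eq[of x] phi_eq[of y] by (simp add: power_mult_distrib algebra_simps)
  qed
  have dadd: "delta p \<phi> (x + y) \<in> T" if xy: "x \<in> T" "y \<in> T" "delta p \<phi> x \<in> T" "delta p \<phi> y \<in> T" for x y
  proof -
    \<comment> \<open>This is ((x+y)^p - x^p - y^p)/p, with integer coefficients because p divides
      the inner binomials.\<close>
    define c where "c = (\<Sum>k\<in>{0<..<p}. of_nat ((p choose k) div p) * x ^ k * y ^ (p - k))"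
    have "{..p} = insert 0 (insert p {0<..<p})" using p_gt_0 by auto
    then have "(x + y) ^ p = x ^ p + y ^ p + (\<Sum>k\<in>{0<..<p}. of_nat (p choose k) * x ^ k * y ^ (p - k))"
      using p_gt_0 by (simp add: binomial_ring)
    also have "(\<Sum>k\<in>{0<..<p}. of_nat (p choose k) * x ^ k * y ^ (p - k)) = P * c"
      unfolding c_def sum_distrib_left
    proof (rule sum.cong[OF refl])
      fix k assume "k \<in> {0<..<p}"
      then have "p dvd (p choose k)" using prime_p by (intro dvd_choose_prime) auto
      then have "of_nat (p choose k) = P * of_nat ((p choose k) div p)"
        by (metis dvd_mult_div_cancel of_nat_mult)
      then show "of_nat (p choose k) * x ^ k * y ^ (p - k) = P * (of_nat ((p choose k) div p) * x ^ k * y ^ (p - k))"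
        by (simp only: mult.assoc)
    qed
    finally have e: "(x + y) ^ p = x ^ p + y ^ p + P * c" .
    have "delta p \<phi> (x + y) = delta p \<phi> x + delta p \<phi> y + (- c)"
    proof (rule cancel)
      have "P * delta p \<phi> (x + y) = \<phi> x + \<phi> y - (x + y) ^ p" by (simp only: P_delta phi_simps)
      then show "P * delta p \<phi> (x + y) = P * (delta p \<phi> x + delta p \<phi> y + (- c))"
        unfolding e phi_eq[of x] phi_eq[of y] by (simp add: algebra_simps)
    qed
    moreover have "c \<in> T"
      unfolding c_def by (intro is_subring_sum[OF T] sub(2) is_subring_of_nat[OF T] is_subring_power[OF T] xy)
    ultimately show ?thesis using xy by (simp only:) (intro sub)
  qed
  show ?thesis
    unfolding is_subring_def
  proof (intro conjI ballI)
    show "0 \<in> {x \<in> T. delta p \<phi> x \<in> T}" "1 \<in> {x \<in> T. delta p \<phi> x \<in> T}" using T01 d01 by auto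
    show "- x \<in> {x \<in> T. delta p \<phi> x \<in> T}" if "x \<in> {x \<in> T. delta p \<phi> x \<in> T}" for x
      using that sub(3) by (auto simp: dminus)
    fix x y assume xy: "x \<in> {x \<in> T. delta p \<phi> x \<in> T}" "y \<in> {x \<in> T. delta p \<phi> x \<in> T}"
    then show "x + y \<in> {x \<in> T. delta p \<phi> x \<in> T}" using dadd sub(1) by auto
    have "P \<in> T" by (rule is_subring_of_nat[OF T])
    then have "delta p \<phi> (x * y) \<in> T"
      unfolding dmult using xy is_subring_power[OF T] by (intro sub) auto
    then show "x * y \<in> {x \<in> T. delta p \<phi> x \<in> T}" using xy sub(2) by auto
  qed
qed

definition scaleP :: "'r^'n^'m \<Rightarrow> 'r^'n^'m" where
  "scaleP M = (\<chi> i j. P * M $ i $ j)"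

lemma scaleP_mult: "scaleP M ** N = scaleP (M ** N)"
  by (simp add: scaleP_def matrix_matrix_mult_def vec_eq_iff sum_distrib_left mult.assoc)

lemma phi_matrix: "mmap \<phi> u = mfrob p u + scaleP (mdelta p \<phi> u)"
  by (simp add: mmap_def mfrob_def mdelta_def scaleP_def vec_eq_iff P_delta)

lemma mmap_phi_mult: "mmap \<phi> (M ** N) = mmap \<phi> M ** mmap \<phi> N"
  by (rule mmap_mult[OF phi_hom]) auto

lemma unit_cong: "P dvd x - y \<Longrightarrow> x dvd 1 \<Longrightarrow> y dvd 1"
  using unit_or_dvd[of y] not_dvd_unit[of x] dvd_add[of P "x - y" y] by auto

text \<open>R is local, so whether the determinant is a unit depends only on its class modulo
  p.\<close>

lemma invertible_if_cong:
  fixes A B :: "'r^'n^'n"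
  assumes "invertible A" "\<And>i j. P dvd A $ i $ j - B $ i $ j"
  shows "invertible B"
proof -
  have "P dvd det A - det B" by (rule dvd_diff_det) (rule assms)
  then have "det B dvd 1" using unit_cong invertible_det_unit[OF assms(1)] by blast
  then show ?thesis by (rule invertible_if_det_unit[OF iota_hom iota_inj])
qed

lemma invertible_mmap_phi:
  assumes "invertible (u :: 'r^'n^'n)"
  shows "invertible (mmap \<phi> u)"
proof -
  note I = matrix_inv_inverse[OF assms]
  have "mmap \<phi> u ** mmap \<phi> (matrix_inv u) = mat 1" "mmap \<phi> (matrix_inv u) ** mmap \<phi> u = mat 1"
    by (simp_all only: mmap_phi_mult[symmetric] I mmap_mat_1[OF phi_hom])
  then show ?thesis by (auto simp: invertible_def)
qed

lemma invertible_mfrob: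
  assumes "invertible (u :: 'r^'n^'n)"
  shows "invertible (mfrob p u)"
  by (rule invertible_if_cong[OF invertible_mmap_phi[OF assms]])
    (simp add: mmap_def mfrob_def phi_frob)

lemma alpha_of_mult:
  assumes "invertible (u :: 'r^'n^'n)"
  shows "alpha_of p \<phi> u ** mfrob p u = mdelta p \<phi> u"
  unfolding alpha_of_def
  by (simp add: matrix_inv_inverse[OF invertible_mfrob[OF assms]] flip: matrix_mul_assoc)

lemma phi_linear_equation:
  assumes "mdelta p \<phi> v = a ** mfrob p v"
  shows "mmap \<phi> v = (mat 1 + scaleP a) ** mfrob p v"
  using assms by (simp add: phi_matrix matrix_mult_add_left scaleP_mult)

context
  fixes Ob :: "'r set" and u :: "'r^'n^'n"
  assumes Ob: "delta_subring p \<phi> Ob" and u: "invertible u" and alpha: "entries (alpha_of p \<phi> u) \<subseteq> Ob"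
begin

lemma Ob_subring: "is_subring Ob"
  using Ob by (simp add: delta_subring_def)

lemma delta_ext_subring: "is_subring (delta_ext p \<phi> Ob u)"
  unfolding delta_ext_def by (rule ring_gen_subring)

lemma Ob_delta_ext: "Ob \<subseteq> delta_ext p \<phi> Ob u"
  unfolding delta_ext_def using ring_gen_superset by blast

lemma u_delta_ext: "entries u \<subseteq> delta_ext p \<phi> Ob u"
proof -
  have "entries ((mdelta p \<phi> ^^ 0) u) \<subseteq> (\<Union>k. entries ((mdelta p \<phi> ^^ k) u))"
    by (rule UN_upper) simp
  then have "entries u \<subseteq> Ob \<union> (\<Union>k. entries ((mdelta p \<phi> ^^ k) u))"
    by (intro le_supI2) simp
  then show ?thesis unfolding delta_ext_def using ring_gen_superset by (rule subset_trans)
qed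

lemma delta_ext_delta:
  assumes x: "x \<in> delta_ext p \<phi> Ob u"
  shows "delta p \<phi> x \<in> delta_ext p \<phi> Ob u"
proof -
  let ?A = "delta_ext p \<phi> Ob u"
  let ?X = "Ob \<union> (\<Union>k. entries ((mdelta p \<phi> ^^ k) u))"
  have "?X \<subseteq> {x \<in> ?A. delta p \<phi> x \<in> ?A}"
  proof
    fix x assume x: "x \<in> ?X"
    have "delta p \<phi> x \<in> ?X"
    proof (cases "x \<in> Ob")
      case True
      then show ?thesis using Ob by (simp add: delta_subring_def)
    next
      case False
      with x obtain k i j where "x = (mdelta p \<phi> ^^ k) u $ i $ j" by (auto simp: entries_def)
      then have "delta p \<phi> x = (mdelta p \<phi> ^^ Suc k) u $ i $ j" by (simp add: mdelta_def mmap_def)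
      then have "delta p \<phi> x \<in> entries ((mdelta p \<phi> ^^ Suc k) u)" using entries_mem by metis
      then show ?thesis by (intro UnI2) (rule UN_I[OF UNIV_I])
    qed
    moreover have XA: "?X \<subseteq> ?A" unfolding delta_ext_def by (rule ring_gen_superset)
    ultimately show "x \<in> {x \<in> ?A. delta p \<phi> x \<in> ?A}"
      using subsetD[OF XA x] subsetD[OF XA] by simp
  qed
  then have "?A \<subseteq> {x \<in> ?A. delta p \<phi> x \<in> ?A}"
    unfolding delta_ext_def
    by (rule ring_gen_minimal[OF delta_stable_subring[OF ring_gen_subring]])
  from subsetD[OF this x] show ?thesis by simp
qed

lemma tildeG_hom: "\<sigma> \<in> tildeG p \<phi> Ob u \<Longrightarrow> ring_hom_on (delta_ext p \<phi> Ob u) \<sigma>"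
  using delta_ext_subring Ob_subring by (auto simp: tildeG_def Let_def ring_hom_on_def is_subring_def)

lemma tildeG_bij: "\<sigma> \<in> tildeG p \<phi> Ob u \<Longrightarrow> bij_betw \<sigma> (delta_ext p \<phi> Ob u) (delta_ext p \<phi> Ob u)"
  and tildeG_fix: "\<sigma> \<in> tildeG p \<phi> Ob u \<Longrightarrow> x \<in> Ob \<Longrightarrow> \<sigma> x = x"
  and tildeG_delta: "\<sigma> \<in> tildeG p \<phi> Ob u \<Longrightarrow> x \<in> delta_ext p \<phi> Ob u \<Longrightarrow> \<sigma> (delta p \<phi> x) = delta p \<phi> (\<sigma> x)"
  and tildeG_GL: "\<sigma> \<in> tildeG p \<phi> Ob u \<Longrightarrow> matrix_inv u ** mmap \<sigma> u \<in> GL_over Ob"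
  by (auto simp: tildeG_def Let_def)

lemma mmap_fix: "\<sigma> \<in> tildeG p \<phi> Ob u \<Longrightarrow> entries c \<subseteq> Ob \<Longrightarrow> mmap \<sigma> c = c"
  by (simp add: mmap_def vec_eq_iff entries_subset_iff tildeG_fix)

lemma cocycle_iff: "matrix_inv u ** w = c \<longleftrightarrow> w = u ** c"
  using matrix_inv_inverse[OF u] by (metis matrix_mul_assoc matrix_mul_lid)

lemma Ggal_iff: "c \<in> Ggal p \<phi> Ob u \<longleftrightarrow> (\<exists>\<sigma>\<in>tildeG p \<phi> Ob u. mmap \<sigma> u = u ** c)"
proof
  assume "c \<in> Ggal p \<phi> Ob u"
  then obtain \<sigma> where "\<sigma> \<in> tildeG p \<phi> Ob u" "matrix_inv u ** mmap \<sigma> u = c" by (auto simp: Ggal_def)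
  then show "\<exists>\<sigma>\<in>tildeG p \<phi> Ob u. mmap \<sigma> u = u ** c" using cocycle_iff by blast
next
  assume "\<exists>\<sigma>\<in>tildeG p \<phi> Ob u. mmap \<sigma> u = u ** c"
  then obtain \<sigma> where "\<sigma> \<in> tildeG p \<phi> Ob u" "matrix_inv u ** mmap \<sigma> u = c" using cocycle_iff by blast
  then show "c \<in> Ggal p \<phi> Ob u" by (auto simp: Ggal_def)
qed

lemma Ggal_GL: "c \<in> Ggal p \<phi> Ob u \<Longrightarrow> c \<in> GL_over Ob"
  unfolding Ggal_def using tildeG_GL by blast

text \<open>\<sigma> fixes \<alpha> and commutes with \<delta>, so u and uc solve the same equation
  \<phi>(v) = (1 + p\<alpha>) v^(p). Expanding \<phi>(uc) = \<phi>(u)\<phi>(c) and cancelling 1 +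
  p\<alpha> leaves a relation free of \<alpha>.\<close>

lemma galois_relation:
  assumes "c \<in> Ggal p \<phi> Ob u"
  shows "mfrob p u ** mmap \<phi> c = mfrob p (u ** c)"
proof -
  obtain \<sigma> where s: "\<sigma> \<in> tildeG p \<phi> Ob u" "mmap \<sigma> u = u ** c" using assms Ggal_iff by blast
  let ?A = "delta_ext p \<phi> Ob u"
  let ?a = "alpha_of p \<phi> u"
  have uA: "u $ i $ j \<in> ?A" for i j using u_delta_ext entries_mem by blast
  note hom = tildeG_hom[OF s(1)]
  have frob: "mmap \<sigma> (mfrob p u) = mfrob p (u ** c)"
    unfolding s(2)[symmetric] by (simp add: mmap_def mfrob_def vec_eq_iff hom_on_power[OF hom] uA)
  have "entries (mfrob p u) \<subseteq> ?A"
    using uA is_subring_power[OF delta_ext_subring] by (simp add: entries_subset_iff mfrob_def mmap_def)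
  then have "mmap \<sigma> (?a ** mfrob p u) = mmap \<sigma> ?a ** mmap \<sigma> (mfrob p u)"
    using alpha Ob_delta_ext by (intro mmap_mult[OF hom]) auto
  also have "\<dots> = ?a ** mfrob p (u ** c)" by (simp add: mmap_fix[OF s(1) alpha] frob)
  also have "?a ** mfrob p u = mdelta p \<phi> u" by (rule alpha_of_mult[OF u])
  also have "mmap \<sigma> (mdelta p \<phi> u) = mdelta p \<phi> (u ** c)"
    unfolding s(2)[symmetric] by (simp add: mmap_def mdelta_def vec_eq_iff tildeG_delta[OF s(1)] uA)
  finally have v: "mmap \<phi> (u ** c) = (mat 1 + scaleP ?a) ** mfrob p (u ** c)"
    by (rule phi_linear_equation)
  have e: "mmap \<phi> u = (mat 1 + scaleP ?a) ** mfrob p u"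
    by (rule phi_linear_equation) (simp add: alpha_of_mult[OF u])
  \<comment> \<open>From \<phi>(u) = (1 + p\<alpha>) u^(p), the matrix u^(p) \<phi>(u)^(-1) is a
    left inverse of 1 + p\<alpha>.\<close>
  let ?X = "matrix_inv (mmap \<phi> u)"
  have X: "?X ** mmap \<phi> u = mat 1" by (rule matrix_inv_inverse[OF invertible_mmap_phi[OF u]])
  have "?X ** (mat 1 + scaleP ?a) ** mfrob p u = mat 1"
    using X unfolding e by (simp only: matrix_mul_assoc)
  then have "?X ** (mat 1 + scaleP ?a) = matrix_inv (mfrob p u)"
    by (rule matrix_left_inverse_unique[OF invertible_mfrob[OF u]])
  then have K: "mfrob p u ** ?X ** (mat 1 + scaleP ?a) = mat 1"
    using matrix_inv_inverse(1)[OF invertible_mfrob[OF u]] by (simp flip: matrix_mul_assoc)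
  have "(mat 1 + scaleP ?a) ** (mfrob p u ** mmap \<phi> c) = (mat 1 + scaleP ?a) ** mfrob p (u ** c)"
    unfolding v[symmetric] mmap_phi_mult e by (simp only: matrix_mul_assoc)
  from arg_cong[OF this, of "\<lambda>M. mfrob p u ** ?X ** M"]
  have "(mfrob p u ** ?X ** (mat 1 + scaleP ?a)) ** (mfrob p u ** mmap \<phi> c)
      = (mfrob p u ** ?X ** (mat 1 + scaleP ?a)) ** mfrob p (u ** c)"
    by (simp only: matrix_mul_assoc)
  then show ?thesis by (simp only: K matrix_mul_lid)
qed

lemma galois_residue_inj:
  assumes c: "c \<in> Ggal p \<phi> Ob u" "d \<in> Ggal p \<phi> Ob u"
    and cong: "\<And>i j. P dvd c $ i $ j - d $ i $ j"
  shows "c = d"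
proof -
  note I = matrix_inv_inverse[OF invertible_mfrob[OF u]]
  have sol: "mmap \<phi> g = matrix_inv (mfrob p u) ** mfrob p (u ** g)" if "g \<in> Ggal p \<phi> Ob u" for g
    unfolding galois_relation[OF that, symmetric] by (simp add: matrix_mul_assoc I)
  have step: "P ^ Suc k dvd c $ i $ j - d $ i $ j" for k i j
  proof (induction k arbitrary: i j)
    case 0
    then show ?case using cong by simp
  next
    case (Suc k)
    have "P ^ Suc k dvd (u ** c) $ i $ j - (u ** d) $ i $ j" for i j
      by (rule dvd_diff_matrix_mult) (use Suc in auto)
    \<comment> \<open>The p-th power gains the factor p, and \<open>phi_dvd_iff\<close> keeps it
      when \<phi> is removed from the entries.\<close>
    then have "P ^ Suc (Suc k) dvd mfrob p (u ** c) $ i $ j - mfrob p (u ** d) $ i $ j" for i j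
      unfolding mfrob_def mmap_def by (simp del: power_Suc add: power_dvd_diff_step)
    then have "P ^ Suc (Suc k) dvd mmap \<phi> c $ i $ j - mmap \<phi> d $ i $ j"
      unfolding sol[OF c(1)] sol[OF c(2)] by (intro dvd_diff_matrix_mult) auto
    then have "P ^ Suc (Suc k) dvd \<phi> (c $ i $ j - d $ i $ j)" by (simp add: mmap_def phi_simps)
    then show ?case by (simp only: phi_dvd_iff)
  qed
  have "c $ i $ j - d $ i $ j = 0" for i j
  proof (rule separated)
    fix k show "P ^ k dvd c $ i $ j - d $ i $ j"
      using step[of k i j] by (rule power_le_dvd) simp
  qed
  then show ?thesis by (simp add: vec_eq_iff)
qed

text \<open>The matrices c have entries in O and are fixed by every \<sigma>, so the matrix of a
  composition is the product of the matrices.\<close>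

lemma Ggal_group: "group (mat_group (Ggal p \<phi> Ob u))"
proof -
  let ?A = "delta_ext p \<phi> Ob u" and ?G = "Ggal p \<phi> Ob u" and ?T = "tildeG p \<phi> Ob u"
  have one: "mat 1 \<in> ?G"
  proof -
    have "mmap id u = u" by (simp add: mmap_def vec_eq_iff)
    moreover have "id \<in> ?T"
      using \<open>mmap id u = u\<close> matrix_inv_inverse[OF u] entries_mat_1[OF Ob_subring]
      by (auto simp: tildeG_def Let_def GL_over_def intro!: exI[of _ "mat 1"])
    ultimately show ?thesis using Ggal_iff[of "mat 1"] by (metis matrix_mul_rid)
  qed
  have mult: "c ** d \<in> ?G" if cd: "c \<in> ?G" "d \<in> ?G" for c d
  proof -
    obtain \<sigma> where s: "\<sigma> \<in> ?T" "mmap \<sigma> u = u ** c" using cd(1) Ggal_iff by blast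
    obtain \<tau> where t: "\<tau> \<in> ?T" "mmap \<tau> u = u ** d" using cd(2) Ggal_iff by blast
    have d: "entries d \<subseteq> Ob" using Ggal_GL[OF cd(2)] by (simp add: GL_over_def)
    have "mmap (\<sigma> \<circ> \<tau>) u = mmap \<sigma> (mmap \<tau> u)" by (simp add: mmap_def vec_eq_iff)
    also have "\<dots> = mmap \<sigma> u ** mmap \<sigma> d"
      unfolding t(2) using d Ob_delta_ext by (intro mmap_mult[OF tildeG_hom[OF s(1)]] u_delta_ext) auto
    also have "\<dots> = u ** (c ** d)" by (simp add: s mmap_fix[OF s(1) d] matrix_mul_assoc)
    finally have st: "mmap (\<sigma> \<circ> \<tau>) u = u ** (c ** d)" .
    have "\<sigma> \<circ> \<tau> \<in> ?T"
      unfolding tildeG_def Let_def mem_Collect_eq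
    proof (intro conjI ballI)
      show "bij_betw (\<sigma> \<circ> \<tau>) ?A ?A" using tildeG_bij s t by (blast intro: bij_betw_trans)
      have tA: "\<tau> x \<in> ?A" if "x \<in> ?A" for x using tildeG_bij[OF t(1)] that by (auto simp: bij_betw_def)
      note hs = tildeG_hom[OF s(1)] and ht = tildeG_hom[OF t(1)]
      show "(\<sigma> \<circ> \<tau>) (x + y) = (\<sigma> \<circ> \<tau>) x + (\<sigma> \<circ> \<tau>) y" "(\<sigma> \<circ> \<tau>) (x * y) = (\<sigma> \<circ> \<tau>) x * (\<sigma> \<circ> \<tau>) y"
        if "x \<in> ?A" "y \<in> ?A" for x y
        using that tA by (simp_all add: hom_on_add[OF hs] hom_on_mult[OF hs] hom_on_add[OF ht] hom_on_mult[OF ht])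
      show "(\<sigma> \<circ> \<tau>) x = x" if "x \<in> Ob" for x using that s t by (simp add: tildeG_fix)
      show "(\<sigma> \<circ> \<tau>) (delta p \<phi> x) = delta p \<phi> ((\<sigma> \<circ> \<tau>) x)" if "x \<in> ?A" for x
        using that tA by (simp add: tildeG_delta[OF s(1)] tildeG_delta[OF t(1)])
      have "matrix_inv u ** mmap (\<sigma> \<circ> \<tau>) u = c ** d" using st by (simp only: cocycle_iff)
      then show "matrix_inv u ** mmap (\<sigma> \<circ> \<tau>) u \<in> GL_over Ob"
        using GL_over_mult[OF Ob_subring Ggal_GL[OF cd(1)] Ggal_GL[OF cd(2)]] by simp
    qed
    with st show ?thesis using Ggal_iff by blast
  qed
  have inv: "\<exists>d\<in>?G. d ** c = mat 1" if c: "c \<in> ?G" for c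
  proof -
    obtain \<sigma> where s: "\<sigma> \<in> ?T" "mmap \<sigma> u = u ** c" using c Ggal_iff by blast
    obtain d where d: "entries d \<subseteq> Ob" "c ** d = mat 1" "d ** c = mat 1" and cO: "entries c \<subseteq> Ob"
      using Ggal_GL[OF c] by (auto simp: GL_over_def)
    define \<tau> where "\<tau> = inv_into ?A \<sigma>"
    note bs = tildeG_bij[OF s(1)] and hs = tildeG_hom[OF s(1)]
    have bt: "bij_betw \<tau> ?A ?A" unfolding \<tau>_def using bs by (rule bij_betw_inv_into)
    have tA: "\<tau> x \<in> ?A" "\<sigma> (\<tau> x) = x" if "x \<in> ?A" for x
      using bt bs that by (auto simp: bij_betw_def \<tau>_def f_inv_into_f)
    have ts: "\<tau> (\<sigma> x) = x" if "x \<in> ?A" for x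
      using bs that by (auto simp: bij_betw_def \<tau>_def)
    have sinj: "x = y" if "x \<in> ?A" "y \<in> ?A" "\<sigma> x = \<sigma> y" for x y
      using bs that by (auto simp: bij_betw_def inj_on_def)
    have sub: "x + y \<in> ?A" "x * y \<in> ?A" if "x \<in> ?A" "y \<in> ?A" for x y
      using delta_ext_subring that by (auto simp: is_subring_def)
    have fixO: "\<tau> x = x" if "x \<in> Ob" for x
      using ts[of x] that Ob_delta_ext by (auto simp: tildeG_fix[OF s(1)])
    have hom: "\<tau> (x + y) = \<tau> x + \<tau> y" "\<tau> (x * y) = \<tau> x * \<tau> y" if "x \<in> ?A" "y \<in> ?A" for x y
    proof -
      note t = tA[OF that(1)] tA[OF that(2)]
      show "\<tau> (x + y) = \<tau> x + \<tau> y"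
        by (rule sinj) (use that t tA sub in \<open>simp_all add: hom_on_add[OF hs]\<close>)
      show "\<tau> (x * y) = \<tau> x * \<tau> y"
        by (rule sinj) (use that t tA sub in \<open>simp_all add: hom_on_mult[OF hs]\<close>)
    qed
    have ht: "ring_hom_on ?A \<tau>"
      using hom fixO Ob_subring delta_ext_subring by (auto simp: ring_hom_on_def is_subring_def)
    have uA: "u $ i $ j \<in> ?A" for i j using u_delta_ext entries_mem by blast
    have "u = mmap \<tau> (mmap \<sigma> u)" by (simp add: mmap_def vec_eq_iff ts uA)
    also have "\<dots> = mmap \<tau> u ** mmap \<tau> c"
      unfolding s(2) using cO Ob_delta_ext by (intro mmap_mult[OF ht] u_delta_ext) auto
    also have "mmap \<tau> c = c" using cO fixO by (simp add: mmap_def vec_eq_iff entries_subset_iff)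
    finally have tu: "mmap \<tau> u = u ** d"
      using d(2) by (metis matrix_mul_assoc matrix_mul_rid)
    have "\<tau> \<in> ?T"
      unfolding tildeG_def Let_def mem_Collect_eq
    proof (intro conjI ballI)
      show "bij_betw \<tau> ?A ?A" by (fact bt)
      show "\<tau> (x + y) = \<tau> x + \<tau> y" "\<tau> (x * y) = \<tau> x * \<tau> y" if "x \<in> ?A" "y \<in> ?A" for x y
        using hom that by auto
      show "\<tau> x = x" if "x \<in> Ob" for x using that by (rule fixO)
      show "\<tau> (delta p \<phi> x) = delta p \<phi> (\<tau> x)" if x: "x \<in> ?A" for x
      proof -
        have e: "\<sigma> (delta p \<phi> (\<tau> x)) = delta p \<phi> x" using tildeG_delta[OF s(1) tA(1)[OF x]] tA(2)[OF x] by simp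
        have "delta p \<phi> (\<tau> x) \<in> ?A" using tA(1)[OF x] by (rule delta_ext_delta)
        then show ?thesis using ts e by metis
      qed
      have "matrix_inv u ** mmap \<tau> u = d" using tu by (simp only: cocycle_iff)
      then show "matrix_inv u ** mmap \<tau> u \<in> GL_over Ob" using d cO unfolding GL_over_def by blast
    qed
    with tu have "d \<in> ?G" using Ggal_iff by blast
    with d show ?thesis by blast
  qed
  show ?thesis
    by (rule groupI) (use one mult inv in \<open>auto simp: mat_group_def matrix_mul_assoc\<close>)
qed

theorem Ggal_virtually_diagonalizable:
  "\<exists>H. H \<lhd> mat_group (Ggal p \<phi> Ob u) \<and> finite (rcosets\<^bsub>mat_group (Ggal p \<phi> Ob u)\<^esub> H) \<and>
     diagonalizable_over \<iota> H"
  by (rule virtually_abelian_matrix_group[OF Ggal_group galois_residue_inj])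

end

end

section \<open>Polynomial functions\<close>

text \<open>The coefficient set is arbitrary because \<open>Rdelta\<close> is not closed under
  addition; the index type may be infinite, as it is for jets.\<close>

inductive_set pfun :: "'r::comm_ring_1 set \<Rightarrow> (('i \<Rightarrow> 'r) \<Rightarrow> 'r) set" for C where
  pfun_const: "c \<in> C \<Longrightarrow> (\<lambda>v. c) \<in> pfun C"
| pfun_coord: "(\<lambda>v. v i) \<in> pfun C"
| pfun_add: "f \<in> pfun C \<Longrightarrow> g \<in> pfun C \<Longrightarrow> (\<lambda>v. f v + g v) \<in> pfun C"
| pfun_mult: "f \<in> pfun C \<Longrightarrow> g \<in> pfun C \<Longrightarrow> (\<lambda>v. f v * g v) \<in> pfun C"

lemma pfun_sum:
  "0 \<in> C \<Longrightarrow> (\<And>k. k \<in> K \<Longrightarrow> f k \<in> pfun C) \<Longrightarrow> (\<lambda>v. \<Sum>k\<in>K. f k v) \<in> pfun C"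
  by (induction K rule: infinite_finite_induct) (auto intro: pfun.intros)

lemma pfun_prod:
  "1 \<in> C \<Longrightarrow> (\<And>k. k \<in> K \<Longrightarrow> f k \<in> pfun C) \<Longrightarrow> (\<lambda>v. \<Prod>k\<in>K. f k v) \<in> pfun C"
  by (induction K rule: infinite_finite_induct) (auto intro: pfun.intros)

lemma pfun_power: "1 \<in> C \<Longrightarrow> f \<in> pfun C \<Longrightarrow> (\<lambda>v. f v ^ k) \<in> pfun C"
  by (induction k) (auto intro: pfun.intros)

lemma pfun_of_nat: "0 \<in> C \<Longrightarrow> 1 \<in> C \<Longrightarrow> (\<lambda>v. of_nat k) \<in> pfun C"
  by (induction k) (auto intro: pfun.intros)

lemma pfun_minus: "- 1 \<in> C \<Longrightarrow> f \<in> pfun C \<Longrightarrow> (\<lambda>v. - f v) \<in> pfun C"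
  using pfun_mult[OF pfun_const[of "- 1" C]] by simp

lemma pfun_diff: "- 1 \<in> C \<Longrightarrow> f \<in> pfun C \<Longrightarrow> g \<in> pfun C \<Longrightarrow> (\<lambda>v. f v - g v) \<in> pfun C"
  using pfun_add[of f C "\<lambda>v. - g v"] pfun_minus[of C g] by simp

lemma pfun_det:
  assumes "0 \<in> C" "1 \<in> C" "- 1 \<in> C" "\<And>i j. (\<lambda>v. M v $ i $ j) \<in> pfun C"
  shows "(\<lambda>v. det (M v :: 'r::comm_ring_1^'n^'n)) \<in> pfun C"
  unfolding det_def
proof (intro pfun_sum pfun_mult pfun_prod assms)
  fix q :: "'n \<Rightarrow> 'n"
  show "(\<lambda>v. of_int (sign q)) \<in> pfun C"
    using assms by (auto simp: sign_def intro: pfun_const)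
qed

lemma pfun_finite_support:
  "f \<in> pfun C \<Longrightarrow> \<exists>I. finite I \<and> (\<forall>v w. (\<forall>i\<in>I. v i = w i) \<longrightarrow> f v = f w)"
proof (induction rule: pfun.induct)
  case (pfun_const c)
  then show ?case by (intro exI[of _ "{}"]) simp
next
  case (pfun_coord i)
  then show ?case by (intro exI[of _ "{i}"]) simp
next
  case (pfun_add f g)
  then obtain I J where "finite I" "\<And>v w. (\<forall>i\<in>I. v i = w i) \<Longrightarrow> f v = f w"
    "finite J" "\<And>v w. (\<forall>i\<in>J. v i = w i) \<Longrightarrow> g v = g w" by metis
  then show ?case by (intro exI[of _ "I \<union> J"] conjI allI impI arg_cong2[of _ _ _ _ "(+)"]) auto
next
  case (pfun_mult f g)
  then obtain I J where "finite I" "\<And>v w. (\<forall>i\<in>I. v i = w i) \<Longrightarrow> f v = f w"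
    "finite J" "\<And>v w. (\<forall>i\<in>J. v i = w i) \<Longrightarrow> g v = g w" by metis
  then show ?case by (intro exI[of _ "I \<union> J"] conjI allI impI arg_cong2[of _ _ _ _ "(*)"]) auto
qed

lemma pfun_compose:
  assumes "f \<in> pfun C" "C \<subseteq> D" "\<And>i. g i \<in> pfun D"
  shows "(\<lambda>w. f (\<lambda>i. g i w)) \<in> pfun D"
  using assms(1) by induction (use assms(2,3) in \<open>auto intro: pfun.intros\<close>)

lemma pfun_line:
  fixes f :: "('i \<Rightarrow> 'r::comm_ring_1) \<Rightarrow> 'r"
  shows "f \<in> pfun C \<Longrightarrow> \<exists>q. \<forall>t. f (\<lambda>i. a i + t * b i) = poly q t"
proof (induction rule: pfun.induct)
  case (pfun_const c)
  then show ?case by (intro exI[of _ "[:c:]"]) simp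
next
  case (pfun_coord i)
  then show ?case by (intro exI[of _ "[:a i, b i:]"]) simp
next
  case (pfun_add f g)
  then obtain q r where "\<forall>t. f (\<lambda>i. a i + t * b i) = poly q t" "\<forall>t. g (\<lambda>i. a i + t * b i) = poly r t" by blast
  then show ?case by (intro exI[of _ "q + r"]) simp
next
  case (pfun_mult f g)
  then obtain q r where "\<forall>t. f (\<lambda>i. a i + t * b i) = poly q t" "\<forall>t. g (\<lambda>i. a i + t * b i) = poly r t" by blast
  then show ?case by (intro exI[of _ "q * r"]) simp
qed

text \<open>This replaces Zariski density below: zeros are found at infinitely many points of a line
  and carried to the point of interest, usually at parameter 1.\<close>

lemma pfun_zero_on_line:
  fixes f :: "('i \<Rightarrow> 'r::idom) \<Rightarrow> 'r"
  assumes "f \<in> pfun C" "infinite Z" "\<And>t. t \<in> Z \<Longrightarrow> f (\<lambda>i. a i + t * b i) = 0"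
  shows "f (\<lambda>i. a i + t * b i) = 0"
proof -
  obtain q where q: "\<And>t. f (\<lambda>i. a i + t * b i) = poly q t" using pfun_line[OF assms(1)] by blast
  have "q = 0"
  proof (rule ccontr)
    assume "q \<noteq> 0"
    then have "finite {t. poly q t = 0}" by (rule poly_roots_finite)
    moreover have "Z \<subseteq> {t. poly q t = 0}" using assms(3) q by auto
    ultimately show False using assms(2) finite_subset by blast
  qed
  then show ?thesis by (simp add: q)
qed

text \<open>The coordinates in a finite support are released from natural to arbitrary values one at
  a time; \<open>J\<close> collects those already released.\<close>

lemma pfun_zero_if_nat_zero:
  fixes f :: "('i \<Rightarrow> 'r::idom) \<Rightarrow> 'r"
  assumes char0: "inj (of_nat :: nat \<Rightarrow> 'r)" and f: "f \<in> pfun C" and z: "\<And>c. f (\<lambda>i. of_nat (c i)) = 0"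
  shows "f v = 0"
proof -
  obtain I where I: "finite I" "\<And>v w. (\<forall>i\<in>I. v i = w i) \<Longrightarrow> f v = f w"
    using pfun_finite_support[OF f] by metis
  have "f v = 0" if "J \<subseteq> I" "\<And>i. i \<in> I - J \<Longrightarrow> v i \<in> range of_nat" for J v
  proof -
    have "finite J" using that(1) I(1) by (rule finite_subset)
    then show ?thesis using that
    proof (induction J arbitrary: v rule: finite_induct)
      case empty
      then have "\<forall>i\<in>I. \<exists>c. v i = of_nat c" by auto
      then obtain c where "\<forall>i\<in>I. v i = of_nat (c i)" by metis
      then have "f v = f (\<lambda>i. of_nat (c i))" by (rule I(2))
      then show ?case by (simp add: z)
    next
      case (insert j J)
      let ?a = "v(j := 0)" and ?b = "\<lambda>i. if i = j then 1 else 0"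
      have *: "f (\<lambda>i. ?a i + t * ?b i) = 0" if "t \<in> range of_nat" for t
        using insert.prems insert.hyps that by (intro insert.IH) (auto split: if_splits)
      have "f (\<lambda>i. ?a i + v j * ?b i) = 0"
        by (rule pfun_zero_on_line[of f C "range of_nat" ?a ?b "v j", OF f range_inj_infinite[OF char0] *])
      moreover have "(\<lambda>i. ?a i + v j * ?b i) = v" by auto
      ultimately show ?case by simp
    qed
  qed
  from this[of I v] show ?thesis by simp
qed

lemma pfun_dvd_diff:
  assumes "f \<in> pfun C" "\<And>i. d dvd v i - w i"
  shows "d dvd f v - f w"
  using assms(1) by induction (use assms(2) in \<open>auto intro: dvd_diff_add dvd_diff_mult\<close>)

text \<open>The function g is f with h applied to its coefficients.\<close>

lemma pfun_hom_image:
  assumes "ring_hom_on UNIV h" "h ` C \<subseteq> C" "f \<in> pfun C"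
  shows "\<exists>g\<in>pfun C. \<forall>v. g (\<lambda>i. h (v i)) = h (f v)"
  using assms(3)
proof (induction rule: pfun.induct)
  case (pfun_const c)
  then show ?case using assms(2) by (intro bexI[of _ "\<lambda>v. h c"]) (auto intro: pfun.intros)
next
  case (pfun_coord i)
  then show ?case by (intro bexI[of _ "\<lambda>v. v i"]) (auto intro: pfun.intros)
next
  case (pfun_add f g)
  then obtain f' g' where "f' \<in> pfun C" "\<forall>v. f' (\<lambda>i. h (v i)) = h (f v)"
    "g' \<in> pfun C" "\<forall>v. g' (\<lambda>i. h (v i)) = h (g v)" by blast
  then show ?case
    by (intro bexI[of _ "\<lambda>v. f' v + g' v"]) (auto intro: pfun.intros simp: hom_on_add[OF assms(1)])
next
  case (pfun_mult f g)
  then obtain f' g' where "f' \<in> pfun C" "\<forall>v. f' (\<lambda>i. h (v i)) = h (f v)"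
    "g' \<in> pfun C" "\<forall>v. g' (\<lambda>i. h (v i)) = h (g v)" by blast
  then show ?case
    by (intro bexI[of _ "\<lambda>v. f' v * g' v"]) (auto intro: pfun.intros simp: hom_on_mult[OF assms(1)])
qed

text \<open>For a subring S this is the intersection of R with the fraction field of S, expressed
  inside R.\<close>

definition fraction_closure :: "'r::idom set \<Rightarrow> 'r set" where
  "fraction_closure S = {x. \<exists>a\<in>S. \<exists>b\<in>S. b \<noteq> 0 \<and> b * x = a}"

lemma pfun_clear_denominators:
  fixes f :: "('i \<Rightarrow> 'r::idom) \<Rightarrow> 'r"
  assumes S: "is_subring S" and "f \<in> pfun (fraction_closure S)"
  shows "\<exists>b\<in>S. b \<noteq> 0 \<and> (\<lambda>v. b * f v) \<in> pfun S"
  using assms(2)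
proof (induction rule: pfun.induct)
  case (pfun_const c)
  then obtain a b where "a \<in> S" "b \<in> S" "b \<noteq> 0" "b * c = a" by (auto simp: fraction_closure_def)
  then show ?case by (intro bexI[of _ b]) (auto intro: pfun.pfun_const)
next
  case (pfun_coord i)
  have "1 \<in> S" using S by (simp add: is_subring_def)
  then show ?case by (intro bexI[of _ 1]) (auto intro: pfun.pfun_coord)
next
  case (pfun_add f g)
  then obtain b c where bc: "b \<in> S" "b \<noteq> 0" "(\<lambda>v. b * f v) \<in> pfun S" "c \<in> S" "c \<noteq> 0" "(\<lambda>v. c * g v) \<in> pfun S"
    by blast
  have "(\<lambda>v. c * (b * f v) + b * (c * g v)) \<in> pfun S" 
    by (intro pfun.pfun_add pfun.pfun_mult[OF pfun.pfun_const] bc)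
  then have "(\<lambda>v. (b * c) * (f v + g v)) \<in> pfun S" by (simp add: algebra_simps)
  moreover have "b * c \<in> S" using bc S by (simp add: is_subring_def)
  ultimately show ?case using bc by (intro bexI[of _ "b * c"]) auto
next
  case (pfun_mult f g)
  then obtain b c where bc: "b \<in> S" "b \<noteq> 0" "(\<lambda>v. b * f v) \<in> pfun S" "c \<in> S" "c \<noteq> 0" "(\<lambda>v. c * g v) \<in> pfun S"
    by blast
  have "(\<lambda>v. (b * f v) * (c * g v)) \<in> pfun S" by (rule pfun.pfun_mult[OF bc(3) bc(6)])
  then have "(\<lambda>v. (b * c) * (f v * g v)) \<in> pfun S" by (simp add: mult_ac)
  moreover have "b * c \<in> S" using bc S by (simp add: is_subring_def)
  ultimately show ?case using bc by (intro bexI[of _ "b * c"]) auto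
qed

lemma pfun_values_subring:
  assumes "0 \<in> C" "1 \<in> C" "- 1 \<in> C"
  shows "is_subring {f w | f. f \<in> pfun C}"
  unfolding is_subring_def
proof (intro conjI ballI)
  show "0 \<in> {f w | f. f \<in> pfun C}"
    using pfun_const[OF assms(1)] by (intro CollectI exI[of _ "\<lambda>v. 0"]) simp
  show "1 \<in> {f w | f. f \<in> pfun C}"
    using pfun_const[OF assms(2)] by (intro CollectI exI[of _ "\<lambda>v. 1"]) simp
  show "- x \<in> {f w | f. f \<in> pfun C}" if x: "x \<in> {f w | f. f \<in> pfun C}" for x
  proof -
    obtain f where "f \<in> pfun C" "x = f w" using x by blast
    then show ?thesis
      using pfun_minus[OF assms(3), of f] by (intro CollectI exI[of _ "\<lambda>v. - f v"]) simp
  qed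
  fix x y assume "x \<in> {f w | f. f \<in> pfun C}" "y \<in> {f w | f. f \<in> pfun C}"
  then obtain f g where fg: "f \<in> pfun C" "g \<in> pfun C" "x = f w" "y = g w" by blast
  show "x + y \<in> {f w | f. f \<in> pfun C}"
    using pfun_add[OF fg(1,2)] fg(3,4) by (intro CollectI exI[of _ "\<lambda>v. f v + g v"]) simp
  show "x * y \<in> {f w | f. f \<in> pfun C}"
    using pfun_mult[OF fg(1,2)] fg(3,4) by (intro CollectI exI[of _ "\<lambda>v. f v * g v"]) simp
qed

text \<open>Coefficients that are themselves values F(a) are opened up: the point a becomes a second
  block of variables, indexed by \<open>Inr\<close>.\<close>

lemma pfun_over_values:
  assumes "f \<in> pfun {F a | F. F \<in> pfun C}"
  shows "\<exists>F\<in>pfun C. \<forall>v. f v = F (case_sum v a)"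
  using assms
proof (induction rule: pfun.induct)
  case (pfun_const c)
  then obtain F where F: "c = F a" "F \<in> pfun C" by blast
  then have "(\<lambda>w. F (\<lambda>i. w (Inr i))) \<in> pfun C"
    by (intro pfun_compose[OF F(2)] pfun_coord) auto
  then show ?case by (intro bexI[of _ "\<lambda>w. F (\<lambda>i. w (Inr i))"]) (auto simp: F)
next
  case (pfun_coord i)
  then show ?case by (intro bexI[of _ "\<lambda>w. w (Inl i)"]) (auto intro: pfun.pfun_coord)
next
  case (pfun_add f g)
  then obtain F G where "F \<in> pfun C" "\<forall>v. f v = F (case_sum v a)" "G \<in> pfun C" "\<forall>v. g v = G (case_sum v a)"
    by blast
  then show ?case by (intro bexI[of _ "\<lambda>w. F w + G w"]) (auto intro: pfun.pfun_add)
next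
  case (pfun_mult f g)
  then obtain F G where "F \<in> pfun C" "\<forall>v. f v = F (case_sum v a)" "G \<in> pfun C" "\<forall>v. g v = G (case_sum v a)"
    by blast
  then show ?case by (intro bexI[of _ "\<lambda>w. F w * G w"]) (auto intro: pfun.pfun_mult)
qed

text \<open>Codes for polynomial functions. Constants are positions in an enumeration of C, which
  makes the type countable.\<close>

datatype 'i pexp = Cst nat | Var 'i | Add "'i pexp" "'i pexp" | Mul "'i pexp" "'i pexp"

instance pexp :: (countable) countable
  by countable_datatype

primrec peval :: "(nat \<Rightarrow> 'r::comm_ring_1) \<Rightarrow> 'i pexp \<Rightarrow> ('i \<Rightarrow> 'r) \<Rightarrow> 'r" where
  "peval e (Cst k) = (\<lambda>v. e k)"
| "peval e (Var i) = (\<lambda>v. v i)"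
| "peval e (Add s t) = (\<lambda>v. peval e s v + peval e t v)"
| "peval e (Mul s t) = (\<lambda>v. peval e s v * peval e t v)"

lemma countable_pfun:
  assumes "countable C"
  shows "countable (pfun C :: (('i::countable \<Rightarrow> 'r::comm_ring_1) \<Rightarrow> 'r) set)"
proof -
  define e where "e = from_nat_into C"
  have "f \<in> range (peval e)" if "f \<in> pfun C" for f :: "('i \<Rightarrow> 'r) \<Rightarrow> 'r"
    using that
  proof (induction rule: pfun.induct)
    case (pfun_const c)
    then obtain k where "e k = c" using from_nat_into_surj[OF assms] by (auto simp: e_def)
    then show ?case by (intro range_eqI[of _ _ "Cst k"]) auto
  next
    case (pfun_coord i)
    then show ?case by (intro range_eqI[of _ _ "Var i"]) auto
  next
    case (pfun_add f g)
    then obtain s t where "f = peval e s" "g = peval e t" by blast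
    then show ?case by (intro range_eqI[of _ _ "Add s t"]) auto
  next
    case (pfun_mult f g)
    then obtain s t where "f = peval e s" "g = peval e t" by blast
    then show ?case by (intro range_eqI[of _ _ "Mul s t"]) auto
  qed
  then have "pfun C \<subseteq> range (peval e :: 'i pexp \<Rightarrow> _)" by blast
  then show ?thesis by (rule countable_subset) simp
qed

section \<open>The Galois group of a generic solution\<close>

definition flat :: "'r^'n^'m \<Rightarrow> 'm \<times> 'n \<Rightarrow> 'r" where
  "flat u = (\<lambda>ij. u $ fst ij $ snd ij)"

definition unflat :: "('m \<times> 'n \<Rightarrow> 'r) \<Rightarrow> 'r^'n^'m" where
  "unflat v = (\<chi> i j. v (i, j))"

lemma flat_unflat [simp]: "flat (unflat v) = v" and unflat_flat [simp]: "unflat (flat u) = u"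
  by (auto simp: flat_def unflat_def vec_eq_iff)

text \<open>Algebraic independence of the entries of \<open>u\<close> over \<open>C\<close>, stated with polynomial functions in place of
  formal polynomials (the coefficient domains are infinite).\<close>
definition generic :: "'r::comm_ring_1 set \<Rightarrow> 'r^'n^'n \<Rightarrow> bool" where
  "generic C u \<longleftrightarrow> (\<forall>f\<in>pfun C. f (flat u) = 0 \<longrightarrow> (\<forall>v. f v = 0))"

lemma generic_eq:
  assumes "generic C u" "- 1 \<in> C" "f \<in> pfun C" "g \<in> pfun C" "f (flat u) = g (flat u)"
  shows "f v = g v"
proof -
  have "(\<lambda>v. f v - g v) \<in> pfun C" using assms by (intro pfun_diff)
  then have "f v - g v = 0" using assms unfolding generic_def by (metis (no_types, lifting) right_minus_eq)
  then show ?thesis by simp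
qed

text \<open>Both sides are polynomials in t that agree on an infinite domain; their linear
  coefficients give p a^(p-1) b = 0.\<close>

lemma additive_power_imp_zero:
  fixes a b :: "'r::idom"
  assumes char0: "inj (of_nat :: nat \<Rightarrow> 'r)" and p: "p > 1"
    and eq: "\<And>t. (a + t * b) ^ p = a ^ p + t ^ p * b ^ p"
  shows "a = 0 \<or> b = 0"
proof -
  define q where "q = [:a, b:] ^ p - [:a ^ p:] - monom (b ^ p) p"
  have "poly q t = 0" for t
    using eq[of t] by (simp add: q_def poly_monom algebra_simps)
  then have "{t. poly q t = 0} = UNIV" by auto
  moreover have "infinite (UNIV :: 'r set)"
    by (rule infinite_super[OF subset_UNIV range_inj_infinite[OF char0]])
  ultimately have "q = 0" using poly_roots_finite[of q] by fastforce
  then have "poly (pderiv q) 0 = 0" by simp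
  moreover have "poly (pderiv q) 0 = of_nat p * a ^ (p - 1) * b"
    using p by (simp add: q_def pderiv_diff pderiv_power pderiv_pCons pderiv_monom poly_monom)
  moreover have "of_nat p \<noteq> (0::'r)" using p inj_eq[OF char0, of p 0] by simp
  ultimately show ?thesis by auto
qed

context delta_frobenius
begin

lemma inj_of_nat: "inj (of_nat :: nat \<Rightarrow> 'r)"
proof (rule injI)
  fix i j :: nat assume eq: "of_nat i = (of_nat j :: 'r)"
  have *: False if "of_nat i = (of_nat j :: 'r)" "i < j" for i j
    using of_nat_nonzero[of "j - i"] that by (simp add: of_nat_diff)
  show "i = j" using *[of i j] *[of j i] eq by (metis linorder_neqE_nat)
qed

lemma Rdelta_iff: "x \<in> Rdelta p \<phi> \<longleftrightarrow> \<phi> x = x ^ p"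
  using P_delta[of x] P_nonzero by (auto simp: Rdelta_def)

lemma Rdelta_consts: "0 \<in> Rdelta p \<phi>" "1 \<in> Rdelta p \<phi>" "- 1 \<in> Rdelta p \<phi>"
  using p_gt_0 odd_p by (auto simp: Rdelta_iff phi_simps)

lemma Ndelta_entry:
  "(perm_mat \<pi> ** diag_mat d :: 'r^'n^'n) $ i $ j = (if i = \<pi> j then d j else 0)"
  by (simp add: perm_mat_def diag_mat_def matrix_matrix_mult_def if_distrib[of "\<lambda>x. _ * x"]
      if_distrib[of "\<lambda>x. x * _"] cong: if_cong)

context
  fixes Ob :: "'r set" and u :: "'r^'n^'n"
  assumes Ob: "delta_subring p \<phi> Ob" and u: "invertible u" and alpha: "entries (alpha_of p \<phi> u) \<subseteq> Ob"
    and RO: "Rdelta p \<phi> \<subseteq> Ob" and gen: "generic Ob u"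
begin

lemma Ob_sub: "is_subring Ob"
  using Ob by (simp add: delta_subring_def)

lemma Ob_01: "0 \<in> Ob" "1 \<in> Ob" "- 1 \<in> Ob" "P \<in> Ob" "x \<in> Ob \<Longrightarrow> \<phi> x \<in> Ob"
proof -
  show o: "0 \<in> Ob" "1 \<in> Ob" "- 1 \<in> Ob" using Ob_sub by (auto simp: is_subring_def)
  show P: "P \<in> Ob" by (rule is_subring_of_nat[OF Ob_sub])
  show "\<phi> x \<in> Ob" if "x \<in> Ob"
    unfolding phi_eq[of x] using that is_subring_power[OF Ob_sub] P Ob
    by (simp add: delta_subring_def is_subring_def)
qed

text \<open>Since the rows of \<open>u\<close> are generic, the Galois relation \<open>(uc)\<^sup>(\<^sup>p\<^sup>) = u\<^sup>(\<^sup>p\<^sup>)\<phi>(c)\<close> holds for all vectors \<open>y\<close>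
  in place of the rows of \<open>u\<close>.\<close>
lemma Ggal_subset_Ndelta: "Ggal p \<phi> Ob u \<subseteq> Ndelta p \<phi>"
proof
  fix c assume c: "c \<in> Ggal p \<phi> Ob u"
  have cO: "c $ i $ j \<in> Ob" for i j
    using Ggal_GL[OF Ob u alpha c] by (auto simp: GL_over_def entries_subset_iff)
  obtain c' where c': "c ** c' = mat 1" "c' ** c = mat 1"
    using Ggal_GL[OF Ob u alpha c] by (auto simp: GL_over_def)
  note rel = galois_relation[OF Ob u alpha c]
  have id: "(\<Sum>k\<in>UNIV. y k * c $ k $ j) ^ p = (\<Sum>k\<in>UNIV. y k ^ p * \<phi> (c $ k $ j))" for y :: "'n \<Rightarrow> 'r" and j
  proof -
    obtain i0 :: 'n where True by blast
    define f where "f x = (\<Sum>k\<in>UNIV. x (i0, k) * c $ k $ j) ^ p" for x :: "'n \<times> 'n \<Rightarrow> 'r"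
    define g where "g x = (\<Sum>k\<in>UNIV. x (i0, k) ^ p * \<phi> (c $ k $ j))" for x :: "'n \<times> 'n \<Rightarrow> 'r"
    have "f \<in> pfun Ob"
      unfolding f_def by (intro pfun_power pfun_sum pfun_mult pfun_coord pfun_const cO Ob_01)
    moreover have "g \<in> pfun Ob"
      unfolding g_def by (intro pfun_power pfun_sum pfun_mult pfun_coord pfun_const cO Ob_01)
    moreover have "f (flat u) = g (flat u)"
      using arg_cong[OF rel, of "\<lambda>M. M $ i0 $ j"]
      by (simp add: f_def g_def flat_def mfrob_def mmap_def matrix_matrix_mult_def)
    ultimately have "f (\<lambda>ij. y (snd ij)) = g (\<lambda>ij. y (snd ij))"
      using generic_eq[OF gen Ob_01(3)] by blast
    then show ?thesis by (simp add: f_def g_def)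
  qed
  \<comment> \<open>At the k-th unit vector the identity reads c_kj^p = \<phi>(c_kj).\<close>
  have cR: "c $ k $ j \<in> Rdelta p \<phi>" for k j
    using id[of "\<lambda>l. if l = k then 1 else 0" j]
    by (simp add: Rdelta_iff zero_power[OF p_gt_0] if_distrib[of "\<lambda>x. x * _"] if_distrib[of "\<lambda>x. x ^ _"] cong: if_cong)
  \<comment> \<open>At the vector e_k + t e_l the identity says that the p-th power is additive, so
    each column has at most one nonzero entry.\<close>
  have col: "c $ k $ j = 0 \<or> c $ l $ j = 0" if kl: "k \<noteq> l" for k l j
  proof (rule additive_power_imp_zero[OF inj_of_nat])
    show "p > 1" by (rule prime_gt_1_nat[OF prime_p])
    fix t :: 'r
    have two: "(\<Sum>x\<in>UNIV. h x * (if x = k then 1 else if x = l then s else 0)) = h k + h l * s"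
      for h :: "'n \<Rightarrow> 'r" and s
    proof -
      have "(\<Sum>x\<in>UNIV. h x * (if x = k then 1 else if x = l then s else 0))
         = (\<Sum>x\<in>UNIV. (if x = k then h x else 0) + (if x = l then h x * s else 0))"
        using kl by (intro sum.cong) auto
      then show ?thesis by (simp add: sum.distrib)
    qed
    have "(\<Sum>x\<in>UNIV. (if x = k then 1 else if x = l then t else 0) * c $ x $ j) = c $ k $ j + t * c $ l $ j"
      using two[of "\<lambda>x. c $ x $ j" t] by (simp add: mult.commute)
    moreover have "(\<Sum>x\<in>UNIV. (if x = k then 1 else if x = l then t else 0) ^ p * \<phi> (c $ x $ j))
        = c $ k $ j ^ p + t ^ p * c $ l $ j ^ p"
    proof -
      have "(if x = k then 1 else if x = l then t else 0) ^ p = (if x = k then 1 else if x = l then t ^ p else 0)" for x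
        using p_gt_0 by simp
      then show ?thesis
        using two[of "\<lambda>x. \<phi> (c $ x $ j)" "t ^ p"] cR by (simp add: mult.commute Rdelta_iff)
    qed
    ultimately show "(c $ k $ j + t * c $ l $ j) ^ p = c $ k $ j ^ p + t ^ p * c $ l $ j ^ p"
      using id[of "\<lambda>x. if x = k then 1 else if x = l then t else 0" j] by simp
  qed
  have ent: "(\<Sum>k\<in>UNIV. c $ i $ k * c' $ k $ i) = 1" "(\<Sum>k\<in>UNIV. c' $ i $ k * c $ k $ i) = 1" for i
    using arg_cong[OF c'(1), of "\<lambda>M. M $ i $ i"] arg_cong[OF c'(2), of "\<lambda>M. M $ i $ i"]
    by (simp_all add: matrix_matrix_mult_def mat_def)
  have "\<exists>k. c $ k $ j \<noteq> 0" for j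
    using ent(2)[of j] by (metis (no_types, lifting) mult_zero_right sum.neutral zero_neq_one)
  then obtain \<pi> where \<pi>: "\<And>j. c $ \<pi> j $ j \<noteq> 0" by metis
  have \<pi>': "c $ i $ j = 0" if "i \<noteq> \<pi> j" for i j
    using col[OF that] \<pi>[of j] by blast
  have "\<exists>k. c $ i $ k \<noteq> 0" for i
    using ent(1)[of i] by (metis (no_types, lifting) mult_zero_left sum.neutral zero_neq_one)
  \<comment> \<open>Invertibility leaves no zero row, so the nonzero places of the columns exhaust
    the rows.\<close>
  then have "surj \<pi>" using \<pi>' by (metis surjI)
  then have "bij \<pi>" by (simp add: finite_UNIV_surj_inj bij_def)
  then have perm: "\<pi> permutes UNIV" by (intro bij_imp_permutes) auto
  define d where "d j = c $ \<pi> j $ j" for j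
  have "d j dvd 1" for j
  proof -
    have "(\<Sum>k\<in>UNIV. c' $ j $ k * c $ k $ j) = (\<Sum>k\<in>UNIV. if k = \<pi> j then c' $ j $ \<pi> j * d j else 0)"
      using \<pi>' by (intro sum.cong) (auto simp: d_def)
    then have "1 = c' $ j $ \<pi> j * d j" using ent(2)[of j] by simp
    then show ?thesis by (metis dvd_triv_right)
  qed
  moreover have "c = perm_mat \<pi> ** diag_mat d"
    using \<pi>' by (simp add: vec_eq_iff Ndelta_entry d_def)
  ultimately have "c \<in> Ngrp" unfolding Ngrp_def using perm by blast
  then show "c \<in> Ndelta p \<phi>" using cR by (simp add: Ndelta_def entries_subset_iff)
qed

text \<open>O{u} is just O[u]: the entries of \<delta>u = \<alpha> u^(p) already lie there, and
  \<open>delta_stable_subring\<close> propagates this to all of O[u].\<close>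

lemma delta_ext_eq_values: "delta_ext p \<phi> Ob u = {f (flat u) | f. f \<in> pfun Ob}"
proof
  let ?A = "delta_ext p \<phi> Ob u" and ?B = "{f (flat u) | f. f \<in> pfun Ob}"
  note sA = delta_ext_subring[OF Ob u alpha]
  show BA: "?B \<subseteq> ?A"
  proof
    fix x assume "x \<in> ?B"
    then obtain f where f: "f \<in> pfun Ob" "x = f (flat u)" by blast
    have "f (flat u) \<in> ?A" using f(1)
    proof induction
      case (pfun_const c)
      then show ?case using Ob_delta_ext[OF Ob u alpha] by blast
    next
      case (pfun_coord i)
      then show ?case using u_delta_ext[OF Ob u alpha] by (simp add: flat_def entries_subset_iff)
    qed (use sA in \<open>auto simp: is_subring_def\<close>)
    with f show "x \<in> ?A" by simp
  qed
  have sB: "is_subring ?B" by (intro pfun_values_subring Ob_01)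
  have OB: "Ob \<subseteq> ?B"
  proof
    fix x assume "x \<in> Ob"
    then show "x \<in> ?B" by (intro CollectI exI[of _ "\<lambda>v. x"]) (auto intro: pfun_const)
  qed
  have uB: "u $ i $ j \<in> ?B" for i j
    by (intro CollectI exI[of _ "\<lambda>v. v (i, j)"]) (auto intro: pfun_coord simp: flat_def)
  have duB: "delta p \<phi> (u $ i $ j) \<in> ?B" for i j
  proof -
    have "entries (mfrob p u) \<subseteq> ?B"
      using uB is_subring_power[OF sB] by (simp add: entries_subset_iff mfrob_def mmap_def)
    then have "entries (alpha_of p \<phi> u ** mfrob p u) \<subseteq> ?B"
      using alpha OB by (intro entries_mult[OF sB]) auto
    then show ?thesis
      unfolding alpha_of_mult[OF u] entries_subset_iff by (simp add: mdelta_def mmap_def)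
  qed
  let ?T = "{x \<in> ?B. delta p \<phi> x \<in> ?B}"
  have sT: "is_subring ?T" by (rule delta_stable_subring[OF sB])
  have "f (flat u) \<in> ?T" if "f \<in> pfun Ob" for f
    using that
  proof induction
    case (pfun_const c)
    then have "delta p \<phi> c \<in> Ob" using Ob by (simp add: delta_subring_def)
    with pfun_const OB show ?case by blast
  next
    case (pfun_coord i)
    have "flat u i = u $ fst i $ snd i" by (simp add: flat_def)
    with uB duB show ?case by simp
  next
    case (pfun_add f g)
    with sT show ?case unfolding is_subring_def by blast
  next
    case (pfun_mult f g)
    with sT show ?case unfolding is_subring_def by blast
  qed
  then have stable: "delta p \<phi> x \<in> ?B" if "x \<in> ?B" for x using that by blast
  have "entries ((mdelta p \<phi> ^^ k) u) \<subseteq> ?B" for k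
  proof (induction k)
    case 0
    then show ?case using uB by (simp add: entries_subset_iff)
  next
    case (Suc k)
    then have "\<And>i j. (mdelta p \<phi> ^^ k) u $ i $ j \<in> ?B" by (simp add: entries_subset_iff)
    from stable[OF this] show ?case
      by (simp add: entries_subset_iff mdelta_def[of _ _ "(mdelta p \<phi> ^^ k) u"] mmap_def)
  qed
  then show "?A \<subseteq> ?B"
    unfolding delta_ext_def using OB by (intro ring_gen_minimal[OF sB]) auto
qed

text \<open>The substitution of uM for u on O[u], via a chosen polynomial representing x; genericity
  makes the choice irrelevant.\<close>

definition subst_right :: "'r^'n^'n \<Rightarrow> 'r \<Rightarrow> 'r" where
  "subst_right M x = (SOME f. f \<in> pfun Ob \<and> f (flat u) = x) (flat (u ** M))"

lemma subst_right_eq: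
  assumes "f \<in> pfun Ob"
  shows "subst_right M (f (flat u)) = f (flat (u ** M))"
proof -
  define g where "g = (SOME g. g \<in> pfun Ob \<and> g (flat u) = f (flat u))"
  have "\<exists>g. g \<in> pfun Ob \<and> g (flat u) = f (flat u)"
    using assms by (intro exI[of _ f]) simp
  then have g: "g \<in> pfun Ob \<and> g (flat u) = f (flat u)"
    unfolding g_def by (rule someI_ex)
  have "g (flat (u ** M)) = f (flat (u ** M))"
    by (rule generic_eq[OF gen Ob_01(3) conjunct1[OF g] assms conjunct2[OF g]])
  then show ?thesis by (simp add: subst_right_def g_def)
qed

lemma pfun_right_mult:
  assumes "f \<in> pfun Ob" "entries M \<subseteq> Ob"
  shows "(\<lambda>v. f (flat (unflat v ** M))) \<in> pfun Ob"
proof -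
  have "(\<lambda>v. f (\<lambda>ij. flat (unflat v ** M) ij)) \<in> pfun Ob"
    using assms(2)
    by (intro pfun_compose[OF assms(1)])
      (auto simp: flat_def unflat_def matrix_matrix_mult_def entries_subset_iff
        intro!: pfun_sum pfun_mult pfun_coord pfun_const Ob_01)
  then show ?thesis by simp
qed

lemma subst_right_inverse:
  assumes "entries M \<subseteq> Ob" "M' ** M = mat 1" "x \<in> delta_ext p \<phi> Ob u"
  shows "subst_right M x \<in> delta_ext p \<phi> Ob u" "subst_right M' (subst_right M x) = x"
proof -
  obtain f where f: "f \<in> pfun Ob" "x = f (flat u)" using assms(3) unfolding delta_ext_eq_values by blast
  have e: "subst_right M x = (\<lambda>v. f (flat (unflat v ** M))) (flat u)"
    by (simp add: f subst_right_eq)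
  show "subst_right M x \<in> delta_ext p \<phi> Ob u"
    unfolding e delta_ext_eq_values
    by (intro CollectI exI[of _ "\<lambda>v. f (flat (unflat v ** M))"] conjI refl pfun_right_mult[OF f(1) assms(1)])
  have "subst_right M' (subst_right M x) = f (flat (u ** M' ** M))"
    unfolding e subst_right_eq[OF pfun_right_mult[OF f(1) assms(1)]] by simp
  then show "subst_right M' (subst_right M x) = x"
    by (simp add: assms(2) f flip: matrix_mul_assoc)
qed

text \<open>For monomial M each entry of uM is a single product, so (uM)^(p) = u^(p) \<phi>(M).
  Hence uM satisfies the same \<phi>-equation as u, and the substitution commutes with \<phi>;
  cancelling p gives the same for \<delta>.\<close>

lemma Ndelta_subset_Ggal: "Ndelta p \<phi> \<subseteq> Ggal p \<phi> Ob u"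
proof
  fix M :: "'r^'n^'n" assume M: "M \<in> Ndelta p \<phi>"
  let ?A = "delta_ext p \<phi> Ob u"
  obtain \<pi> d where \<pi>: "\<pi> permutes UNIV" "\<And>i. d i dvd 1" "M = perm_mat \<pi> ** diag_mat d"
    and MR: "entries M \<subseteq> Rdelta p \<phi>"
    using M by (auto simp: Ndelta_def Ngrp_def)
  have ME: "M $ i $ j = (if i = \<pi> j then d j else 0)" for i j by (simp add: \<pi>(3) Ndelta_entry)
  have MO: "entries M \<subseteq> Ob" using MR RO by auto
  have dR: "d j \<in> Rdelta p \<phi>" for j
  proof -
    have "d j = M $ \<pi> j $ j" by (simp add: ME)
    then show ?thesis using MR by (simp add: entries_subset_iff)
  qed
  have "\<exists>e. e * d j = 1" for j using \<pi>(2)[of j] by (auto simp: dvd_def mult.commute)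
  then obtain e where e: "\<And>j. e j * d j = 1" by metis
  have eR: "e j \<in> Rdelta p \<phi>" for j
  proof -
    have "\<phi> (e j) * d j ^ p = \<phi> (e j * d j)" using dR[of j] by (simp add: phi_simps Rdelta_iff)
    then have "\<phi> (e j) * d j ^ p * e j ^ p = e j ^ p" by (simp add: e phi_simps)
    moreover have "d j ^ p * e j ^ p = 1" by (metis e mult.commute power_mult_distrib power_one)
    ultimately have "\<phi> (e j) = e j ^ p" by (metis mult.assoc mult.right_neutral)
    then show ?thesis by (simp add: Rdelta_iff)
  qed
  \<comment> \<open>The inverse of M is written out because its entries must lie in O: they are 0 or
    the inverses \<open>e i\<close>, which belong to \<open>Rdelta\<close>.\<close>
  define M' :: "'r^'n^'n" where "M' = (\<chi> i j. if j = \<pi> i then e i else 0)"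
  have M'O: "entries M' \<subseteq> Ob" using eR RO Ob_01 by (auto simp: entries_def M'_def)
  have inj\<pi>: "\<pi> i = \<pi> j \<longleftrightarrow> i = j" for i j using permutes_inj[OF \<pi>(1)] by (auto dest: injD)
  have M'M: "M' ** M = mat 1"
    by (simp add: vec_eq_iff matrix_matrix_mult_def M'_def ME mat_def e inj\<pi> if_distrib[of "\<lambda>x. x * _"] cong: if_cong)
  have "invertible M'"
  proof -
    have "det M' * det M = 1" using M'M by (metis det_I det_mul)
    then have "det M' dvd 1" by (metis dvd_triv_left)
    then show ?thesis by (rule invertible_if_det_unit[OF iota_hom iota_inj])
  qed
  note I = matrix_inv_inverse[OF this]
  have "M = (matrix_inv M' ** M') ** M" by (simp add: I)
  also have "\<dots> = matrix_inv M'" by (simp add: M'M flip: matrix_mul_assoc)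
  finally have MM': "M ** M' = mat 1" using I by simp
  have GL: "M \<in> GL_over Ob" unfolding GL_over_def using MO M'O MM' M'M by blast
  let ?\<sigma> = "subst_right M"
  have hom: "?\<sigma> (x + y) = ?\<sigma> x + ?\<sigma> y" "?\<sigma> (x * y) = ?\<sigma> x * ?\<sigma> y" if xy: "x \<in> ?A" "y \<in> ?A" for x y
  proof -
    obtain f g where fg: "f \<in> pfun Ob" "g \<in> pfun Ob" "x = f (flat u)" "y = g (flat u)"
      using xy unfolding delta_ext_eq_values by blast
    show "?\<sigma> (x + y) = ?\<sigma> x + ?\<sigma> y"
      using subst_right_eq[OF pfun_add[OF fg(1,2)]] by (simp add: fg subst_right_eq)
    show "?\<sigma> (x * y) = ?\<sigma> x * ?\<sigma> y"
      using subst_right_eq[OF pfun_mult[OF fg(1,2)]] by (simp add: fg subst_right_eq)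
  qed
  have const: "?\<sigma> x = x" if "x \<in> Ob" for x
    using subst_right_eq[OF pfun_const[OF that]] .
  have ring: "ring_hom_on ?A ?\<sigma>"
    using hom const[OF Ob_01(2)] delta_ext_subring[OF Ob u alpha] by (simp add: ring_hom_on_def)
  have frobM: "mfrob p (u ** M) = mfrob p u ** mmap \<phi> M"
  proof -
    have "(u ** M) $ i $ j = u $ i $ \<pi> j * d j" for i j
      by (simp add: matrix_matrix_mult_def ME if_distrib[of "\<lambda>x. _ * x"] cong: if_cong)
    moreover have "(mfrob p u ** mmap \<phi> M) $ i $ j = (u $ i $ \<pi> j) ^ p * d j ^ p" for i j
    proof -
      have "mmap \<phi> M $ k $ j = (if k = \<pi> j then d j ^ p else 0)" for k
        using dR[of j] by (simp add: mmap_def ME phi_simps Rdelta_iff)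
      then show ?thesis
        by (simp add: matrix_matrix_mult_def mfrob_def mmap_def if_distrib[of "\<lambda>x. _ * x"] cong: if_cong)
    qed
    ultimately show ?thesis by (simp add: vec_eq_iff mfrob_def mmap_def power_mult_distrib)
  qed
  let ?E = "mat 1 + scaleP (alpha_of p \<phi> u)"
  have phiu: "mmap \<phi> u = ?E ** mfrob p u"
    by (rule phi_linear_equation) (simp add: alpha_of_mult[OF u])
  have EO: "?E $ i $ j \<in> Ob" for i j
    using alpha Ob_01 Ob_sub by (auto simp: scaleP_def mat_def is_subring_def entries_subset_iff)
  have phi: "?\<sigma> (\<phi> x) = \<phi> (?\<sigma> x)" if x: "x \<in> ?A" for x
  proof -
    obtain f where f: "f \<in> pfun Ob" "x = f (flat u)" using x unfolding delta_ext_eq_values by blast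
    obtain g where g: "g \<in> pfun Ob" "\<And>v. g (\<lambda>i. \<phi> (v i)) = \<phi> (f v)"
      using pfun_hom_image[OF phi_hom _ f(1)] Ob_01(5) by blast
    \<comment> \<open>This expresses \<phi>(f(u)) as a polynomial in u: g carries the twisted
      coefficients, and \<phi>(u) is replaced by (1 + p\<alpha>) u^(p).\<close>
    define h where "h v = g (\<lambda>ij. flat (?E ** mfrob p (unflat v)) ij)" for v
    have h: "h \<in> pfun Ob"
      unfolding h_def
      by (intro pfun_compose[OF g(1)])
        (auto simp: flat_def unflat_def matrix_matrix_mult_def mfrob_def mmap_def simp del: vector_add_component
          intro!: pfun_sum pfun_mult pfun_coord pfun_const pfun_power Ob_01 EO)
    have flatphi: "(\<lambda>i. \<phi> (flat w i)) = flat (mmap \<phi> w)" for w :: "'r^'n^'n"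
      by (simp add: flat_def mmap_def)
    have "\<phi> x = h (flat u)"
      unfolding f(2) g(2)[symmetric] h_def flatphi phiu by simp
    then have "?\<sigma> (\<phi> x) = h (flat (u ** M))" using subst_right_eq[OF h] by simp
    also have "\<dots> = g (flat (?E ** (mfrob p u ** mmap \<phi> M)))" by (simp add: h_def frobM)
    also have "?E ** (mfrob p u ** mmap \<phi> M) = mmap \<phi> (u ** M)"
      unfolding mmap_phi_mult phiu by (simp only: matrix_mul_assoc)
    also have "g (flat (mmap \<phi> (u ** M))) = \<phi> (f (flat (u ** M)))"
      unfolding g(2)[symmetric] flatphi ..
    also have "f (flat (u ** M)) = ?\<sigma> x" by (simp add: f subst_right_eq)
    finally show ?thesis .
  qed
  have sigu: "mmap ?\<sigma> u = u ** M"
  proof -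
    have "?\<sigma> (u $ i $ j) = (u ** M) $ i $ j" for i j
      using subst_right_eq[OF pfun_coord[of "(i, j)"]] by (simp add: flat_def)
    then show ?thesis by (simp add: mmap_def vec_eq_iff)
  qed
  have "?\<sigma> \<in> tildeG p \<phi> Ob u"
    unfolding tildeG_def Let_def mem_Collect_eq
  proof (intro conjI ballI)
    show "bij_betw ?\<sigma> ?A ?A"
      by (rule bij_betw_byWitness[where f' = "subst_right M'"])
        (use subst_right_inverse[OF MO M'M] subst_right_inverse[OF M'O MM'] in auto)
    show "?\<sigma> (x + y) = ?\<sigma> x + ?\<sigma> y" "?\<sigma> (x * y) = ?\<sigma> x * ?\<sigma> y" if "x \<in> ?A" "y \<in> ?A" for x y
      using hom that by auto
    show "?\<sigma> x = x" if "x \<in> Ob" for x using that by (rule const)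
    show "?\<sigma> (delta p \<phi> x) = delta p \<phi> (?\<sigma> x)" if x: "x \<in> ?A" for x
    proof -
      note sA = delta_ext_subring[OF Ob u alpha]
      have dA: "delta p \<phi> x \<in> ?A" by (rule delta_ext_delta[OF Ob u alpha x])
      have PA: "P \<in> ?A" by (rule is_subring_of_nat[OF sA])
      have "\<phi> x = x ^ p + P * delta p \<phi> x" by (rule phi_eq)
      then have "?\<sigma> (\<phi> x) = ?\<sigma> (x ^ p) + ?\<sigma> (P * delta p \<phi> x)"
        using hom_on_add[OF ring is_subring_power[OF sA x], of "P * delta p \<phi> x" p] dA PA sA
        by (simp add: is_subring_def)
      also have "\<dots> = ?\<sigma> x ^ p + P * ?\<sigma> (delta p \<phi> x)"
        by (simp only: hom_on_power[OF ring x] hom_on_mult[OF ring PA dA] hom_on_of_nat[OF ring])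
      finally have "P * ?\<sigma> (delta p \<phi> x) = P * delta p \<phi> (?\<sigma> x)"
        by (simp add: phi[OF x] P_delta)
      then show ?thesis using P_nonzero by simp
    qed
    have "matrix_inv u ** mmap ?\<sigma> u = M"
      unfolding sigu by (simp add: matrix_mul_assoc matrix_inv_inverse[OF u])
    then show "matrix_inv u ** mmap ?\<sigma> u \<in> GL_over Ob" using GL by simp
  qed
  with sigu show "M \<in> Ggal p \<phi> Ob u" using Ggal_iff[OF Ob u alpha] by blast
qed

lemma Ggal_eq_Ndelta: "Ggal p \<phi> Ob u = Ndelta p \<phi>"
  using Ggal_subset_Ndelta Ndelta_subset_Ggal by blast

end

end

section \<open>Jets under \<phi> and the construction of the base ring O\<close>

context delta_frobenius
begin

text \<open>Iterates of \<phi> are used instead of iterates of \<delta> because a homomorphism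
  passes through polynomial functions.\<close>

definition jet :: "'r^'n^'n \<Rightarrow> nat \<times> 'n \<times> 'n \<Rightarrow> 'r" where
  "jet u = (\<lambda>(k, i, j). (\<phi> ^^ k) (u $ i $ j))"

lemma jet_apply [simp]: "jet u (k, i, j) = (\<phi> ^^ k) (u $ i $ j)"
  by (simp add: jet_def)

definition jet_ring :: "'r^'n^'n \<Rightarrow> 'r set" where
  "jet_ring a = {f (jet a) | f. f \<in> pfun (Rdelta p \<phi>)}"

lemma jet_ring_subring: "is_subring (jet_ring a)"
  unfolding jet_ring_def by (intro pfun_values_subring Rdelta_consts)

lemma Rdelta_jet_ring: "Rdelta p \<phi> \<subseteq> jet_ring a"
proof
  fix x assume "x \<in> Rdelta p \<phi>"
  then show "x \<in> jet_ring a"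
    unfolding jet_ring_def by (intro CollectI exI[of _ "\<lambda>v. x"]) (simp add: pfun_const)
qed

lemma entry_jet_ring: "a $ i $ j \<in> jet_ring a"
  unfolding jet_ring_def by (intro CollectI exI[of _ "\<lambda>v. v (0, i, j)"]) (simp add: pfun_coord)

lemma phi_Rdelta: "x \<in> Rdelta p \<phi> \<Longrightarrow> \<phi> x \<in> Rdelta p \<phi>"
  by (simp add: Rdelta_iff phi_simps)

lemma phi_jet_ring:
  fixes a :: "'r^'n^'n"
  assumes "x \<in> jet_ring a" shows "\<phi> x \<in> jet_ring a"
proof -
  obtain f where f: "f \<in> pfun (Rdelta p \<phi>)" "x = f (jet a)" using assms by (auto simp: jet_ring_def)
  have "\<phi> ` Rdelta p \<phi> \<subseteq> Rdelta p \<phi>" using phi_Rdelta by blast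
  from pfun_hom_image[OF phi_hom this f(1)] obtain g where
    g: "g \<in> pfun (Rdelta p \<phi>)" "\<And>v. g (\<lambda>i. \<phi> (v i)) = \<phi> (f v)" by blast
  define h where "h v = g (\<lambda>i. v (Suc (fst i), snd i))" for v :: "nat \<times> 'n \<times> 'n \<Rightarrow> 'r"
  have "h \<in> pfun (Rdelta p \<phi>)"
    unfolding h_def by (rule pfun_compose[OF g(1) order_refl pfun_coord])
  moreover have "h (jet a) = \<phi> x"
  proof -
    have "(\<lambda>i. jet a (Suc (fst i), snd i)) = (\<lambda>i. \<phi> (jet a i))" by (auto simp: jet_def)
    then show ?thesis by (simp add: h_def f(2) g(2)[symmetric])
  qed
  ultimately show ?thesis unfolding jet_ring_def by (metis (mono_tags, lifting) mem_Collect_eq)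
qed

text \<open>With a = \<alpha> this is the ring O of part 2.\<close>

definition jet_field_ring :: "'r^'n^'n \<Rightarrow> 'r set" where
  "jet_field_ring a = fraction_closure (jet_ring a)"

lemma jet_field_ring_valuation: "valuation_subring \<iota> (jet_field_ring a)"
proof -
  let ?S = "jet_ring a"
  note S = jet_ring_subring[of a, unfolded is_subring_def]
  define F where "F = {z. \<exists>x\<in>?S. \<exists>y\<in>?S. y \<noteq> 0 \<and> z = \<iota> x / \<iota> y}"
  have FI: "\<iota> x / \<iota> y \<in> F" if "x \<in> ?S" "y \<in> ?S" "y \<noteq> 0" for x y
    unfolding F_def using that by blast
  have nz: "\<iota> x \<noteq> 0" if "x \<noteq> 0" for x
    using that iota_eq_iff[of x 0] by (simp add: iota_simps)
  have "is_subfield F"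
    unfolding is_subfield_def is_subring_def
  proof (intro conjI ballI impI)
    show "0 \<in> F" using FI[of 0 1] S by (simp add: iota_simps)
    show "1 \<in> F" using FI[of 1 1] S by (simp add: iota_simps)
    fix z assume "z \<in> F"
    then obtain x y where xy: "x \<in> ?S" "y \<in> ?S" "y \<noteq> 0" "z = \<iota> x / \<iota> y" by (auto simp: F_def)
    show "- z \<in> F" using FI[of "- x" y] xy S by (simp add: iota_simps)
    show "inverse z \<in> F" if z0: "z \<noteq> 0"
    proof -
      have "x \<noteq> 0" using z0 xy(4) by (auto simp: iota_simps)
      then show ?thesis using FI[of y x] xy by simp
    qed
    fix z' assume "z' \<in> F"
    then obtain x' y' where xy': "x' \<in> ?S" "y' \<in> ?S" "y' \<noteq> 0" "z' = \<iota> x' / \<iota> y'" by (auto simp: F_def)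
    have "z + z' = \<iota> (x * y' + x' * y) / \<iota> (y * y')"
      using xy xy' nz by (simp add: iota_simps field_simps)
    then show "z + z' \<in> F" using FI[of "x * y' + x' * y" "y * y'"] xy xy' S by simp
    have "z * z' = \<iota> (x * x') / \<iota> (y * y')" using xy xy' by (simp add: iota_simps)
    then show "z * z' \<in> F" using FI[of "x * x'" "y * y'"] xy xy' S by simp
  qed
  moreover have "jet_field_ring a = {x. \<iota> x \<in> F}"
  proof (rule subset_antisym; rule subsetI)
    fix x assume "x \<in> jet_field_ring a"
    then obtain c b where "c \<in> ?S" "b \<in> ?S" "b \<noteq> 0" "b * x = c"
      by (auto simp: jet_field_ring_def fraction_closure_def)
    then show "x \<in> {x. \<iota> x \<in> F}" using FI[of c b] nz[of b] by (auto simp: iota_simps)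
  next
    fix x assume "x \<in> {x. \<iota> x \<in> F}"
    then obtain c b where cb: "c \<in> ?S" "b \<in> ?S" "b \<noteq> 0" "\<iota> x = \<iota> c / \<iota> b" by (auto simp: F_def)
    then have "\<iota> (b * x) = \<iota> c" using nz[of b] by (simp add: iota_simps)
    then have "b * x = c" by (simp only: iota_eq_iff)
    with cb show "x \<in> jet_field_ring a" by (auto simp: jet_field_ring_def fraction_closure_def)
  qed
  ultimately show ?thesis unfolding valuation_subring_def by blast
qed

lemma jet_ring_subset: "jet_ring a \<subseteq> jet_field_ring a"
proof
  fix x assume x: "x \<in> jet_ring a"
  have "1 \<in> jet_ring a" using jet_ring_subring[of a] by (simp add: is_subring_def)
  then show "x \<in> jet_field_ring a"
    unfolding jet_field_ring_def fraction_closure_def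
    by (intro CollectI bexI[OF _ x] bexI[of _ 1]) auto
qed

text \<open>\<phi> maps fractions to fractions, being injective on denominators. The division by p
  in \<delta>x = (\<phi>(x) - x^p)/p is absorbed because p belongs to
  \<open>jet_ring a\<close>.\<close>

lemma jet_field_ring_delta: "delta_subring p \<phi> (jet_field_ring a)"
proof -
  let ?S = "jet_ring a" and ?O = "jet_field_ring a"
  note S = jet_ring_subring[of a, unfolded is_subring_def]
  have sub: "is_subring ?O"
    using jet_field_ring_valuation[of a]
    by (auto simp: valuation_subring_def is_subfield_def is_subring_def iota_simps)
  have "delta p \<phi> x \<in> ?O" if x: "x \<in> ?O" for x
  proof -
    obtain c b where cb: "c \<in> ?S" "b \<in> ?S" "b \<noteq> 0" "b * x = c"
      using x by (auto simp: jet_field_ring_def fraction_closure_def)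
    have "\<phi> b \<noteq> 0"
    proof
      assume "\<phi> b = 0"
      then have "P ^ k dvd b" for k using phi_dvd_iff[of k b] by simp
      then show False using separated cb(3) by blast
    qed
    moreover have "\<phi> b * \<phi> x = \<phi> c" using cb(4) by (simp flip: phi_simps)
    ultimately have "\<phi> x \<in> ?O"
      using phi_jet_ring[OF cb(1)] phi_jet_ring[OF cb(2)]
      unfolding jet_field_ring_def fraction_closure_def by blast
    then have "\<phi> x - x ^ p \<in> ?O" using is_subring_diff[OF sub] is_subring_power[OF sub x] by blast
    then obtain c' b' where cb': "c' \<in> ?S" "b' \<in> ?S" "b' \<noteq> 0" "b' * (P * delta p \<phi> x) = c'"
      by (auto simp: jet_field_ring_def fraction_closure_def P_delta)
    have "P \<in> ?S" by (rule is_subring_of_nat[OF jet_ring_subring])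
    then have "b' * P \<in> ?S" "b' * P \<noteq> 0" "(b' * P) * delta p \<phi> x = c'"
      using cb' S P_nonzero by (auto simp: mult.assoc)
    with cb'(1) show ?thesis unfolding jet_field_ring_def fraction_closure_def by blast
  qed
  with sub show ?thesis by (simp add: delta_subring_def)
qed

text \<open>The jets of \<open>v\<close> can be expressed through \<open>v\<close> and the jets \<open>a k\<close> of the coefficient matrix by
  iterating \<open>\<phi>(v) = (1 + p\<alpha>) v\<^sup>(\<^sup>p\<^sup>)\<close>, for independent \<open>v\<close> and \<open>a\<close>.\<close>
primrec solution_jet :: "'r^'n^'n \<Rightarrow> (nat \<times> 'n \<times> 'n \<Rightarrow> 'r) \<Rightarrow> nat \<Rightarrow> 'r^'n^'n" where
  "solution_jet v a 0 = v"
| "solution_jet v a (Suc k) =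
     (mat 1 + scaleP (\<chi> i j. a (k, i, j))) ** mfrob p (solution_jet v a k)"

definition solution_jets :: "'r^'n^'n \<Rightarrow> (nat \<times> 'n \<times> 'n \<Rightarrow> 'r) \<Rightarrow> nat \<times> 'n \<times> 'n \<Rightarrow> 'r" where
  "solution_jets v a = (\<lambda>(k, i, j). solution_jet v a k $ i $ j)"

lemma mmap_funpow: "mmap (\<phi> ^^ k) (M ** N) = mmap (\<phi> ^^ k) M ** mmap (\<phi> ^^ k) N"
  by (rule mmap_mult[OF funpow_phi_hom]) auto

lemma solution_jets_alpha:
  assumes u: "invertible u"
  shows "solution_jets u (jet (alpha_of p \<phi> u)) = jet u"
proof -
  let ?a = "alpha_of p \<phi> u"
  have e: "mmap \<phi> u = (mat 1 + scaleP ?a) ** mfrob p u"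
    by (rule phi_linear_equation) (simp add: alpha_of_mult[OF u])
  have "solution_jet u (jet ?a) k = mmap (\<phi> ^^ k) u" for k
  proof (induction k)
    case 0
    then show ?case by (simp add: mmap_def vec_eq_iff)
  next
    case (Suc k)
    note h = hom_on_add[OF funpow_phi_hom UNIV_I UNIV_I] hom_on_mult[OF funpow_phi_hom UNIV_I UNIV_I]
      hom_on_0[OF funpow_phi_hom] hom_on_1[OF funpow_phi_hom] hom_on_of_nat[OF funpow_phi_hom]
      hom_on_power[OF funpow_phi_hom UNIV_I]
    have 1: "mmap (\<phi> ^^ k) (mat 1 + scaleP ?a) = mat 1 + scaleP (\<chi> i j. jet ?a (k, i, j))"
      by (simp add: mmap_def mat_def scaleP_def vec_eq_iff h)
    have 2: "mmap (\<phi> ^^ k) (mfrob p u) = mfrob p (mmap (\<phi> ^^ k) u)"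
      by (simp add: mmap_def mfrob_def vec_eq_iff h)
    have "mmap (\<phi> ^^ Suc k) u = mmap (\<phi> ^^ k) (mmap \<phi> u)"
      by (simp add: mmap_def vec_eq_iff funpow_swap1)
    then show ?case by (simp only: e mmap_funpow 1 2 solution_jet.simps Suc.IH)
  qed
  then show ?thesis by (auto simp: solution_jets_def mmap_def)
qed

lemma invertible_solution_jet:
  fixes v :: "'r^'n^'n"
  assumes "invertible v"
  shows "invertible (solution_jet v a k)"
proof (induction k)
  case 0
  then show ?case using assms by simp
next
  case (Suc k)
  have "invertible (mat 1 :: 'r^'n^'n)" by (auto simp: invertible_def intro: exI[of _ "mat 1"])
  then have "invertible (mat 1 + scaleP (\<chi> i j. a (k, i, j)) :: 'r^'n^'n)"
    by (rule invertible_if_cong) (simp add: scaleP_def)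
  then show ?case using invertible_mfrob[OF Suc] by (simp add: invertible_mult)
qed

text \<open>The recursion is inverted: with B the p-th power of the k-th solution jet, p a_k B is
  the next jet minus B, so Cramer's rule writes a_k as a quotient of polynomials in the jets. The
  denominator is p times a determinant that is a unit for invertible v.\<close>

lemma solution_jets_denominators:
  fixes F :: "(('n::finite \<times> 'n) + (nat \<times> 'n \<times> 'n) \<Rightarrow> 'r) \<Rightarrow> 'r"
  assumes "F \<in> pfun (Rdelta p \<phi>)"
  shows "\<exists>N\<in>pfun (Rdelta p \<phi>). \<exists>d\<in>pfun (Rdelta p \<phi>). \<forall>v a.
     N (solution_jets v a) = d (solution_jets v a) * F (case_sum (flat v) a) \<and>
     (invertible v \<longrightarrow> d (solution_jets v a) \<noteq> 0)"
  using assms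
proof (induction rule: pfun.induct)
  case (pfun_const c)
  then show ?case
    using Rdelta_consts by (intro bexI[of _ "\<lambda>v. c"] bexI[of _ "\<lambda>v. 1"]) (auto intro: pfun.pfun_const)
next
  case (pfun_coord x)
  show ?case
  proof (cases x)
    case (Inl ij)
    then show ?thesis
      using Rdelta_consts
      by (intro bexI[of _ "\<lambda>v. v (0, ij)"] bexI[of _ "\<lambda>v. 1"])
        (auto intro: pfun.pfun_const pfun.pfun_coord simp: solution_jets_def flat_def split: prod.split)
  next
    case (Inr y)
    obtain k i j where y: "y = (k, i, j)" by (cases y) auto
    \<comment> \<open>The transposed system: the unknown is row i of p a_k, the matrix is the
      transpose of B, and column j is replaced by the right side.\<close>
    define N where "N w = det (\<chi> m l. if l = j then w (Suc k, i, m) - w (k, i, m) ^ p else w (k, l, m) ^ p)"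
      for w :: "nat \<times> 'n \<times> 'n \<Rightarrow> 'r"
    define d where "d w = P * det (\<chi> m l. w (k, l, m) ^ p)" for w :: "nat \<times> 'n \<times> 'n \<Rightarrow> 'r"
    have NC: "N \<in> pfun (Rdelta p \<phi>)"
    proof -
      have "(\<lambda>w. (\<chi> m l. if l = j then w (Suc k, i, m) - w (k, i, m) ^ p else w (k, l, m) ^ p) $ m $ l)
          \<in> pfun (Rdelta p \<phi>)" for m l
        by (cases "l = j") (simp_all add: pfun_diff pfun_power pfun.pfun_coord Rdelta_consts)
      then show ?thesis unfolding N_def by (intro pfun_det Rdelta_consts)
    qed
    have dC: "d \<in> pfun (Rdelta p \<phi>)"
    proof -
      have "(\<lambda>w. (\<chi> m l. w (k, l, m) ^ p) $ m $ l) \<in> pfun (Rdelta p \<phi>)" for m l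
        by (simp add: pfun_power pfun.pfun_coord Rdelta_consts)
      then show ?thesis unfolding d_def by (intro pfun.pfun_mult pfun_of_nat pfun_det Rdelta_consts)
    qed
    have "N (solution_jets v a) = d (solution_jets v a) * a y" for v a
    proof -
      let ?B = "mfrob p (solution_jet v a k)"
      let ?A = "(\<chi> m l. ?B $ l $ m) :: 'r^'n^'n"
      define x where "x = ((\<chi> l. P * a (k, i, l)) :: 'r^'n)"
      have Ax: "(?A *v x) $ m = solution_jet v a (Suc k) $ i $ m - ?B $ i $ m" for m
        by (simp add: matrix_mult_add_left scaleP_mult)
          (simp add: scaleP_def matrix_matrix_mult_def matrix_vector_mult_def x_def sum_distrib_left mult_ac)
      have "N (solution_jets v a) = det (\<chi> m l. if l = j then (?A *v x) $ m else ?A $ m $ l)"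
        unfolding N_def Ax
        by (intro arg_cong[of _ _ det]) (simp add: vec_eq_iff solution_jets_def mfrob_def mmap_def)
      also have "\<dots> = x $ j * det ?A" by (rule cramer_domain[OF iota_hom iota_inj])
      also have "\<dots> = d (solution_jets v a) * a y"
        by (simp add: x_def d_def y solution_jets_def mfrob_def mmap_def)
      finally show ?thesis .
    qed
    moreover have "d (solution_jets v a) \<noteq> 0" if "invertible v" for v a
    proof -
      let ?B = "mfrob p (solution_jet v a k)"
      have "det ?B dvd 1" by (intro invertible_det_unit invertible_mfrob invertible_solution_jet that)
      then have "det ?B \<noteq> 0" by auto
      moreover have "(\<chi> m l. solution_jets v a (k, l, m) ^ p) = transpose ?B"
        by (simp add: transpose_def vec_eq_iff solution_jets_def mfrob_def mmap_def)
      ultimately show ?thesis using P_nonzero by (simp add: d_def)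
    qed
    ultimately show ?thesis
      using Inr NC dC by (intro bexI[OF _ NC] bexI[OF _ dC]) auto
  qed
next
  case (pfun_add f g)
  then obtain N d N' d' where h: "N \<in> pfun (Rdelta p \<phi>)" "d \<in> pfun (Rdelta p \<phi>)"
    "N' \<in> pfun (Rdelta p \<phi>)" "d' \<in> pfun (Rdelta p \<phi>)"
    "\<And>v a. N (solution_jets v a) = d (solution_jets v a) * f (case_sum (flat v) a) \<and>
       (invertible v \<longrightarrow> d (solution_jets v a) \<noteq> 0)"
    "\<And>v a. N' (solution_jets v a) = d' (solution_jets v a) * g (case_sum (flat v) a) \<and>
       (invertible v \<longrightarrow> d' (solution_jets v a) \<noteq> 0)" by blast
  show ?case
    using h
    by (intro bexI[of _ "\<lambda>w. N w * d' w + N' w * d w"] bexI[of _ "\<lambda>w. d w * d' w"] pfun.pfun_add pfun.pfun_mult)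
      (auto simp: algebra_simps)
next
  case (pfun_mult f g)
  then obtain N d N' d' where h: "N \<in> pfun (Rdelta p \<phi>)" "d \<in> pfun (Rdelta p \<phi>)"
    "N' \<in> pfun (Rdelta p \<phi>)" "d' \<in> pfun (Rdelta p \<phi>)"
    "\<And>v a. N (solution_jets v a) = d (solution_jets v a) * f (case_sum (flat v) a) \<and>
       (invertible v \<longrightarrow> d (solution_jets v a) \<noteq> 0)"
    "\<And>v a. N' (solution_jets v a) = d' (solution_jets v a) * g (case_sum (flat v) a) \<and>
       (invertible v \<longrightarrow> d' (solution_jets v a) \<noteq> 0)" by blast
  show ?case
    using h
    by (intro bexI[of _ "\<lambda>w. N w * N' w"] bexI[of _ "\<lambda>w. d w * d' w"] pfun.pfun_mult)
      (auto simp: algebra_simps)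
qed

definition delta_generic :: "'r^'n^'n \<Rightarrow> bool" where
  "delta_generic u \<longleftrightarrow> (\<forall>f\<in>pfun (Rdelta p \<phi>). f (jet u) = 0 \<longrightarrow> (\<forall>y. f y = 0))"

text \<open>A relation f over O, with denominators cleared, becomes a relation F in u and the jets
  of \<alpha>, and then a relation N in the jets of u alone. Thus N vanishes identically, and
  reading it back with \<alpha> fixed and u replaced by any invertible w gives f(w) = 0.\<close>

lemma delta_generic_imp_generic:
  fixes u :: "'r^'n^'n"
  assumes u: "invertible u" and gen: "delta_generic u"
  shows "generic (jet_field_ring (alpha_of p \<phi> u)) u"
  unfolding generic_def
proof (intro ballI impI allI)
  let ?a = "alpha_of p \<phi> u"
  fix f v assume f: "f \<in> pfun (jet_field_ring ?a)" "f (flat u) = 0"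
  obtain b where b: "b \<noteq> 0" "(\<lambda>v. b * f v) \<in> pfun (jet_ring ?a)"
    using pfun_clear_denominators[OF jet_ring_subring f(1)[unfolded jet_field_ring_def]] by blast
  from pfun_over_values[OF b(2)[unfolded jet_ring_def]]
  obtain F where F: "F \<in> pfun (Rdelta p \<phi>)" "\<And>v. b * f v = F (case_sum v (jet ?a))" by blast
  obtain N d where Nd: "N \<in> pfun (Rdelta p \<phi>)"
    "\<And>v a. N (solution_jets v a) = d (solution_jets v a) * F (case_sum (flat v) a)"
    "\<And>v a. invertible v \<Longrightarrow> d (solution_jets v a) \<noteq> 0"
    using solution_jets_denominators[OF F(1)] by blast
  have "N (jet u) = 0"
    using Nd(2)[of u "jet ?a"] F(2)[of "flat u"] f(2) by (simp add: solution_jets_alpha[OF u])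
  then have N0: "N y = 0" for y using gen Nd(1) unfolding delta_generic_def by blast
  have inv: "f (flat w) = 0" if w: "invertible w" for w
  proof -
    have "F (case_sum (flat w) (jet ?a)) = 0"
      using Nd(2)[of w "jet ?a"] Nd(3)[OF w, of "jet ?a"] N0 by simp
    then show ?thesis using F(2)[of "flat w"] b(1) by simp
  qed
  let ?one = "flat (mat 1 :: 'r^'n^'n)"
  \<comment> \<open>On the line from 1 to v the points with parameter pk are congruent to 1 modulo
    p, hence invertible, and supply infinitely many zeros.\<close>
  have "f (\<lambda>i. ?one i + 1 * (v i - ?one i)) = 0"
  proof (rule pfun_zero_on_line[OF f(1)])
    show "infinite (range (\<lambda>k. P * of_nat k))"
    proof (rule range_inj_infinite)
      show "inj (\<lambda>k. P * of_nat k :: 'r)"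
        using inj_of_nat P_nonzero by (auto simp: inj_def)
    qed
    fix t assume "t \<in> range (\<lambda>k. P * of_nat k)"
    then obtain k where t: "t = P * of_nat k" by blast
    define w where "w = unflat (\<lambda>i. ?one i + t * (v i - ?one i))"
    have "invertible (mat 1 :: 'r^'n^'n)" by (auto simp: invertible_def intro: exI[of _ "mat 1"])
    then have "invertible w"
      by (rule invertible_if_cong) (simp add: w_def unflat_def flat_def t mult.assoc)
    from inv[OF this] show "f (\<lambda>i. ?one i + t * (v i - ?one i)) = 0" by (simp add: w_def)
  qed
  then show "f v = 0" by simp
qed

theorem delta_generic_Galois:
  assumes u: "invertible u" and gen: "delta_generic u"
  shows "\<exists>Ob. valuation_subring \<iota> Ob \<and> delta_subring p \<phi> Ob \<and> Rdelta p \<phi> \<subseteq> Ob \<and>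
     entries (alpha_of p \<phi> u) \<subseteq> Ob \<and> Ggal p \<phi> Ob u = Ndelta p \<phi>"
proof -
  let ?O = "jet_field_ring (alpha_of p \<phi> u)"
  have R: "Rdelta p \<phi> \<subseteq> ?O" using Rdelta_jet_ring jet_ring_subset by blast
  have a: "entries (alpha_of p \<phi> u) \<subseteq> ?O"
    unfolding entries_subset_iff using entry_jet_ring jet_ring_subset by blast
  have "Ggal p \<phi> ?O u = Ndelta p \<phi>"
    by (rule Ggal_eq_Ndelta[OF jet_field_ring_delta u a R delta_generic_imp_generic[OF u gen]])
  with R a jet_field_ring_valuation jet_field_ring_delta show ?thesis by blast
qed

end

section \<open>Genericity in the sense of category\<close>

lemma degree_linear_factors: "finite R \<Longrightarrow> degree (\<Prod>r\<in>R. [:- z r, 1:] :: 'r::idom poly) = card R"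
  by (subst degree_prod_sum_eq) auto

lemma poly_eq_sum_atMost:
  fixes g :: "'r::comm_ring_1 poly"
  assumes "degree g \<le> K"
  shows "poly g x = (\<Sum>t\<le>K. coeff g t * x ^ t)"
  unfolding poly_altdef using assms by (intro sum.mono_neutral_left) (auto simp: coeff_eq_0)

text \<open>Lagrange interpolation without division: everything is multiplied by the product of all
  denominators, and \<open>E s\<close> is that product without the factor of node s.\<close>

lemma interpolation_scaled:
  fixes z :: "nat \<Rightarrow> 'r::idom"
  shows "\<exists>c. \<forall>s\<le>K. (\<Sum>t\<le>K. c t * z s ^ t) = (\<Prod>s\<le>K. \<Prod>r\<in>{..K} - {s}. z s - z r) * w s"
proof -
  define E where "E s = (\<Prod>s'\<in>{..K} - {s}. \<Prod>r\<in>{..K} - {s'}. z s' - z r)" for s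
  define L where "L s = (\<Prod>r\<in>{..K} - {s}. [:- z r, 1:])" for s
  define g where "g = (\<Sum>s\<le>K. smult (w s * E s) (L s))"
  have Lself: "poly (L s) (z s) = (\<Prod>r\<in>{..K} - {s}. z s - z r)" for s
    by (simp add: L_def poly_prod)
  have Lother: "poly (L s) (z s') = 0" if "s' \<le> K" "s' \<noteq> s" for s s'
    unfolding L_def poly_prod using that by (intro prod_zero) auto
  have "poly g (z s) = (\<Prod>s\<le>K. \<Prod>r\<in>{..K} - {s}. z s - z r) * w s" if s: "s \<le> K" for s
  proof -
    have "poly g (z s) = (\<Sum>s'\<le>K. if s' = s then w s * E s * poly (L s) (z s) else 0)"
      unfolding g_def poly_sum poly_smult using Lother[OF s] by (intro sum.cong) auto
    also have "\<dots> = w s * (poly (L s) (z s) * E s)" using s by (simp add: mult_ac)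
    also have "poly (L s) (z s) * E s = (\<Prod>s\<le>K. \<Prod>r\<in>{..K} - {s}. z s - z r)"
      unfolding Lself E_def using s by (subst prod.remove[of "{..K}" s]) auto
    finally show ?thesis by (simp add: mult.commute)
  qed
  moreover have "degree g \<le> K"
    unfolding g_def
  proof (rule degree_sum_le)
    fix s assume "s \<in> {..K}"
    then have "degree (L s) = K" unfolding L_def by (subst degree_linear_factors) auto
    then show "degree (smult (w s * E s) (L s)) \<le> K" using degree_smult_le[of "w s * E s" "L s"] by simp
  qed simp
  ultimately show ?thesis using poly_eq_sum_atMost[of g K] by (intro exI[of _ "coeff g"]) auto
qed

lemma dvd_entries_iff: "(\<forall>x\<in>entries M. d dvd x) \<longleftrightarrow> (\<forall>i j. d dvd M $ i $ j)"
  by (auto simp: entries_def)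

context delta_frobenius
begin

lemma phi_inj: "\<phi> x = \<phi> y \<Longrightarrow> x = y"
proof -
  assume "\<phi> x = \<phi> y"
  then have "\<phi> (x - y) = 0" by (simp add: phi_simps)
  then have "P ^ k dvd x - y" for k using phi_dvd_iff[of k "x - y"] by simp
  then have "x - y = 0" by (rule separated)
  then show "x = y" by simp
qed

lemma funpow_phi_inj: "(\<phi> ^^ k) x = (\<phi> ^^ k) y \<Longrightarrow> x = y"
  by (induction k) (auto dest: phi_inj)

text \<open>A coincidence of conjugates would put the residue of z in a finite field with p^(r-s)
  elements. The residue field is algebraically closed, so the product of the X^(p^j) - X takes the
  value 1 modulo p at some z, where no factor vanishes.\<close>

lemma distinct_conjugates: "\<exists>z. \<forall>s\<le>K. \<forall>r\<le>K. s \<noteq> r \<longrightarrow> (\<phi> ^^ s) z \<noteq> (\<phi> ^^ r) z"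
proof -
  define h where "h j = monom (1::'r) (p ^ j) - monom 1 1" for j
  \<comment> \<open>The bound \<open>Suc K\<close> keeps the product nonempty, and so g nonconstant,
    for K = 0.\<close>
  define g where "g = (\<Prod>j\<in>{1..Suc K}. h j)"
  have h: "degree (h j) = p ^ j \<and> lead_coeff (h j) = 1" if "j \<ge> 1" for j
  proof -
    have pj: "p ^ j > 1" using prime_gt_1_nat[OF prime_p] that by (intro one_less_power) auto
    have "degree (h j) \<le> p ^ j"
      unfolding h_def using pj by (intro degree_diff_le) (auto simp: degree_monom_eq)
    moreover have "coeff (h j) (p ^ j) = 1" using pj by (simp add: h_def)
    ultimately show ?thesis using le_degree[of "h j" "p ^ j"] by (simp add: le_antisym)
  qed
  have h0: "h j \<noteq> 0" if "j \<ge> 1" for j using h[OF that] by auto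
  have "degree g = (\<Sum>j\<in>{1..Suc K}. degree (h j))"
    unfolding g_def using h0 by (intro degree_prod_sum_eq) auto
  also have "\<dots> \<ge> degree (h 1)" by (rule member_le_sum) auto
  finally have dg: "degree g \<ge> 1" using h[of 1] p_gt_0 by simp
  have lg: "lead_coeff g = 1"
  proof -
    have h1: "lead_coeff (h j) = 1" if "j \<ge> 1" for j using h[OF that] ..
    have lc: "lead_coeff (\<Prod>j\<in>J. h j) = 1" if "finite J" "J \<subseteq> {1..}" for J
      using that by (induction J rule: finite_induct) (simp_all add: lead_coeff_mult h1)
    show ?thesis unfolding g_def by (rule lc) auto
  qed
  have df: "degree (g - 1) = degree g"
  proof (rule antisym)
    show "degree (g - 1) \<le> degree g" using degree_diff_le_max[of g 1] by simp
    have "coeff (g - 1) (degree g) = 1" using lg dg by simp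
    then show "degree g \<le> degree (g - 1)" by (intro le_degree) simp
  qed
  then have "lead_coeff (g - 1) = 1" using lg dg by simp
  with df dg obtain z where z: "P dvd poly (g - 1) z"
    using setting unfolding delta_setting_def residue_field_alg_closure_Fp_def by (metis (no_types))
  have nz: "\<not> P dvd z ^ (p ^ j) - z" if "j \<in> {1..Suc K}" for j
  proof
    assume "P dvd z ^ (p ^ j) - z"
    then have "P dvd poly (h j) z" by (simp add: h_def poly_monom)
    also have "poly (h j) z dvd poly g z"
      unfolding g_def poly_prod using that by (intro dvd_prodI) auto
    finally have "P dvd poly g z" .
    then have "P dvd poly g z - poly (g - 1) z" using z by (rule dvd_diff)
    then show False using P_nonunit by simp
  qed
  have ne: "(\<phi> ^^ s) z \<noteq> (\<phi> ^^ r) z" if "s < r" "r \<le> K" for s r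
  proof
    assume eq: "(\<phi> ^^ s) z = (\<phi> ^^ r) z"
    have "(\<phi> ^^ r) z = (\<phi> ^^ s) ((\<phi> ^^ (r - s)) z)"
      using that by (simp flip: funpow_add comp_apply[of "\<phi> ^^ s"])
    with eq have "(\<phi> ^^ (r - s)) z = z" using funpow_phi_inj by metis
    then have "P dvd z - z ^ (p ^ (r - s))" using dvd_funpow_phi[of "r - s" z] by simp
    then have "P dvd z ^ (p ^ (r - s)) - z" by (subst dvd_diff_swap)
    moreover have "r - s \<in> {1..Suc K}" using that by auto
    ultimately show False using nz by blast
  qed
  show ?thesis
  proof (intro exI[of _ z] allI impI)
    fix s r assume "s \<le> K" "r \<le> K" "s \<noteq> r"
    then show "(\<phi> ^^ s) z \<noteq> (\<phi> ^^ r) z" using ne[of s r] ne[of r s] by (cases "s < r") auto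
  qed
qed

text \<open>The jets of the matrices in a ball contain all natural combinations of the vectors
  \<open>\<lambda>s. (\<phi>\<^sup>s z)\<^sup>t\<close>, which span by interpolation.\<close>
lemma jets_dense:
  fixes u :: "'r^'n^'n"
  assumes f: "f \<in> pfun C" and zero: "\<And>x. f (jet (\<chi> i j. u $ i $ j + P ^ m * x i j)) = 0"
  shows "f y = 0"
proof -
  obtain I where I: "finite I" "\<And>v w. (\<forall>i\<in>I. v i = w i) \<Longrightarrow> f v = f w"
    using pfun_finite_support[OF f] by metis
  obtain K where K: "\<And>s i j. (s, i, j) \<in> I \<Longrightarrow> s \<le> K"
  proof -
    have "finite (fst ` I)" using I(1) by simp
    then obtain K where "\<forall>s\<in>fst ` I. s \<le> K" using finite_nat_set_iff_bounded_le by blast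
    then show ?thesis by (intro that[of K]) force
  qed
  obtain z where z: "\<And>s r. s \<le> K \<Longrightarrow> r \<le> K \<Longrightarrow> s \<noteq> r \<Longrightarrow> (\<phi> ^^ s) z \<noteq> (\<phi> ^^ r) z"
    using distinct_conjugates[of K] by blast
  define zs where "zs s = (\<phi> ^^ s) z" for s
  \<comment> \<open>For natural c, which \<phi> fixes, this is the jet of the matrix with entries
    u_ij + p^m sum c z^t; for other c it is merely a point of jet space.\<close>
  define pt where "pt c = (\<lambda>(s, i, j). (\<phi> ^^ s) (u $ i $ j) + P ^ m * (\<Sum>t\<le>K. c (t, i, j) * zs s ^ t))"
    for c :: "nat \<times> 'n \<times> 'n \<Rightarrow> 'r"
  have pf: "(\<lambda>c. f (\<lambda>x. pt c x)) \<in> pfun UNIV"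
  proof (rule pfun_compose[OF f subset_UNIV])
    fix x :: "nat \<times> 'n \<times> 'n"
    obtain s i j where x: "x = (s, i, j)" by (cases x) auto
    show "(\<lambda>c. pt c x) \<in> pfun UNIV"
      unfolding pt_def x prod.case by (intro pfun_add pfun_mult pfun_sum pfun_const pfun_coord UNIV_I)
  qed
  have nat0: "f (\<lambda>x. pt (\<lambda>i. of_nat (c i)) x) = 0" for c
  proof -
    note h = hom_on_add[OF funpow_phi_hom UNIV_I UNIV_I] hom_on_mult[OF funpow_phi_hom UNIV_I UNIV_I]
      hom_on_sum[OF funpow_phi_hom UNIV_I] hom_on_of_nat[OF funpow_phi_hom] hom_on_power[OF funpow_phi_hom UNIV_I]
    have "pt (\<lambda>i. of_nat (c i)) x = jet (\<chi> i j. u $ i $ j + P ^ m * (\<Sum>t\<le>K. of_nat (c (t, i, j)) * z ^ t)) x" for x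
      by (cases x) (simp add: pt_def h zs_def)
    then show ?thesis using zero[of "\<lambda>i j. \<Sum>t\<le>K. of_nat (c (t, i, j)) * z ^ t"] by presburger
  qed
  \<comment> \<open>As a polynomial in c the value vanishes at all natural points, hence
    everywhere.\<close>
  have pt0: "f (pt c) = 0" for c
    by (rule pfun_zero_if_nat_zero[where f = "\<lambda>c. f (pt c)", OF inj_of_nat pf nat0])
  define D where "D = (\<Prod>s\<le>K. \<Prod>r\<in>{..K} - {s}. zs s - zs r)"
  have D: "D \<noteq> 0" unfolding D_def using z by (auto simp: zs_def)
  define a where "a = jet u"
  have "\<forall>i j. \<exists>c. \<forall>s\<le>K. (\<Sum>t\<le>K. c t * zs s ^ t) = D * (y (s, i, j) - a (s, i, j))"
    unfolding D_def by (intro allI interpolation_scaled)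
  then obtain c where c: "\<And>i j s. s \<le> K \<Longrightarrow> (\<Sum>t\<le>K. c i j t * zs s ^ t) = D * (y (s, i, j) - a (s, i, j))"
    by metis
  \<comment> \<open>On the line from the jet of u to y, the points with parameter p^m D k agree with
    points \<open>pt c\<close> on the support of f; D is the factor lost in the
    interpolation.\<close>
  have "f (\<lambda>x. a x + 1 * (y x - a x)) = 0"
  proof (rule pfun_zero_on_line[OF f])
    show "infinite (range (\<lambda>k. P ^ m * D * of_nat k))"
    proof (rule range_inj_infinite)
      show "inj (\<lambda>k. P ^ m * D * of_nat k :: 'r)"
        using inj_of_nat P_nonzero D by (auto simp: inj_def)
    qed
    fix t assume "t \<in> range (\<lambda>k. P ^ m * D * of_nat k)"
    then obtain k where t: "t = P ^ m * D * of_nat k" by blast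
    have "f (\<lambda>x. a x + t * (y x - a x)) = f (pt (\<lambda>(s, i, j). of_nat k * c i j s))"
    proof (rule I(2), rule ballI)
      fix x assume x: "x \<in> I"
      obtain s i j where x': "x = (s, i, j)" by (cases x) auto
      have sK: "s \<le> K" using K x x' by blast
      have "(\<Sum>t\<le>K. of_nat k * c i j t * zs s ^ t) = of_nat k * (D * (y (s, i, j) - a (s, i, j)))"
        unfolding c[OF sK, symmetric] by (simp add: sum_distrib_left mult.assoc)
      then show "a x + t * (y x - a x) = pt (\<lambda>(s, i, j). of_nat k * c i j s) x"
        by (simp add: x' pt_def a_def t mult_ac)
    qed
    then show "f (\<lambda>x. a x + t * (y x - a x)) = 0" by (simp add: pt0)
  qed
  then show ?thesis by simp
qed

text \<open>On \<open>Rdelta\<close> the map \<phi> is the p-th power, so a congruence improves by a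
  factor p and reduction is injective. Only finitely many elements lie in each
  \<open>frob_fixed m\<close>.\<close>

lemma countable_Rdelta: "countable (Rdelta p \<phi>)"
proof -
  have eq: "x = y" if x: "x \<in> Rdelta p \<phi>" "y \<in> Rdelta p \<phi>" "P dvd x - y" for x y
  proof -
    have "P ^ Suc k dvd x - y" for k
    proof (induction k)
      case 0
      then show ?case using x by simp
    next
      case (Suc k)
      have "P ^ Suc (Suc k) dvd x ^ p - y ^ p" using Suc by (intro power_dvd_diff_step) auto
      then have "P ^ Suc (Suc k) dvd \<phi> (x - y)" using x by (simp add: Rdelta_iff phi_simps)
      then show ?case by (simp only: phi_dvd_iff)
    qed
    then have "P ^ k dvd x - y" for k by (meson le_SucI order_refl power_le_dvd)
    then have "x - y = 0" by (rule separated)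
    then show ?thesis by simp
  qed
  have "finite (Rdelta p \<phi> \<inter> frob_fixed m)" if "m \<ge> 1" for m
  proof (rule finite_imageD)
    show "finite (residue ` (Rdelta p \<phi> \<inter> frob_fixed m))"
      by (rule finite_subset[OF _ finite_residues[OF that]]) blast
    show "inj_on residue (Rdelta p \<phi> \<inter> frob_fixed m)"
      using eq by (auto simp: inj_on_def residue_eq_iff)
  qed
  then have "countable (\<Union>m\<in>{1..}. Rdelta p \<phi> \<inter> frob_fixed m)"
    by (intro countable_UN) (auto intro: countable_finite)
  moreover have "Rdelta p \<phi> \<subseteq> (\<Union>m\<in>{1..}. Rdelta p \<phi> \<inter> frob_fixed m)"
    using frob_fixed_exists by fastforce
  ultimately show ?thesis by (rule countable_subset[rotated])
qed

text \<open>For distinct u and v separatedness bounds the exponents, so \<open>GREATEST\<close> is a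
  genuine maximum. Metric arguments reduce to divisibility through this equivalence.\<close>

lemma padic_dist_le_iff: "padic_dist p u v \<le> (1 / real p) ^ k \<longleftrightarrow> (\<forall>x\<in>entries (u - v). P ^ k dvd x)"
proof (cases "u = v")
  case True
  then show ?thesis by (auto simp: padic_dist_def entries_def)
next
  case False
  let ?S = "\<lambda>k. \<forall>x\<in>entries (u - v). P ^ k dvd x"
  obtain i j where "u $ i $ j \<noteq> v $ i $ j" using False by (auto simp: vec_eq_iff)
  then have nz: "(u - v) $ i $ j \<noteq> 0" by simp
  then obtain b where b: "\<not> P ^ b dvd (u - v) $ i $ j" using separated by blast
  have bound: "k \<le> b" if "?S k" for k
  proof (rule ccontr)
    assume "\<not> k \<le> b"
    then have "P ^ b dvd (u - v) $ i $ j" using that entries_mem[of "u - v" i j] by (meson le_cases power_le_dvd)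
    with b show False by blast
  qed
  have G: "?S (Greatest ?S)" by (rule GreatestI_nat[of ?S 0 b]) (use bound in auto)
  have Gle: "k \<le> Greatest ?S" if "?S k" for k using that bound by (rule Greatest_le_nat)
  have iff: "k \<le> Greatest ?S \<longleftrightarrow> ?S k"
    using G Gle by (meson power_le_dvd)
  have "padic_dist p u v \<le> (1 / real p) ^ k \<longleftrightarrow> k \<le> Greatest ?S"
    using False prime_gt_1_nat[OF prime_p] by (simp add: padic_dist_def power_decreasing_iff)
  from this iff show ?thesis by (rule trans)
qed

lemma padic_dist_nonneg: "padic_dist p (u :: 'r^'n^'n) v \<ge> 0"
  by (simp add: padic_dist_def)

lemma padic_dist_cases: "u = v \<or> (\<exists>k. padic_dist p u v = (1 / real p) ^ k)"
  by (auto simp: padic_dist_def)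

lemma padic_metric: "Metric_space (Xspace p :: ('r^'n^'n) set) (padic_dist p)"
proof
  fix u v w :: "'r^'n^'n"
  show "0 \<le> padic_dist p u v" by (rule padic_dist_nonneg)
  have sym: "(\<forall>x\<in>entries (u - v). P ^ k dvd x) \<longleftrightarrow> (\<forall>x\<in>entries (v - u). P ^ k dvd x)" for k
    unfolding dvd_entries_iff vector_minus_component
    by (intro iffI allI; subst dvd_diff_swap; blast)
  show "padic_dist p u v = padic_dist p v u"
    unfolding padic_dist_def sym by auto
  show "padic_dist p u v = 0 \<longleftrightarrow> u = v"
    using p_gt_0 by (simp add: padic_dist_def)
  have ultra: "padic_dist p u w \<le> (1 / real p) ^ k"
    if "padic_dist p u v \<le> (1 / real p) ^ k" "padic_dist p v w \<le> (1 / real p) ^ k" for k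
  proof -
    note d = that[unfolded padic_dist_le_iff dvd_entries_iff vector_minus_component, rule_format]
    show ?thesis
      unfolding padic_dist_le_iff dvd_entries_iff vector_minus_component
      by (intro allI dvd_diff_trans[OF d])
  qed
  show "padic_dist p u w \<le> padic_dist p u v + padic_dist p v w"
  proof (cases "u = v \<or> v = w")
    case True
    then show ?thesis using padic_dist_nonneg[of u v] padic_dist_nonneg[of v w] by auto
  next
    case False
    then obtain k l where kl: "padic_dist p u v = (1 / real p) ^ k" "padic_dist p v w = (1 / real p) ^ l"
      using padic_dist_cases by metis
    show ?thesis
    proof (cases "k \<le> l")
      case True
      then have "padic_dist p v w \<le> (1 / real p) ^ k"
        unfolding kl using p_gt_0 by (intro power_decreasing) auto
      then have "padic_dist p u w \<le> padic_dist p u v" using ultra[of k] kl by simp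
      then show ?thesis using padic_dist_nonneg[of v w] by linarith
    next
      case False
      then have "padic_dist p u v \<le> (1 / real p) ^ l"
        unfolding kl using p_gt_0 by (intro power_decreasing) auto
      then have "padic_dist p u w \<le> padic_dist p v w" using ultra[of l] kl by simp
      then show ?thesis using padic_dist_nonneg[of u v] by linarith
    qed
  qed
qed

text \<open>The zero set is closed because jets are continuous, and by \<open>jets_dense\<close> it
  contains no ball.\<close>

lemma nowhere_dense_jet_zeros:
  assumes f: "f \<in> pfun C" and nz: "f y \<noteq> 0"
  defines "T \<equiv> Metric_space.mtopology (Xspace p :: ('r^'n^'n) set) (padic_dist p)"
  shows "T interior_of (T closure_of {u \<in> Xspace p. f (jet u) = 0}) = {}"
proof -
  interpret Metric_space "Xspace p :: ('r^'n^'n) set" "padic_dist p" by (rule padic_metric)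
  let ?A = "{u \<in> Xspace p. f (jet u) = 0} :: ('r^'n^'n) set"
  have False if x: "x \<in> T interior_of (T closure_of ?A)" for x
  proof -
    obtain r where r: "r > 0" "mball x r \<subseteq> T closure_of ?A" and xX: "x \<in> Xspace p"
      using x unfolding T_def metric_interior_of by blast
    have p1: "1 / real p < 1" "1 / real p \<ge> 0" using prime_gt_1_nat[OF prime_p] by auto
    obtain m where m: "(1 / real p) ^ m < r" using real_arch_pow_inv[OF r(1) p1(1)] by blast
    \<comment> \<open>A positive exponent ensures that the perturbed matrix is congruent to x modulo
      p and stays in X.\<close>
    have m': "(1 / real p) ^ Suc m < r" using m p1 by (meson le_less_trans power_decreasing le_SucI order_refl less_imp_le)
    have "\<exists>d. f (jet (\<chi> i j. x $ i $ j + P ^ Suc m * d i j)) \<noteq> 0"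
      using jets_dense[OF f, of x "Suc m" y] nz by blast
    then obtain d where d: "f (jet (\<chi> i j. x $ i $ j + P ^ Suc m * d i j)) \<noteq> 0" by blast
    define u where "u = (\<chi> i j. x $ i $ j + P ^ Suc m * d i j)"
    have ux: "P ^ Suc m dvd x $ i $ j - u $ i $ j" for i j by (simp add: u_def del: power_Suc)
    have ux1: "P dvd x $ i $ j - u $ i $ j" for i j
      using ux[of i j] by (metis dvd_trans dvd_power zero_less_Suc)
    have uX: "u \<in> Xspace p"
    proof -
      have "invertible u" using xX invertible_if_cong[of x u] ux1 by (auto simp: Xspace_def)
      moreover have "P dvd u $ i $ j - (mat 1 :: 'r^'n^'n) $ i $ j" for i j
      proof -
        have "P dvd (x - mat 1) $ i $ j" using xX entries_mem[of "x - mat 1" i j] by (auto simp: Xspace_def)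
        then have "P dvd x $ i $ j - (mat 1 :: 'r^'n^'n) $ i $ j" by simp
        moreover have "P dvd u $ i $ j - x $ i $ j" using ux1[of i j] by (subst dvd_diff_swap)
        ultimately show ?thesis using dvd_diff_trans by blast
      qed
      ultimately show ?thesis by (auto simp: Xspace_def entries_def)
    qed
    have "padic_dist p x u \<le> (1 / real p) ^ Suc m"
      unfolding padic_dist_le_iff using ux by (auto simp: entries_def simp del: power_Suc)
    then have "u \<in> mball x r" using m' xX uX by simp
    then have "u \<in> T closure_of ?A" using r(2) by blast
    then have cl: "\<exists>w\<in>?A. w \<in> mball u s" if "s > 0" for s
      using that unfolding T_def metric_closure_of by blast
    have "f (jet u) \<noteq> 0" using d by (simp add: u_def)
    \<comment> \<open>Matrices congruent modulo p^M have jets congruent modulo p^M, so f has no zero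
      within distance p^(-M) of u.\<close>
    then obtain M where M: "\<not> P ^ M dvd f (jet u)" using separated by blast
    have "(1 / real p) ^ M > 0" using p_gt_0 by simp
    from cl[OF this] obtain w where w: "f (jet w) = 0" "padic_dist p u w < (1 / real p) ^ M" by auto
    then have "\<forall>x\<in>entries (u - w). P ^ M dvd x" using padic_dist_le_iff[of u w M] by simp
    then have uw: "P ^ M dvd u $ i $ j - w $ i $ j" for i j
      using entries_mem[of "u - w" i j] by auto
    have cong: "P ^ M dvd (\<phi> ^^ k) x - (\<phi> ^^ k) y" if "P ^ M dvd x - y" for k x y
      using that by (induction k) (auto dest: phi_dvd_diff)
    have "P ^ M dvd jet u i - jet w i" for i by (cases i) (simp add: cong uw)
    then have "P ^ M dvd f (jet u) - f (jet w)" by (intro pfun_dvd_diff[OF f])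
    then show False using M w by simp
  qed
  then show ?thesis by blast
qed

text \<open>The coefficients come from the countable set \<open>Rdelta\<close>, so the functions
  that are not identically zero can be enumerated, each contributing one nowhere dense zero
  set.\<close>

theorem first_category_nongeneric:
  "\<exists>\<Omega> :: ('r^'n^'n) set. first_category (Metric_space.mtopology (Xspace p) (padic_dist p)) \<Omega> \<and>
     (\<forall>u\<in>Xspace p - \<Omega>. invertible u \<and> delta_generic u)"
proof -
  interpret Metric_space "Xspace p :: ('r^'n^'n) set" "padic_dist p" by (rule padic_metric)
  let ?F = "{f \<in> pfun (Rdelta p \<phi>). \<exists>y. f y \<noteq> 0} :: ((nat \<times> 'n \<times> 'n \<Rightarrow> 'r) \<Rightarrow> 'r) set"
  have cF: "countable ?F"
    by (rule countable_subset[OF _ countable_pfun[OF countable_Rdelta]]) blast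
  have "(\<lambda>v. 1) \<in> ?F" using pfun_const[OF Rdelta_consts(2)] by simp
  then have ne: "?F \<noteq> {}" by blast
  define g where "g = from_nat_into ?F"
  have g: "range g = ?F" unfolding g_def using ne cF by (rule range_from_nat_into)
  let ?A = "\<lambda>i. {u \<in> Xspace p. g i (jet u) = 0} :: ('r^'n^'n) set"
  have "first_category mtopology (\<Union>i. ?A i)"
    unfolding first_category_def
  proof (intro exI[of _ ?A] conjI allI refl)
    fix i
    show "?A i \<subseteq> topspace mtopology" by auto
    obtain y where "g i \<in> pfun (Rdelta p \<phi>)" "g i y \<noteq> 0" using g by blast
    then show "mtopology interior_of (mtopology closure_of ?A i) = {}" by (rule nowhere_dense_jet_zeros)
  qed
  moreover have "invertible u \<and> delta_generic u" if u: "u \<in> Xspace p - (\<Union>i. ?A i)" for u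
  proof
    show "invertible u" using u by (simp add: Xspace_def)
    show "delta_generic u"
      unfolding delta_generic_def
    proof (intro ballI impI allI)
      fix f y assume f: "f \<in> pfun (Rdelta p \<phi>)" "f (jet u) = 0"
      show "f y = 0"
      proof (rule ccontr)
        assume "f y \<noteq> 0"
        then have "f \<in> range g" unfolding g using f(1) by blast
        then obtain i where "f = g i" by blast
        with u f(2) show False by auto
      qed
    qed
  qed
  ultimately show ?thesis by blast
qed

end

theorem theorem1p6:
  fixes p :: nat and \<phi> :: "'r::idom \<Rightarrow> 'r" and \<iota> :: "'r \<Rightarrow> 'a::field"
  assumes "delta_setting p \<phi> \<iota>"
  shows
    "(\<exists>\<Omega> :: ('a^'n::finite^'n) set. zariski_closed_GL \<Omega> \<and> mat 1 \<notin> \<Omega> \<and>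
       (\<forall>u :: 'r^'n^'n. invertible u \<and> mmap \<iota> u \<notin> \<Omega> \<longrightarrow>
         (\<forall>Ob. valuation_subring \<iota> Ob \<and> delta_subring p \<phi> Ob \<and>
               entries (alpha_of p \<phi> u) \<subseteq> Ob \<longrightarrow>
           (\<exists>H. H \<lhd> mat_group (Ggal p \<phi> Ob u) \<and>
                finite (rcosets\<^bsub>mat_group (Ggal p \<phi> Ob u)\<^esub> H) \<and>
                diagonalizable_over \<iota> H))))
     \<and>
     (\<exists>\<Omega> :: ('r^'n^'n) set.
        first_category (Metric_space.mtopology (Xspace p) (padic_dist p)) \<Omega> \<and>
        (\<forall>u \<in> Xspace p - \<Omega>.
          (\<exists>Ob. valuation_subring \<iota> Ob \<and> delta_subring p \<phi> Ob \<and> Rdelta p \<phi> \<subseteq> Ob \<and>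
               entries (alpha_of p \<phi> u) \<subseteq> Ob \<and> Ggal p \<phi> Ob u = Ndelta p \<phi>)))"
proof
  interpret delta_frobenius p \<phi> \<iota> using assms by (rule delta_frobenius.intro)
  have "zariski_closed_GL ({} :: ('a^'n^'n) set)"
    unfolding zariski_closed_GL_def
    by (intro exI[of _ "{\<lambda>M. 1}"]) (auto intro: polyfun.const)
  then show "\<exists>\<Omega> :: ('a^'n^'n) set. zariski_closed_GL \<Omega> \<and> mat 1 \<notin> \<Omega> \<and>
       (\<forall>u :: 'r^'n^'n. invertible u \<and> mmap \<iota> u \<notin> \<Omega> \<longrightarrow>
         (\<forall>Ob. valuation_subring \<iota> Ob \<and> delta_subring p \<phi> Ob \<and>
               entries (alpha_of p \<phi> u) \<subseteq> Ob \<longrightarrow>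
           (\<exists>H. H \<lhd> mat_group (Ggal p \<phi> Ob u) \<and>
                finite (rcosets\<^bsub>mat_group (Ggal p \<phi> Ob u)\<^esub> H) \<and>
                diagonalizable_over \<iota> H)))"
    by (intro exI[of _ "{}"] conjI allI impI Ggal_virtually_diagonalizable) auto
  from first_category_nongeneric obtain \<Omega> :: "('r^'n^'n) set" where
    \<Omega>: "first_category (Metric_space.mtopology (Xspace p) (padic_dist p)) \<Omega>"
      "\<forall>u\<in>Xspace p - \<Omega>. invertible u \<and> delta_generic u"
    by (elim exE conjE)
  then show "\<exists>\<Omega> :: ('r^'n^'n) set.
        first_category (Metric_space.mtopology (Xspace p) (padic_dist p)) \<Omega> \<and>
        (\<forall>u \<in> Xspace p - \<Omega>.
          (\<exists>Ob. valuation_subring \<iota> Ob \<and> delta_subring p \<phi> Ob \<and> Rdelta p \<phi> \<subseteq> Ob \<and>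
               entries (alpha_of p \<phi> u) \<subseteq> Ob \<and> Ggal p \<phi> Ob u = Ndelta p \<phi>))"
    by (intro exI[of _ \<Omega>] conjI ballI delta_generic_Galois) auto
qed

end
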